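(* Let $(M,g,f)$ be a non-compact gradient Ricci soliton, i.e. $(M,g)$ is a non-compact $n$-dimensional Riemannian manifold and $f$ is a smooth real-valued function on $M$ such that $\nabla^2 f+\mathrm{Ric}=\lambda g$ for some real constant $\lambda$. Suppose that $M$ has a pole at a point $p\in M$ and that $\mathrm{Ric}\ge 0$. If the potential function $f$ is at most linear along a geodesic ray $\sigma:[0,\infty)\to M$ (parametrized by arc length) with $\sigma(0)=p$, i.e. there are constants $a,b\in\mathbb{R}$ such that $f(\sigma(t))\le at+b$ for all $t\ge 0$, then the soliton is non-shrinking, i.e. $\lambda\le 0$.
   Context: All Riemannian manifolds are assumed complete, connected, orientable and without boundary. $\nabla^2 f$ denotes the Hessian of $f$ and $\mathrm{Ric}$ the Ricci tensor of $g$. $M$ has a pole at $p$ if the exponential map $\exp_p:T_pM\to M$ is a diffeomorphism. The soliton is called shrinking if $\lambda>0$, steady if $\lambda=0$ and expanding if $\lambda<0$. *)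

theory Defs
  imports "HOL-Analysis.Analysis"
begin

section \<open>Smooth maps between Euclidean spaces\<close>

text \<open>Only meaningful for open \<open>S\<close>: the derivatives are full (not one-sided) derivatives.\<close>

primrec Ck_on :: "nat \<Rightarrow> 'a::real_normed_vector set \<Rightarrow> ('a \<Rightarrow> 'b::real_normed_vector) \<Rightarrow> bool" where
  "Ck_on 0 S f \<longleftrightarrow> continuous_on S f"
| "Ck_on (Suc k) S f \<longleftrightarrow>
     (\<forall>x\<in>S. f differentiable (at x)) \<and> (\<forall>v. Ck_on k S (\<lambda>x. frechet_derivative f (at x) v))"

definition smooth_on :: "'a::real_normed_vector set \<Rightarrow> ('a \<Rightarrow> 'b::real_normed_vector) \<Rightarrow> bool" where
  "smooth_on S f \<longleftrightarrow> (\<forall>k. Ck_on k S f)"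

definition partial :: "'n::finite \<Rightarrow> (real^'n \<Rightarrow> real) \<Rightarrow> real^'n \<Rightarrow> real" where
  "partial i f x = frechet_derivative f (at x) (axis i 1)"


section \<open>Smooth manifolds\<close>

text \<open>
  The underlying space of the manifold is the whole type \<open>'m\<close>, and its dimension is \<open>CARD('n)\<close>.
  A chart is a pair \<open>(U, \<phi>)\<close>; the map \<open>\<phi>\<close> is relevant only on \<open>U\<close>. Since charts map onto open
  subsets of \<open>real^'n\<close>, manifolds have no boundary.
\<close>

type_synonym ('m, 'n) chart = "'m set \<times> ('m \<Rightarrow> (real, 'n) vec)"

abbreviation chart_dom :: "('m, 'n) chart \<Rightarrow> 'm set" where
  "chart_dom c \<equiv> fst c"

abbreviation chart_map :: "('m, 'n) chart \<Rightarrow> 'm \<Rightarrow> real^'n" where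
  "chart_map c \<equiv> snd c"

definition chart_img :: "('m, 'n::finite) chart \<Rightarrow> (real^'n) set" where
  "chart_img c = chart_map c ` chart_dom c"

definition chart_inv :: "('m, 'n::finite) chart \<Rightarrow> real^'n \<Rightarrow> 'm" where
  "chart_inv c = inv_into (chart_dom c) (chart_map c)"

definition is_chart :: "('m::topological_space, 'n::finite) chart \<Rightarrow> bool" where
  "is_chart c \<longleftrightarrow> open (chart_dom c) \<and> open (chart_img c) \<and>
     homeomorphism (chart_dom c) (chart_img c) (chart_map c) (chart_inv c)"

definition transition :: "('m, 'n::finite) chart \<Rightarrow> ('m, 'n) chart \<Rightarrow> real^'n \<Rightarrow> real^'n" where
  "transition c d = chart_map d \<circ> chart_inv c"

definition overlap :: "('m, 'n::finite) chart \<Rightarrow> ('m, 'n) chart \<Rightarrow> (real^'n) set" where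
  "overlap c d = chart_map c ` (chart_dom c \<inter> chart_dom d)"

definition jacobian :: "('m, 'n::finite) chart \<Rightarrow> ('m, 'n) chart \<Rightarrow> real^'n \<Rightarrow> real^'n^'n" where
  "jacobian c d x = matrix (frechet_derivative (transition c d) (at x))"

definition smooth_atlas :: "('m::topological_space, 'n::finite) chart set \<Rightarrow> bool" where
  "smooth_atlas A \<longleftrightarrow>
     (\<forall>c\<in>A. is_chart c) \<and> (\<Union>c\<in>A. chart_dom c) = UNIV \<and>
     (\<forall>c\<in>A. \<forall>d\<in>A. smooth_on (overlap c d) (transition c d))"

text \<open>\<open>smooth_atlas (A \<union> B)\<close> says that \<open>A\<close> and \<open>B\<close> define the same smooth structure.\<close>

definition orientable :: "('m::topological_space, 'n::finite) chart set \<Rightarrow> bool" where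
  "orientable A \<longleftrightarrow>
     (\<exists>B. smooth_atlas B \<and> smooth_atlas (A \<union> B) \<and>
        (\<forall>c\<in>B. \<forall>d\<in>B. \<forall>x\<in>overlap c d. det (jacobian c d x) > 0))"

definition smooth_from_manifold ::
    "('m, 'n::finite) chart set \<Rightarrow> ('m \<Rightarrow> 'b::real_normed_vector) \<Rightarrow> bool" where
  "smooth_from_manifold A f \<longleftrightarrow> (\<forall>c\<in>A. smooth_on (chart_img c) (f \<circ> chart_inv c))"

definition smooth_to_manifold ::
    "('m::topological_space, 'n::finite) chart set \<Rightarrow> ('b::real_normed_vector \<Rightarrow> 'm) \<Rightarrow> bool" where
  "smooth_to_manifold A h \<longleftrightarrow> continuous_on UNIV h \<and>
     (\<forall>c\<in>A. smooth_on (h -` chart_dom c) (chart_map c \<circ> h))"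


section \<open>Riemannian metrics\<close>

text \<open>
  A metric \<open>G\<close> is given by its component matrices: \<open>G c x $ i $ j\<close> is the value of \<open>g(\<partial>\<^sub>i, \<partial>\<^sub>j)\<close> in the
  chart \<open>c\<close> at the point with coordinates \<open>x\<close>. The last clause is the transformation law of a
  covariant 2-tensor. Correspondingly, a tangent vector at \<open>q\<close> is given by its component vector
  with respect to a chart around \<open>q\<close>.
\<close>

type_synonym ('m, 'n) metric = "('m, 'n) chart \<Rightarrow> (real, 'n) vec \<Rightarrow> ((real, 'n) vec, 'n) vec"

definition riemannian_metric :: "('m, 'n::finite) chart set \<Rightarrow> ('m, 'n) metric \<Rightarrow> bool" where
  "riemannian_metric A G \<longleftrightarrow>
     (\<forall>c\<in>A. smooth_on (chart_img c) (G c)) \<and>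
     (\<forall>c\<in>A. \<forall>x\<in>chart_img c. transpose (G c x) = G c x \<and> (\<forall>v. v \<noteq> 0 \<longrightarrow> v \<bullet> (G c x *v v) > 0)) \<and>
     (\<forall>c\<in>A. \<forall>d\<in>A. \<forall>x\<in>overlap c d.
        G c x = transpose (jacobian c d x) ** G d (transition c d x) ** jacobian c d x)"

definition riemannian_manifold ::
    "('m::topological_space, 'n::finite) chart set \<Rightarrow> ('m, 'n) metric \<Rightarrow> bool" where
  "riemannian_manifold A G \<longleftrightarrow> smooth_atlas A \<and> riemannian_metric A G"


section \<open>Levi-Civita connection, curvature and Hessian in coordinates\<close>

text \<open>In this section \<open>g\<close> is the component matrix of the metric in one chart.\<close>

text \<open>\<open>christoffel g k i j x\<close> is \<open>\<Gamma>\<^sup>k\<^sub>i\<^sub>j\<close>, where \<open>\<nabla>\<^sub>i \<partial>\<^sub>j = \<Sum>\<^sub>k \<Gamma>\<^sup>k\<^sub>i\<^sub>j \<partial>\<^sub>k\<close>.\<close>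

definition christoffel ::
    "(real^'n::finite \<Rightarrow> real^'n^'n) \<Rightarrow> 'n \<Rightarrow> 'n \<Rightarrow> 'n \<Rightarrow> real^'n \<Rightarrow> real" where
  "christoffel g k i j x = (1/2) * (\<Sum>l\<in>UNIV. matrix_inv (g x) $ k $ l *
     (partial i (\<lambda>y. g y $ j $ l) x + partial j (\<lambda>y. g y $ i $ l) x - partial l (\<lambda>y. g y $ i $ j) x))"

text \<open>
  \<open>riemann g l k i j x\<close> is the \<open>l\<close>-th component of
  \<open>R(\<partial>\<^sub>i, \<partial>\<^sub>j) \<partial>\<^sub>k = \<nabla>\<^sub>i \<nabla>\<^sub>j \<partial>\<^sub>k - \<nabla>\<^sub>j \<nabla>\<^sub>i \<partial>\<^sub>k\<close>.
\<close>

definition riemann ::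
    "(real^'n::finite \<Rightarrow> real^'n^'n) \<Rightarrow> 'n \<Rightarrow> 'n \<Rightarrow> 'n \<Rightarrow> 'n \<Rightarrow> real^'n \<Rightarrow> real" where
  "riemann g l k i j x =
     partial i (christoffel g l j k) x - partial j (christoffel g l i k) x
     + (\<Sum>m\<in>UNIV. christoffel g l i m x * christoffel g m j k x
                  - christoffel g l j m x * christoffel g m i k x)"

text \<open>
  \<open>Ric(Y, Z)\<close> is the trace of \<open>X \<mapsto> R(X, Y) Z\<close>; with this sign convention round spheres have
  positive Ricci curvature.
\<close>

definition ricci :: "(real^'n::finite \<Rightarrow> real^'n^'n) \<Rightarrow> real^'n \<Rightarrow> real^'n^'n" where
  "ricci g x = (\<chi> j k. \<Sum>i\<in>UNIV. riemann g i k i j x)"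

definition hessian ::
    "(real^'n::finite \<Rightarrow> real^'n^'n) \<Rightarrow> (real^'n \<Rightarrow> real) \<Rightarrow> real^'n \<Rightarrow> real^'n^'n" where
  "hessian g F x =
     (\<chi> i j. partial i (partial j F) x - (\<Sum>k\<in>UNIV. christoffel g k i j x * partial k F x))"

definition ricci_nonneg :: "('m, 'n::finite) chart set \<Rightarrow> ('m, 'n) metric \<Rightarrow> bool" where
  "ricci_nonneg A G \<longleftrightarrow> (\<forall>c\<in>A. \<forall>x\<in>chart_img c. \<forall>v. v \<bullet> (ricci (G c) x *v v) \<ge> 0)"

definition gradient_ricci_soliton ::
    "('m, 'n::finite) chart set \<Rightarrow> ('m, 'n) metric \<Rightarrow> ('m \<Rightarrow> real) \<Rightarrow> real \<Rightarrow> bool" where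
  "gradient_ricci_soliton A G f lam \<longleftrightarrow> smooth_from_manifold A f \<and>
     (\<forall>c\<in>A. \<forall>x\<in>chart_img c.
        hessian (G c) (f \<circ> chart_inv c) x + ricci (G c) x = lam *\<^sub>R G c x)"


section \<open>Geodesics, completeness and poles\<close>

text \<open>
  \<open>I\<close> is a nondegenerate interval; derivatives at endpoints belonging to \<open>I\<close> are one-sided.
  \<open>velocity c I \<gamma> t\<close> is meant for \<open>t \<in> I\<close> with \<open>\<gamma> t\<close> in the domain of \<open>c\<close>.
\<close>

definition velocity ::
    "('m, 'n::finite) chart \<Rightarrow> real set \<Rightarrow> (real \<Rightarrow> 'm) \<Rightarrow> real \<Rightarrow> real^'n" where
  "velocity c I \<gamma> t = vector_derivative (chart_map c \<circ> \<gamma>) (at t within I)"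

definition geodesic_on ::
    "('m::topological_space, 'n::finite) chart set \<Rightarrow> ('m, 'n) metric \<Rightarrow> real set \<Rightarrow>
     (real \<Rightarrow> 'm) \<Rightarrow> bool" where
  "geodesic_on A G I \<gamma> \<longleftrightarrow> continuous_on I \<gamma> \<and>
     (\<forall>c\<in>A. \<forall>t\<in>I. \<gamma> t \<in> chart_dom c \<longrightarrow>
        (chart_map c \<circ> \<gamma>) differentiable (at t within I) \<and>
        (velocity c I \<gamma> has_vector_derivative
           (\<chi> k. - (\<Sum>i\<in>UNIV. \<Sum>j\<in>UNIV. christoffel (G c) k i j (chart_map c (\<gamma> t)) *
                     velocity c I \<gamma> t $ i * velocity c I \<gamma> t $ j)))
          (at t within I))"

definition unit_speed_on ::
    "('m, 'n::finite) chart set \<Rightarrow> ('m, 'n) metric \<Rightarrow> real set \<Rightarrow> (real \<Rightarrow> 'm) \<Rightarrow> bool" where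
  "unit_speed_on A G I \<gamma> \<longleftrightarrow>
     (\<forall>c\<in>A. \<forall>t\<in>I. \<gamma> t \<in> chart_dom c \<longrightarrow>
        velocity c I \<gamma> t \<bullet> (G c (chart_map c (\<gamma> t)) *v velocity c I \<gamma> t) = 1)"

text \<open>The geodesic starts at \<open>p\<close> with velocity \<open>v\<close> (components with respect to \<open>c\<close>).\<close>

definition geodesic_from ::
    "('m::topological_space, 'n::finite) chart set \<Rightarrow> ('m, 'n) metric \<Rightarrow> ('m, 'n) chart \<Rightarrow>
     'm \<Rightarrow> real^'n \<Rightarrow> (real \<Rightarrow> 'm) \<Rightarrow> bool" where
  "geodesic_from A G c p v \<gamma> \<longleftrightarrow>
     geodesic_on A G UNIV \<gamma> \<and> \<gamma> 0 = p \<and> velocity c UNIV \<gamma> 0 = v"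

definition geodesically_complete ::
    "('m::topological_space, 'n::finite) chart set \<Rightarrow> ('m, 'n) metric \<Rightarrow> bool" where
  "geodesically_complete A G \<longleftrightarrow>
     (\<forall>c\<in>A. \<forall>p\<in>chart_dom c. \<forall>v. \<exists>\<gamma>. geodesic_from A G c p v \<gamma>)"

text \<open>
  The exponential map at \<open>p\<close>, with the tangent space at \<open>p\<close> identified with \<open>real^'n\<close> by the basis
  \<open>\<partial>\<^sub>1, \<dots>, \<partial>\<^sub>n\<close> of a chart \<open>c\<close> around \<open>p\<close>. It is intended for complete manifolds, where the
  geodesic exists for every \<open>v\<close> (and is unique).
\<close>

definition exp_map ::
    "('m::topological_space, 'n::finite) chart set \<Rightarrow> ('m, 'n) metric \<Rightarrow> ('m, 'n) chart \<Rightarrow>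
     'm \<Rightarrow> real^'n \<Rightarrow> 'm" where
  "exp_map A G c p v = (THE q. \<exists>\<gamma>. geodesic_from A G c p v \<gamma> \<and> \<gamma> 1 = q)"

text \<open>
  Changing the chart \<open>c\<close> around \<open>p\<close> precomposes the exponential map with a linear isomorphism, so
  its choice is immaterial.
\<close>

definition has_pole ::
    "('m::topological_space, 'n::finite) chart set \<Rightarrow> ('m, 'n) metric \<Rightarrow> 'm \<Rightarrow> bool" where
  "has_pole A G p \<longleftrightarrow>
     (\<exists>c\<in>A. p \<in> chart_dom c \<and> bij (exp_map A G c p) \<and>
        smooth_to_manifold A (exp_map A G c p) \<and> smooth_from_manifold A (inv (exp_map A G c p)))"

end

theory Submission
  imports Defs
begin

text \<open>
  Write \<open>Ric(t)\<close> for \<open>Ric(\<sigma>'(t), \<sigma>'(t))\<close>. Along the unit speed geodesic \<open>\<sigma>\<close> the soliton equation says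
  \<open>(f \<circ> \<sigma>)'' = \<lambda> - Ric(t)\<close>, so it is enough to bound the integral of \<open>Ric(t)\<close> over
  \<open>[1, T]\<close> independently of \<open>T\<close>: then \<open>f \<circ> \<sigma>\<close> is at least \<open>\<lambda> t\<^sup>2 / 2 - O(t)\<close>, which no linear
  function dominates if \<open>\<lambda> > 0\<close>.

  The bound comes from a Riccati inequality. Transport the Euler field \<open>y \<mapsto> y\<close> of the tangent space
  at the pole to \<open>M\<close> by the exponential map. The resulting field \<open>E\<close> is \<open>t \<sigma>'(t)\<close> along every
  geodesic \<open>\<sigma>\<close> that starts at \<open>p\<close>, hence \<open>\<nabla>\<^sub>E E = E\<close>. The trace of the covariant derivative of this
  identity, with \<open>B = \<nabla>E\<close>, is
     \<open>E(tr B) + tr(B\<^sup>2) + Ric(E, E) = tr B\<close>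
  (\<open>riccati_trace\<close>). By the Gauss lemma (\<open>gauss_lemma\<close>) \<open>E\<close> is the gradient of a function \<open>\<psi>\<close>, half the
  squared distance from \<open>p\<close>. So \<open>B\<close> is the Hessian of \<open>\<psi>\<close> with one index raised; it is self-adjoint,
  and \<open>tr(B\<^sup>2) \<ge> (tr B)\<^sup>2 / n\<close> (\<open>trace_square_ge\<close>). For \<open>u(t) = (tr B)(\<sigma>(t)) / t\<close> this gives
     \<open>u' \<le> - u\<^sup>2 / n - Ric(t)\<close>  for all \<open>t > 0\<close>.
  Since \<open>Ric \<ge> 0\<close> and \<open>u\<close> exists for all times, \<open>u\<close> is never negative, for a negative value would
  lead to blow-up in finite time (\<open>riccati_nonneg\<close>). Therefore the integral of \<open>Ric(t)\<close> over \<open>[1, T]\<close>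
  is at most \<open>u(1) - u(T) \<le> u(1)\<close>; the conclusion is drawn in \<open>riccati_growth\<close>. It is here that the
  pole enters: without conjugate points along \<open>\<sigma>\<close> the function \<open>u\<close> is finite on the whole half-line.

  Two devices keep the tensor calculus short. The Gauss lemma is proved for the metric pulled back by
  the exponential map, as a statement about functions on \<open>real^'n\<close> that are differentiated along
  lines through the origin. And the transformation law of Christoffel symbols under a change of
  charts is avoided: the second derivative of a function along a geodesic computes its Hessian in
  every chart (\<open>second_derivative_along_geodesic\<close>), and by completeness there is a geodesic in
  every direction, so the Hessian, and with it \<open>tr B\<close>, does not depend on the chart
  (\<open>hessian_transform\<close>).
\<close>

section \<open>Smooth maps\<close>

abbreviation fderiv where
  "fderiv f x \<equiv> frechet_derivative f (at x)"

lemma Ck_on_cong: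
  assumes "open S" "\<And>x. x \<in> S \<Longrightarrow> f x = g x" "Ck_on k S f"
  shows "Ck_on k S g"
  using assms(2,3)
proof (induction k arbitrary: f g)
  case 0
  then show ?case by (metis Ck_on.simps(1) continuous_on_cong)
next
  case (Suc k)
  have d: "(f has_derivative fderiv f x) (at x)" if "x \<in> S" for x
    using Suc.prems(2) that frechet_derivative_works by auto
  have d': "(g has_derivative fderiv f x) (at x)" if "x \<in> S" for x
    using has_derivative_transform_within_open[OF d[OF that] assms(1) that] Suc.prems(1) by metis
  have e: "fderiv g x = fderiv f x" if "x \<in> S" for x
    using frechet_derivative_at[OF d'[OF that]] by simp
  show ?case
    unfolding Ck_on.simps
  proof (intro conjI allI ballI)
    show "g differentiable at x" if "x \<in> S" for x using d'[OF that] differentiableI by blast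
    show "Ck_on k S (\<lambda>x. fderiv g x v)" for v
      using Suc.IH[of "\<lambda>x. fderiv f x v" "\<lambda>x. fderiv g x v"]
        Suc.prems(2) e by auto
  qed
qed

lemma Ck_on_const: "Ck_on k S (\<lambda>x. c)"
  by (induction k arbitrary: c) auto

lemma Ck_on_Suc_imp: "Ck_on (Suc k) S f \<Longrightarrow> Ck_on k S f"
proof (induction k arbitrary: f)
  case 0
  then show ?case
    by (auto intro!: continuous_at_imp_continuous_on differentiable_imp_continuous_within)
next
  case (Suc k)
  have d: "\<forall>x\<in>S. f differentiable (at x)" "\<And>v. Ck_on (Suc k) S (\<lambda>x. fderiv f x v)"
    using Suc.prems unfolding Ck_on.simps(2)[of "Suc k"] by blast+
  show ?case unfolding Ck_on.simps(2)[of k] using d(1) Suc.IH[OF d(2)] by blast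
qed

text \<open>
  Closure properties of \<open>Ck_on\<close> are proved by induction on the order. For the induction step it is
  convenient to name a derivative \<open>f'\<close> instead of working with \<open>frechet_derivative\<close>.
\<close>

lemma Ck_on_SucI:
  assumes "open S"
    and "\<And>x. x \<in> S \<Longrightarrow> (f has_derivative f' x) (at x)"
    and "\<And>v. Ck_on k S (\<lambda>x. f' x v)"
  shows "Ck_on (Suc k) S f"
  unfolding Ck_on.simps
proof (intro conjI ballI allI)
  show "f differentiable at x" if "x \<in> S" for x using assms(2)[OF that] differentiableI by blast
  have "fderiv f x = f' x" if "x \<in> S" for x
    using frechet_derivative_at[OF assms(2)[OF that]] by simp
  then show "Ck_on k S (\<lambda>x. fderiv f x v)" for v
    by (intro Ck_on_cong[OF assms(1) _ assms(3)[of v]]) simp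
qed

lemma Ck_on_SucD:
  assumes "Ck_on (Suc k) S f"
  shows "x \<in> S \<Longrightarrow> (f has_derivative fderiv f x) (at x)"
    and "Ck_on k S (\<lambda>x. fderiv f x v)"
  using assms frechet_derivative_works by auto

lemma Ck_on_linear:
  assumes "bounded_linear L" "open S"
  shows "Ck_on k S L"
proof (cases k)
  case 0
  then show ?thesis using linear_continuous_on[OF assms(1)] by simp
next
  case (Suc j)
  show ?thesis unfolding Suc
    by (rule Ck_on_SucI[OF assms(2), of _ "\<lambda>x. L"])
      (auto intro: bounded_linear_imp_has_derivative assms Ck_on_const)
qed

lemma Ck_on_linear_compose:
  assumes L: "bounded_linear L" and S: "open S"
  shows "Ck_on k S f \<Longrightarrow> Ck_on k S (\<lambda>x. L (f x))"
proof (induction k arbitrary: f)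
  case 0
  then show ?case using bounded_linear.continuous_on[OF L] by simp
next
  case (Suc k)
  show ?case
    by (rule Ck_on_SucI[OF S, of _ "\<lambda>x v. L (fderiv f x v)"])
      (rule bounded_linear.has_derivative[OF L Ck_on_SucD(1)[OF Suc.prems]], assumption,
       rule Suc.IH[OF Ck_on_SucD(2)[OF Suc.prems]])
qed

lemma Ck_on_add:
  assumes S: "open S"
  shows "Ck_on k S f \<Longrightarrow> Ck_on k S g \<Longrightarrow> Ck_on k S (\<lambda>x. f x + g x)"
proof (induction k arbitrary: f g)
  case 0
  then show ?case by (simp add: continuous_on_add)
next
  case (Suc k)
  show ?case
    by (rule Ck_on_SucI[OF S, of _ "\<lambda>x v. fderiv f x v + fderiv g x v"])
      (rule has_derivative_add[OF Ck_on_SucD(1)[OF Suc.prems(1)] Ck_on_SucD(1)[OF Suc.prems(2)]], assumption+,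
       rule Suc.IH[OF Ck_on_SucD(2)[OF Suc.prems(1)] Ck_on_SucD(2)[OF Suc.prems(2)]])
qed

lemma Ck_on_sum:
  assumes S: "open S" and "\<And>i. i \<in> I \<Longrightarrow> Ck_on k S (f i)"
  shows "Ck_on k S (\<lambda>x. \<Sum>i\<in>I. f i x)"
  using assms(2)
  by (induction I rule: infinite_finite_induct) (auto intro: Ck_on_const Ck_on_add[OF S])

lemma Ck_on_bilinear:
  assumes B: "bounded_bilinear B" and S: "open S"
  shows "Ck_on k S f \<Longrightarrow> Ck_on k S g \<Longrightarrow> Ck_on k S (\<lambda>x. B (f x) (g x))"
proof (induction k arbitrary: f g)
  case 0
  then show ?case using bounded_bilinear.continuous_on[OF B] by simp
next
  case (Suc k)
  show ?case
  proof (rule Ck_on_SucI[OF S, of _ "\<lambda>x v. B (f x) (fderiv g x v) + B (fderiv f x v) (g x)"])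
    show "((\<lambda>x. B (f x) (g x)) has_derivative
          (\<lambda>v. B (f x) (fderiv g x v) + B (fderiv f x v) (g x))) (at x)"
      if "x \<in> S" for x
      using bounded_bilinear.FDERIV[OF B Ck_on_SucD(1)[OF Suc.prems(1) that] Ck_on_SucD(1)[OF Suc.prems(2) that]] .
    show "Ck_on k S (\<lambda>x. B (f x) (fderiv g x v) + B (fderiv f x v) (g x))" for v
      by (intro Ck_on_add[OF S] Suc.IH Ck_on_SucD(2)[OF Suc.prems(1)] Ck_on_SucD(2)[OF Suc.prems(2)]
          Ck_on_Suc_imp[OF Suc.prems(1)] Ck_on_Suc_imp[OF Suc.prems(2)])
  qed
qed

lemma Ck_on_prod:
  fixes f :: "'i \<Rightarrow> 'a::real_normed_vector \<Rightarrow> real"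
  assumes S: "open S" and "\<And>i. i \<in> I \<Longrightarrow> Ck_on k S (f i)"
  shows "Ck_on k S (\<lambda>x. \<Prod>i\<in>I. f i x)"
  using assms(2)
  by (induction I rule: infinite_finite_induct)
    (auto intro: Ck_on_const Ck_on_bilinear[OF bounded_bilinear_mult S])

lemma Ck_on_inverse:
  fixes f :: "'a::real_normed_vector \<Rightarrow> real"
  assumes S: "open S" and nz: "\<And>x. x \<in> S \<Longrightarrow> f x \<noteq> 0"
  shows "Ck_on k S f \<Longrightarrow> Ck_on k S (\<lambda>x. inverse (f x))"
proof (induction k)
  case 0
  then show ?case using nz by (auto intro!: continuous_on_inverse)
next
  case (Suc k)
  note m = Ck_on_bilinear[OF bounded_bilinear_mult S]
  show ?case
  proof (rule Ck_on_SucI[OF S, of _ "\<lambda>x v. - (inverse (f x) * fderiv f x v * inverse (f x))"])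
    show "((\<lambda>x. inverse (f x)) has_derivative
          (\<lambda>v. - (inverse (f x) * fderiv f x v * inverse (f x)))) (at x)"
      if "x \<in> S" for x
      by (rule Deriv.has_derivative_inverse[OF nz[OF that] Ck_on_SucD(1)[OF Suc.prems that]])
    have i: "Ck_on k S (\<lambda>x. inverse (f x))" using Suc.IH Ck_on_Suc_imp[OF Suc.prems] by blast
    show "Ck_on k S (\<lambda>x. - (inverse (f x) * fderiv f x v * inverse (f x)))" for v
      by (rule Ck_on_linear_compose[OF bounded_linear_minus[OF bounded_linear_ident] S])
        (intro m i Ck_on_SucD(2)[OF Suc.prems])
  qed
qed

text \<open>
  The chain rule applies a derivative to a vector that varies with the point, whereas \<open>Ck_on\<close> speaks
  of directional derivatives in fixed directions. Expanding that vector in the standard basis turns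
  the derivative of the composition into a sum of products to which the induction hypothesis applies.
\<close>

lemma Ck_on_compose:
  fixes f :: "'a::real_normed_vector \<Rightarrow> 'b::euclidean_space" and g :: "'b \<Rightarrow> 'c::real_normed_vector"
  assumes S: "open S" and T: "open T" and ST: "\<And>x. x \<in> S \<Longrightarrow> f x \<in> T"
  shows "Ck_on k S f \<Longrightarrow> Ck_on k T g \<Longrightarrow> Ck_on k S (\<lambda>x. g (f x))"
proof (induction k arbitrary: g)
  case 0
  then have "continuous_on S f" "continuous_on T g" by simp_all
  then have "continuous_on S (\<lambda>x. g (f x))"
    using ST by (intro continuous_on_compose2[of T g S f]) auto
  then show ?case by simp
next
  case (Suc k)
  have fk: "Ck_on k S f" using Ck_on_Suc_imp[OF Suc.prems(1)] .
  show ?case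
  proof (rule Ck_on_SucI[OF S, of _ "\<lambda>x v. \<Sum>b\<in>Basis. (fderiv f x v \<bullet> b) *\<^sub>R fderiv g (f x) b"])
    show "((\<lambda>x. g (f x)) has_derivative
       (\<lambda>v. \<Sum>b\<in>Basis. (fderiv f x v \<bullet> b) *\<^sub>R fderiv g (f x) b)) (at x)"
      if x: "x \<in> S" for x
    proof -
      have l: "linear (fderiv g (f x))"
        by (rule has_derivative_linear[OF Ck_on_SucD(1)[OF Suc.prems(2) ST[OF x]]])
      have "fderiv g (f x) w = (\<Sum>b\<in>Basis. (w \<bullet> b) *\<^sub>R fderiv g (f x) b)" for w
        using linear_sum[OF l, of "\<lambda>b. (w \<bullet> b) *\<^sub>R b" Basis] linear_scale[OF l]
        by (simp add: euclidean_representation)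
      then show ?thesis
        by (rule has_derivative_eq_rhs[OF has_derivative_compose[OF Ck_on_SucD(1)[OF Suc.prems(1) x]
              Ck_on_SucD(1)[OF Suc.prems(2) ST[OF x]]], OF ext])
    qed
    have c1: "Ck_on k S (\<lambda>x. fderiv f x v \<bullet> b)" for v b
      by (rule Ck_on_linear_compose[OF bounded_linear_inner_left S Ck_on_SucD(2)[OF Suc.prems(1)]])
    have c2: "Ck_on k S (\<lambda>x. fderiv g (f x) b)" for b
      using Suc.IH[OF fk Ck_on_SucD(2)[OF Suc.prems(2), of b]] by simp
    show "Ck_on k S (\<lambda>x. \<Sum>b\<in>Basis. (fderiv f x v \<bullet> b) *\<^sub>R fderiv g (f x) b)" for v
      by (intro Ck_on_sum[OF S] Ck_on_bilinear[OF bounded_bilinear_scaleR S] c1 c2)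
  qed
qed

lemma smooth_on_cong:
  "open S \<Longrightarrow> (\<And>x. x \<in> S \<Longrightarrow> f x = g x) \<Longrightarrow> smooth_on S f \<Longrightarrow> smooth_on S g"
  unfolding smooth_on_def using Ck_on_cong[of S f g] by blast

lemma smooth_on_const: "smooth_on S (\<lambda>x. c)"
  unfolding smooth_on_def using Ck_on_const by blast

lemma smooth_on_linear: "bounded_linear L \<Longrightarrow> open S \<Longrightarrow> smooth_on S L"
  unfolding smooth_on_def using Ck_on_linear by blast

lemma smooth_on_linear_compose: "bounded_linear L \<Longrightarrow> open S \<Longrightarrow> smooth_on S f \<Longrightarrow> smooth_on S (\<lambda>x. L (f x))"
  unfolding smooth_on_def using Ck_on_linear_compose[of L S _ f] by simp

lemma smooth_on_add: "open S \<Longrightarrow> smooth_on S f \<Longrightarrow> smooth_on S g \<Longrightarrow> smooth_on S (\<lambda>x. f x + g x)"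
  unfolding smooth_on_def using Ck_on_add[of S _ f g] by simp

lemma smooth_on_minus: "open S \<Longrightarrow> smooth_on S f \<Longrightarrow> smooth_on S (\<lambda>x. - f x)"
  by (rule smooth_on_linear_compose[OF bounded_linear_minus[OF bounded_linear_ident]])

lemma smooth_on_diff: "open S \<Longrightarrow> smooth_on S f \<Longrightarrow> smooth_on S g \<Longrightarrow> smooth_on S (\<lambda>x. f x - g x)"
  using smooth_on_add[of S f "\<lambda>x. - g x"] smooth_on_minus[of S g] by simp

lemma smooth_on_sum:
  "open S \<Longrightarrow> (\<And>i. i \<in> I \<Longrightarrow> smooth_on S (f i)) \<Longrightarrow> smooth_on S (\<lambda>x. \<Sum>i\<in>I. f i x)"
  unfolding smooth_on_def using Ck_on_sum[of S I _ f] by simp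

lemma smooth_on_bilinear:
  "bounded_bilinear B \<Longrightarrow> open S \<Longrightarrow> smooth_on S f \<Longrightarrow> smooth_on S g \<Longrightarrow> smooth_on S (\<lambda>x. B (f x) (g x))"
  unfolding smooth_on_def using Ck_on_bilinear[of B S _ f g] by simp

lemmas smooth_on_mult = smooth_on_bilinear[OF bounded_bilinear_mult]
lemmas smooth_on_scaleR = smooth_on_bilinear[OF bounded_bilinear_scaleR]
lemmas smooth_on_inner = smooth_on_bilinear[OF bounded_bilinear_inner]

lemma smooth_on_prod:
  fixes f :: "'i \<Rightarrow> 'a::real_normed_vector \<Rightarrow> real"
  shows "open S \<Longrightarrow> (\<And>i. i \<in> I \<Longrightarrow> smooth_on S (f i)) \<Longrightarrow> smooth_on S (\<lambda>x. \<Prod>i\<in>I. f i x)"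
  unfolding smooth_on_def using Ck_on_prod[of S I _ f] by simp

lemma smooth_on_inverse:
  fixes f :: "'a::real_normed_vector \<Rightarrow> real"
  shows "open S \<Longrightarrow> (\<And>x. x \<in> S \<Longrightarrow> f x \<noteq> 0) \<Longrightarrow> smooth_on S f \<Longrightarrow> smooth_on S (\<lambda>x. inverse (f x))"
  unfolding smooth_on_def using Ck_on_inverse[of S f] by simp

lemma smooth_on_compose:
  fixes f :: "'a::real_normed_vector \<Rightarrow> 'b::euclidean_space" and g :: "'b \<Rightarrow> 'c::real_normed_vector"
  shows "open S \<Longrightarrow> open T \<Longrightarrow> (\<And>x. x \<in> S \<Longrightarrow> f x \<in> T) \<Longrightarrow> smooth_on S f \<Longrightarrow> smooth_on T g \<Longrightarrow>
    smooth_on S (\<lambda>x. g (f x))"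
  unfolding smooth_on_def using Ck_on_compose[of S T f _ g] by simp

lemma smooth_on_nth: "open S \<Longrightarrow> smooth_on S f \<Longrightarrow> smooth_on S (\<lambda>x. f x $ i)"
  by (rule smooth_on_linear_compose[OF bounded_linear_vec_nth])

lemma smooth_on_vec:
  fixes f :: "'a::real_normed_vector \<Rightarrow> ('b::real_normed_vector)^'n::finite"
  assumes S: "open S" and "\<And>i. smooth_on S (\<lambda>x. f x $ i)"
  shows "smooth_on S f"
proof -
  have norm_axis_le: "norm (axis i y :: 'b^'n) \<le> norm y" for i and y :: 'b
  proof -
    have "(norm (axis i y $ j :: 'b))\<^sup>2 = (if j = i then (norm y)\<^sup>2 else 0)" for j :: 'n
      by (simp add: axis_def)
    then show ?thesis by (simp add: norm_vec_def L2_set_def)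
  qed
  have bl: "bounded_linear (\<lambda>y::'b. axis i y :: 'b^'n)" for i
    by (rule bounded_linear_intro[where K=1]) (simp_all add: vec_eq_iff norm_axis_le, simp_all add: axis_def)
  have "f x = (\<Sum>i\<in>UNIV. axis i (f x $ i))" for x
    by (simp add: vec_eq_iff axis_def if_distrib cong: if_cong)
  then have "f = (\<lambda>x. \<Sum>i\<in>UNIV. axis i (f x $ i))" by blast
  moreover have "smooth_on S (\<lambda>x. \<Sum>i\<in>UNIV. axis i (f x $ i))"
    by (intro smooth_on_sum[OF S] smooth_on_linear_compose[OF bl S] assms(2))
  ultimately show ?thesis by simp
qed

lemma smooth_on_differentiable: "smooth_on S f \<Longrightarrow> x \<in> S \<Longrightarrow> f differentiable (at x)"
  unfolding smooth_on_def by (drule spec[of _ "Suc 0"]) simp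

lemma smooth_on_has_derivative:
  "smooth_on S f \<Longrightarrow> x \<in> S \<Longrightarrow> (f has_derivative fderiv f x) (at x)"
  using smooth_on_differentiable frechet_derivative_works by blast

lemma smooth_on_imp_continuous_on: "smooth_on S f \<Longrightarrow> continuous_on S f"
  unfolding smooth_on_def by (drule spec[of _ 0]) simp

lemma smooth_on_frechet_derivative:
  "smooth_on S f \<Longrightarrow> smooth_on S (\<lambda>x. fderiv f x v)"
  unfolding smooth_on_def using Ck_on_SucD(2) by blast

lemma smooth_on_partial: "smooth_on S f \<Longrightarrow> smooth_on S (partial i f)"
  unfolding partial_def by (rule smooth_on_frechet_derivative)

lemma linear_axis_expansion:
  fixes L :: "real^'n \<Rightarrow> 'b::real_vector"
  assumes "linear L"
  shows "L v = (\<Sum>i\<in>UNIV. v $ i *\<^sub>R L (axis i 1))"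
proof -
  have "v = (\<Sum>i\<in>UNIV. v $ i *\<^sub>R axis i 1)"
    by (simp add: vec_eq_iff axis_def if_distrib cong: if_cong)
  then have "L v = L (\<Sum>i\<in>UNIV. v $ i *\<^sub>R axis i 1)" by (rule arg_cong)
  then show ?thesis by (simp add: linear_sum[OF assms] linear_scale[OF assms])
qed

lemma frechet_derivative_eq_sum_partial:
  fixes f :: "real^'n \<Rightarrow> real"
  assumes "f differentiable (at x)"
  shows "fderiv f x v = (\<Sum>i\<in>UNIV. v $ i * partial i f x)"
  using linear_axis_expansion[OF linear_frechet_derivative[OF assms], of v] by (simp add: partial_def)

lemma smooth_on_frechet_derivative_apply:
  fixes f :: "real^'n \<Rightarrow> 'b::real_normed_vector"
  assumes S: "open S" and f: "smooth_on S f" and w: "smooth_on S w"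
  shows "smooth_on S (\<lambda>x. fderiv f x (w x))"
proof -
  have "fderiv f x (w x) = (\<Sum>i\<in>UNIV. w x $ i *\<^sub>R fderiv f x (axis i 1))"
    if "x \<in> S" for x
    by (rule linear_axis_expansion[OF linear_frechet_derivative[OF smooth_on_differentiable[OF f that]]])
  moreover have "smooth_on S (\<lambda>x. \<Sum>i\<in>UNIV. w x $ i *\<^sub>R fderiv f x (axis i 1))"
    by (intro smooth_on_sum[OF S] smooth_on_scaleR[OF S] smooth_on_nth[OF S] w smooth_on_frechet_derivative f)
  ultimately show ?thesis
    using smooth_on_cong[OF S, of "\<lambda>x. \<Sum>i\<in>UNIV. w x $ i *\<^sub>R fderiv f x (axis i 1)"
        "\<lambda>x. fderiv f x (w x)"] by presburger
qed

section \<open>Symmetry of second derivatives\<close>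

text \<open>
  The second difference over a parallelogram with sides \<open>t u\<close> and \<open>t v\<close> is \<open>t\<^sup>2\<close> times the second
  derivative, up to \<open>o(t\<^sup>2)\<close>. The second difference is symmetric in \<open>u\<close> and \<open>v\<close>, so the second
  derivative is symmetric as well.
\<close>

lemma second_difference_quotient:
  fixes f :: "'a::real_normed_vector \<Rightarrow> real"
  assumes S: "open S" and f: "smooth_on S f" and x: "x \<in> S" and e: "0 < e"
  shows "\<exists>d>0. \<forall>t. 0 < t \<and> t < d \<longrightarrow>
     \<bar>f (x + t *\<^sub>R u + t *\<^sub>R v) - f (x + t *\<^sub>R u) - f (x + t *\<^sub>R v) + f x
       - t * t * fderiv (\<lambda>y. fderiv f y u) x v\<bar>
     \<le> e * (2 * norm u + norm v) * (t * t)"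
proof -
  define D where "D = (\<lambda>y. fderiv f y u)"
  define A where "A = fderiv D x"
  have "smooth_on S D" unfolding D_def by (rule smooth_on_frechet_derivative[OF f])
  then have A: "(D has_derivative A) (at x)"
    unfolding A_def using smooth_on_has_derivative x by blast
  have lA: "linear A" using has_derivative_linear[OF A] .
  obtain d1 where d1: "d1 > 0" "\<And>h. norm h < d1 \<Longrightarrow> norm (D (x + h) - D x - A h) \<le> e * norm h"
  proof -
    from A e obtain d where "d > 0" and
      d: "\<And>y. norm (y - x) < d \<Longrightarrow> norm (D y - D x - A (y - x)) \<le> e * norm (y - x)"
      unfolding has_derivative_at_alt by blast
    show ?thesis
      using that[OF \<open>d > 0\<close>] d[of "x + _"] by simp
  qed
  obtain r where r: "r > 0" "ball x r \<subseteq> S" using S x open_contains_ball by blast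
  define m where "m = min d1 r"
  have m: "m > 0" "m \<le> d1" "m \<le> r" unfolding m_def using d1(1) r(1) by auto
  define K where "K = norm u + norm v + 1"
  have K: "K > 0" unfolding K_def by (simp add: add_nonneg_pos)
  show ?thesis
  proof (intro exI[of _ "m / K"] conjI allI impI)
    show "0 < m / K" using m K by simp
    fix t assume t: "0 < t \<and> t < m / K"
    then have tK: "t * K < m" using K by (simp add: pos_less_divide_eq)
    have nb: "norm (s *\<^sub>R u + c *\<^sub>R v) < m" if "0 \<le> s" "s \<le> t" "0 \<le> c" "c \<le> t" for s c
    proof -
      have "norm (s *\<^sub>R u + c *\<^sub>R v) \<le> s * norm u + c * norm v"
        using norm_triangle_ineq[of "s *\<^sub>R u" "c *\<^sub>R v"] that by simp
      also have "\<dots> \<le> t * norm u + t * norm v"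
        using that by (intro add_mono mult_right_mono) auto
      also have "\<dots> \<le> t * K" unfolding K_def using t by (simp add: algebra_simps)
      finally show ?thesis using tK by simp
    qed
    have dxw: "dist x (x + w) = norm w" for w by (simp add: dist_norm)
    have inS: "x + (s *\<^sub>R u + c *\<^sub>R v) \<in> S" if "0 \<le> s" "s \<le> t" "0 \<le> c" "c \<le> t" for s c
    proof -
      have "x + (s *\<^sub>R u + c *\<^sub>R v) \<in> ball x r"
        using order_less_le_trans[OF nb[OF that] m(3)] unfolding mem_ball dxw .
      then show ?thesis using r(2) by blast
    qed
    have der: "((\<lambda>s. f (x + (s *\<^sub>R u + c *\<^sub>R v))) has_real_derivative D (x + (s *\<^sub>R u + c *\<^sub>R v))) (at s)"
      if "0 \<le> s" "s \<le> t" "0 \<le> c" "c \<le> t" for s c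
    proof -
      have g: "((\<lambda>s. x + (s *\<^sub>R u + c *\<^sub>R v)) has_derivative (\<lambda>h. h *\<^sub>R u)) (at s)"
        by (auto intro!: derivative_eq_intros)
      have "((\<lambda>s. f (x + (s *\<^sub>R u + c *\<^sub>R v))) has_derivative
             (\<lambda>h. fderiv f (x + (s *\<^sub>R u + c *\<^sub>R v)) (h *\<^sub>R u))) (at s)"
        using has_derivative_compose[OF g smooth_on_has_derivative[OF f inS[OF that]]] .
      moreover have "fderiv f (x + (s *\<^sub>R u + c *\<^sub>R v)) (h *\<^sub>R u) = D (x + (s *\<^sub>R u + c *\<^sub>R v)) * h" for h
        using linear_scale[OF linear_frechet_derivative[OF smooth_on_differentiable[OF f inS[OF that]]]]
        by (simp add: D_def)
      ultimately show ?thesis by (simp add: has_field_derivative_def)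
    qed
    define \<phi> where "\<phi> = (\<lambda>s. f (x + (s *\<^sub>R u + t *\<^sub>R v)) - f (x + (s *\<^sub>R u + 0 *\<^sub>R v)))"
    \<comment> \<open>mean value theorem in direction \<open>u\<close> for the difference in direction \<open>v\<close>\<close>
    have "\<exists>z. z > 0 \<and> z < t \<and> \<phi> t - \<phi> 0 =
        (t - 0) * (D (x + (z *\<^sub>R u + t *\<^sub>R v)) - D (x + (z *\<^sub>R u + 0 *\<^sub>R v)))"
    proof (rule MVT2)
      show "0 < t" using t by simp
      fix s assume s: "0 \<le> s" "s \<le> t"
      show "(\<phi> has_real_derivative D (x + (s *\<^sub>R u + t *\<^sub>R v)) - D (x + (s *\<^sub>R u + 0 *\<^sub>R v))) (at s)"
        unfolding \<phi>_def using s t by (intro DERIV_diff der) auto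
    qed
    then obtain z where z: "z > 0" "z < t" and
      eq: "\<phi> t - \<phi> 0 = t * (D (x + (z *\<^sub>R u + t *\<^sub>R v)) - D (x + (z *\<^sub>R u + 0 *\<^sub>R v)))"
      by auto
    have n1: "norm (z *\<^sub>R u + t *\<^sub>R v) \<le> t * (norm u + norm v)"
    proof -
      have "norm (z *\<^sub>R u + t *\<^sub>R v) \<le> z * norm u + t * norm v"
        using norm_triangle_ineq[of "z *\<^sub>R u" "t *\<^sub>R v"] z t by simp
      also have "\<dots> \<le> t * norm u + t * norm v" using z by (intro add_mono mult_right_mono) auto
      finally show ?thesis by (simp add: algebra_simps)
    qed
    have n2: "norm (z *\<^sub>R u + 0 *\<^sub>R v) \<le> t * norm u"
      using z by (simp add: mult_right_mono)
    have b1: "\<bar>D (x + (z *\<^sub>R u + t *\<^sub>R v)) - D x - A (z *\<^sub>R u + t *\<^sub>R v)\<bar> \<le> e * (t * (norm u + norm v))"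
    proof -
      have "norm (z *\<^sub>R u + t *\<^sub>R v) < d1" using nb[of z t] z t m by simp
      from order_trans[OF d1(2)[OF this] mult_left_mono[OF n1 less_imp_le[OF e]]]
      show ?thesis unfolding real_norm_def .
    qed
    have b2: "\<bar>D (x + (z *\<^sub>R u + 0 *\<^sub>R v)) - D x - A (z *\<^sub>R u + 0 *\<^sub>R v)\<bar> \<le> e * (t * norm u)"
    proof -
      have "norm (z *\<^sub>R u + 0 *\<^sub>R v) < d1" using nb[of z 0] z t m by simp
      from order_trans[OF d1(2)[OF this] mult_left_mono[OF n2 less_imp_le[OF e]]]
      show ?thesis unfolding real_norm_def .
    qed
    have Adiff: "A (z *\<^sub>R u + t *\<^sub>R v) - A (z *\<^sub>R u + 0 *\<^sub>R v) = t * A v"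
      by (simp add: linear_add[OF lA] linear_scale[OF lA])
    have "\<bar>(D (x + (z *\<^sub>R u + t *\<^sub>R v)) - D (x + (z *\<^sub>R u + 0 *\<^sub>R v))) - t * A v\<bar>
        \<le> e * (t * (norm u + norm v)) + e * (t * norm u)"
      using b1 b2 Adiff by linarith
    also have "\<dots> = t * (e * (2 * norm u + norm v))" by (simp add: algebra_simps)
    finally have b3: "\<bar>(D (x + (z *\<^sub>R u + t *\<^sub>R v)) - D (x + (z *\<^sub>R u + 0 *\<^sub>R v))) - t * A v\<bar> \<le> t * (e * (2 * norm u + norm v))" .
    have "\<bar>(\<phi> t - \<phi> 0) - t * t * A v\<bar> =
       t * \<bar>(D (x + (z *\<^sub>R u + t *\<^sub>R v)) - D (x + (z *\<^sub>R u + 0 *\<^sub>R v))) - t * A v\<bar>"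
    proof -
      have "(\<phi> t - \<phi> 0) - t * t * A v =
        t * ((D (x + (z *\<^sub>R u + t *\<^sub>R v)) - D (x + (z *\<^sub>R u + 0 *\<^sub>R v))) - t * A v)"
        unfolding eq by (simp add: algebra_simps)
      then show ?thesis using t by (simp add: abs_mult)
    qed
    also have "\<dots> \<le> t * (t * (e * (2 * norm u + norm v)))"
      using b3 t by (intro mult_left_mono) auto
    finally show "\<bar>f (x + t *\<^sub>R u + t *\<^sub>R v) - f (x + t *\<^sub>R u) - f (x + t *\<^sub>R v) + f x
       - t * t * fderiv (\<lambda>y. fderiv f y u) x v\<bar>
     \<le> e * (2 * norm u + norm v) * (t * t)"
      unfolding \<phi>_def A_def D_def by (simp add: algebra_simps)
  qed
qed

theorem second_derivative_symmetric:
  fixes f :: "'a::real_normed_vector \<Rightarrow> real"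
  assumes S: "open S" and f: "smooth_on S f" and x: "x \<in> S"
  shows "fderiv (\<lambda>y. fderiv f y u) x v =
         fderiv (\<lambda>y. fderiv f y v) x u"
proof -
  let ?a = "fderiv (\<lambda>y. fderiv f y u) x v"
  let ?b = "fderiv (\<lambda>y. fderiv f y v) x u"
  define C where "C = 3 * norm u + 3 * norm v + 1"
  have C: "C > 0" unfolding C_def by (simp add: add_nonneg_pos)
  have bd: "\<bar>?a - ?b\<bar> \<le> e" if e: "e > 0" for e
  proof -
    have e': "e / C > 0" using e C by simp
    obtain d1 where d1: "d1 > 0" "\<And>t. 0 < t \<and> t < d1 \<Longrightarrow>
     \<bar>f (x + t *\<^sub>R u + t *\<^sub>R v) - f (x + t *\<^sub>R u) - f (x + t *\<^sub>R v) + f x - t * t * ?a\<bar>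
     \<le> e / C * (2 * norm u + norm v) * (t * t)"
      using second_difference_quotient[OF S f x e', of u v] by blast
    obtain d2 where d2: "d2 > 0" "\<And>t. 0 < t \<and> t < d2 \<Longrightarrow>
     \<bar>f (x + t *\<^sub>R v + t *\<^sub>R u) - f (x + t *\<^sub>R v) - f (x + t *\<^sub>R u) + f x - t * t * ?b\<bar>
     \<le> e / C * (2 * norm v + norm u) * (t * t)"
      using second_difference_quotient[OF S f x e', of v u] by blast
    define t where "t = min d1 d2 / 2"
    have t: "0 < t" "t < d1" "t < d2" unfolding t_def using d1(1) d2(1) by auto
    have sw: "x + t *\<^sub>R v + t *\<^sub>R u = x + t *\<^sub>R u + t *\<^sub>R v" by simp
    have "\<bar>t * t * ?a - t * t * ?b\<bar> \<le> e / C * (2 * norm u + norm v) * (t * t) + e / C * (2 * norm v + norm u) * (t * t)"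
      using d1(2)[of t] d2(2)[of t] t unfolding sw by linarith
    also have "\<dots> = (e / C * (3 * norm u + 3 * norm v)) * (t * t)" by (simp add: algebra_simps)
    finally have bb: "\<bar>t * t * ?a - t * t * ?b\<bar> \<le> (e / C * (3 * norm u + 3 * norm v)) * (t * t)" .
    have "\<bar>?a - ?b\<bar> * (t * t) \<le> (e / C * (3 * norm u + 3 * norm v)) * (t * t)"
    proof -
      have "t * t * ?a - t * t * ?b = (?a - ?b) * (t * t)" by (simp add: algebra_simps)
      then have "\<bar>t * t * ?a - t * t * ?b\<bar> = \<bar>?a - ?b\<bar> * (t * t)" by (simp add: abs_mult)
      with bb show ?thesis by simp
    qed
    then have "\<bar>?a - ?b\<bar> \<le> e / C * (3 * norm u + 3 * norm v)"
      by (rule mult_right_le_imp_le) (use t(1) in simp)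
    also have "\<dots> \<le> e / C * C" using e' unfolding C_def by (intro mult_left_mono) auto
    finally show ?thesis using C by simp
  qed
  then have "\<bar>?a - ?b\<bar> \<le> 0" using field_le_epsilon[of "\<bar>?a - ?b\<bar>" 0] by simp
  then show ?thesis by simp
qed

lemma partial_commute:
  fixes f :: "real^'n \<Rightarrow> real"
  assumes "open S" "smooth_on S f" "x \<in> S"
  shows "partial i (partial j f) x = partial j (partial i f) x"
  using second_derivative_symmetric[OF assms, of "axis j 1" "axis i 1"]
  unfolding partial_def .

lemma frechet_derivative_nth:
  fixes F :: "'a::real_normed_vector \<Rightarrow> real^'n"
  assumes "F differentiable (at x)"
  shows "fderiv (\<lambda>y. F y $ i) x v = fderiv F x v $ i"
proof -
  have "((\<lambda>y. F y $ i) has_derivative (\<lambda>v. fderiv F x v $ i)) (at x)"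
    using bounded_linear.has_derivative[OF bounded_linear_vec_nth] assms frechet_derivative_works by blast
  from frechet_derivative_at[OF this] show ?thesis by metis
qed

section \<open>Matrices\<close>

lemma smooth_on_det:
  fixes g :: "'a::real_normed_vector \<Rightarrow> real^'n^'n"
  assumes S: "open S" and g: "\<And>i j. smooth_on S (\<lambda>x. g x $ i $ j)"
  shows "smooth_on S (\<lambda>x. det (g x))"
  unfolding det_def
  by (intro smooth_on_sum[OF S] smooth_on_mult[OF S] smooth_on_prod[OF S] smooth_on_const g)

lemma
  fixes A :: "real^'n^'n"
  assumes "invertible A"
  shows matrix_inv_right: "A ** matrix_inv A = mat 1"
    and matrix_inv_left: "matrix_inv A ** A = mat 1"
  using someI_ex[of "\<lambda>B. A ** B = mat 1 \<and> B ** A = mat 1"] assms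
  unfolding matrix_inv_def invertible_def by blast+

text \<open>
  By Cramer's rule the entries of the inverse are quotients of determinants.
\<close>

lemma smooth_on_matrix_inv:
  fixes g :: "'a::real_normed_vector \<Rightarrow> real^'n^'n"
  assumes S: "open S" and g: "smooth_on S g" and nz: "\<And>x. x \<in> S \<Longrightarrow> det (g x) \<noteq> 0"
  shows "smooth_on S (\<lambda>x. matrix_inv (g x))"
proof -
  have gij: "smooth_on S (\<lambda>x. g x $ i $ j)" for i j
    by (intro smooth_on_nth[OF S] g)
  have dij: "smooth_on S (\<lambda>x. (\<chi> a b. if b = k then axis j 1 $ a else g x $ a $ b) $ a $ b)" for j k a b
    by (cases "b = k") (simp_all add: smooth_on_const gij)
  have eq: "matrix_inv (g x) $ k $ j =
      det (\<chi> a b. if b = k then axis j 1 $ a else g x $ a $ b) * inverse (det (g x))"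
    if "x \<in> S" for x k j
  proof -
    have "invertible (g x)" using nz[OF that] by (simp add: invertible_det_nz)
    then have "g x ** matrix_inv (g x) = mat 1" by (rule matrix_inv_right)
    then have "g x *v (matrix_inv (g x) *v axis j 1) = axis j 1"
      by (simp add: matrix_vector_mul_assoc)
    then have "matrix_inv (g x) *v axis j 1 =
      (\<chi> k. det (\<chi> a b. if b = k then axis j 1 $ a else g x $ a $ b) / det (g x))"
      using cramer[OF nz[OF that]] by blast
    then have "(matrix_inv (g x) *v axis j 1) $ k =
      det (\<chi> a b. if b = k then axis j 1 $ a else g x $ a $ b) / det (g x)"
      by simp
    then show ?thesis
      by (simp add: matrix_vector_mul_component inner_axis divide_inverse)
  qed
  have c: "smooth_on S (\<lambda>x. matrix_inv (g x) $ k $ j)" for k j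
    by (rule smooth_on_cong[OF S _ smooth_on_mult[OF S smooth_on_det[OF S dij] smooth_on_inverse[OF S nz smooth_on_det[OF S gij]]]])
      (auto simp: eq)
  show ?thesis
    by (intro smooth_on_vec[OF S] c)
qed

lemma transpose_eq_self_iff: "transpose (A :: 'a^'n^'n) = A \<longleftrightarrow> (\<forall>i j. A $ i $ j = A $ j $ i)"
  by (auto simp: vec_eq_iff transpose_def)

text \<open>
  Cholesky factorization. The induction runs over a set \<open>S\<close> of indices outside of which the matrix
  vanishes: subtracting the rank one matrix of a pivot row \<open>p\<close> leaves a positive semidefinite matrix
  supported in \<open>S - {p}\<close>.
\<close>

lemma psd_factorization:
  fixes g :: "real^'n^'n"
  assumes "transpose g = g" and "\<And>v. v \<bullet> (g *v v) \<ge> 0"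
  shows "\<exists>Q :: real^'n^'n. g = transpose Q ** Q"
proof -
  have bl: "v \<bullet> (h *v v) = (\<Sum>i\<in>UNIV. \<Sum>j\<in>UNIV. v $ i * h $ i $ j * v $ j)" for h :: "real^'n^'n" and v
    by (simp add: inner_vec_def matrix_vector_mult_def sum_distrib_left mult.assoc)
  have main: "\<exists>Q :: real^'n^'n. \<forall>i j. h $ i $ j = (\<Sum>a\<in>UNIV. Q $ a $ i * Q $ a $ j) \<and> (i \<notin> S \<longrightarrow> Q $ i = 0)"
    if "finite S" "\<And>i j. h $ i $ j = h $ j $ i" "\<And>v. v \<bullet> (h *v v) \<ge> 0"
      "\<And>i j. i \<notin> S \<Longrightarrow> h $ i $ j = 0" for S and h :: "real^'n^'n"
    using that
  proof (induction S arbitrary: h rule: finite_induct)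
    case empty
    then show ?case by (intro exI[of _ 0]) simp
  next
    case (insert p S)
    have nn: "h $ i $ i \<ge> 0" for i
    proof -
      have "axis i 1 \<bullet> (h *v axis i 1) = h $ i $ i"
        by (simp add: inner_axis' matrix_vector_mul_component inner_axis)
      then show ?thesis using insert.prems(2)[of "axis i 1"] by simp
    qed
    have cs: "h $ p $ j = 0" if "h $ p $ p = 0" for j
    proof (rule ccontr)
      assume nz: "h $ p $ j \<noteq> 0"
      \<comment> \<open>with this \<open>c\<close> the form takes the value \<open>-1\<close> at \<open>c e\<^sub>p + e\<^sub>j\<close>\<close>
      define c where "c = - (h $ j $ j + 1) / (2 * h $ p $ j)"
      have m: "(h *v (c *\<^sub>R axis p 1 + axis j 1)) $ i = c * h $ i $ p + h $ i $ j" for i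
        by (simp add: matrix_vector_mul_component inner_axis inner_add_right)
      have "(c *\<^sub>R axis p 1 + axis j 1) \<bullet> (h *v (c *\<^sub>R axis p 1 + axis j 1)) =
            c * (c * h $ p $ p + h $ p $ j) + (c * h $ j $ p + h $ j $ j)"
        by (simp add: inner_add_left inner_axis' m)
      also have "\<dots> = 2 * c * h $ p $ j + h $ j $ j"
        using that insert.prems(1)[of j p] by (simp add: algebra_simps)
      also have "\<dots> = - 1" unfolding c_def using nz by (simp add: field_simps)
      finally show False using insert.prems(2)[of "c *\<^sub>R axis p 1 + axis j 1"] by simp
    qed
    define r where "r = inverse (h $ p $ p)"
    have r: "r \<ge> 0" unfolding r_def using nn by simp
    define k :: "real^'n^'n" where "k = (\<chi> i j. h $ i $ j - r * h $ p $ i * h $ p $ j)"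
    have kij: "k $ i $ j = h $ i $ j - r * h $ p $ i * h $ p $ j" for i j by (simp add: k_def)
    have kS: "k $ i $ j = 0" if "i \<notin> S" for i j
    proof (cases "i = p")
      case True
      then show ?thesis
        by (cases "h $ p $ p = 0") (simp_all add: kij cs r_def)
    next
      case False
      then have "i \<notin> insert p S" using that by simp
      then have "h $ i $ j = 0" "h $ p $ i = 0" using insert.prems(1)[of p i] insert.prems(3) by metis+
      then show ?thesis by (simp add: kij)
    qed
    have kpos: "v \<bullet> (k *v v) \<ge> 0" for v
    proof -
      define w where "w = (\<Sum>j\<in>UNIV. h $ p $ j * v $ j)"
      \<comment> \<open>completing the square: \<open>u\<close> is \<open>v\<close> made orthogonal to \<open>e\<^sub>p\<close> with respect to \<open>h\<close>\<close>
      define u where "u = v - (r * w) *\<^sub>R axis p 1"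
      have hu: "(h *v u) $ i = (h *v v) $ i - r * w * h $ i $ p" for i
        unfolding u_def
        by (simp add: matrix_vector_mult_diff_distrib matrix_vector_mul_component inner_axis inner_diff_right)
      have hp: "(h *v v) $ p = w" by (simp add: w_def matrix_vector_mult_def)
      have vh: "(\<Sum>i\<in>UNIV. v $ i * h $ i $ p) = w"
        unfolding w_def using insert.prems(1)[of _ p] by (intro sum.cong) (auto simp: mult.commute)
      have "u \<bullet> (h *v u) = v \<bullet> (h *v u) - r * w * (h *v u) $ p"
        by (simp add: u_def inner_diff_left inner_axis')
      also have "v \<bullet> (h *v u) = v \<bullet> (h *v v) - r * w * w"
      proof -
        have "v \<bullet> (h *v u) = (\<Sum>i\<in>UNIV. v $ i * (h *v v) $ i - r * w * (v $ i * h $ i $ p))"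
          by (simp add: inner_vec_def hu algebra_simps)
        also have "\<dots> = v \<bullet> (h *v v) - r * w * (\<Sum>i\<in>UNIV. v $ i * h $ i $ p)"
          by (simp add: sum_subtractf sum_distrib_left inner_vec_def)
        finally show ?thesis by (simp add: vh)
      qed
      also have "(h *v u) $ p = w - r * w * h $ p $ p" by (simp add: hu hp)
      finally have "u \<bullet> (h *v u) = v \<bullet> (h *v v) - r * w * w - r * w * (w - r * w * h $ p $ p)" .
      moreover have "r * w * (w - r * w * h $ p $ p) = 0"
        by (cases "h $ p $ p = 0") (simp_all add: r_def)
      moreover have "v \<bullet> (k *v v) = v \<bullet> (h *v v) - r * w * w"
      proof -
        have "v \<bullet> (k *v v) = (\<Sum>i\<in>UNIV. \<Sum>j\<in>UNIV. v $ i * h $ i $ j * v $ j - r * ((h $ p $ i * v $ i) * (h $ p $ j * v $ j)))"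
          unfolding bl kij by (intro sum.cong refl) (simp add: algebra_simps)
        also have "\<dots> = v \<bullet> (h *v v) - r * (\<Sum>i\<in>UNIV. \<Sum>j\<in>UNIV. (h $ p $ i * v $ i) * (h $ p $ j * v $ j))"
          unfolding bl by (simp add: sum_subtractf sum_distrib_left)
        also have "(\<Sum>i\<in>UNIV. \<Sum>j\<in>UNIV. (h $ p $ i * v $ i) * (h $ p $ j * v $ j)) = w * w"
          unfolding w_def by (simp add: sum_product)
        finally show ?thesis by (simp add: mult.assoc)
      qed
      ultimately show ?thesis using insert.prems(2)[of u] by simp
    qed
    have ksym: "k $ i $ j = k $ j $ i" for i j
      using insert.prems(1)[of i j] by (simp add: kij)
    obtain Q :: "real^'n^'n" where Q: "\<And>i j. k $ i $ j = (\<Sum>a\<in>UNIV. Q $ a $ i * Q $ a $ j)"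
      "\<And>i. i \<notin> S \<Longrightarrow> Q $ i = 0"
      using insert.IH[OF ksym kpos kS] by blast
    define Q' :: "real^'n^'n" where "Q' = (\<chi> a. if a = p then sqrt r *\<^sub>R h $ p else Q $ a)"
    have Qp: "Q $ p = 0" using Q(2) insert.hyps by simp
    have "h $ i $ j = (\<Sum>a\<in>UNIV. Q' $ a $ i * Q' $ a $ j)" for i j
    proof -
      have "(\<Sum>a\<in>UNIV. Q' $ a $ i * Q' $ a $ j) =
        (\<Sum>a\<in>UNIV. (if a = p then r * h $ p $ i * h $ p $ j else 0) + Q $ a $ i * Q $ a $ j)"
        using r Qp by (intro sum.cong refl) (auto simp: Q'_def algebra_simps)
      also have "\<dots> = r * h $ p $ i * h $ p $ j + k $ i $ j"
        by (simp add: sum.distrib Q(1))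
      finally show ?thesis by (simp add: kij)
    qed
    moreover have "Q' $ i = 0" if "i \<notin> insert p S" for i
      using that Q(2) by (simp add: Q'_def)
    ultimately have "\<forall>i j. h $ i $ j = (\<Sum>a\<in>UNIV. Q' $ a $ i * Q' $ a $ j) \<and> (i \<notin> insert p S \<longrightarrow> Q' $ i = 0)"
      by simp
    then show ?case by (rule exI)
  qed
  have sym: "g $ i $ j = g $ j $ i" for i j
    using assms(1) unfolding transpose_eq_self_iff by blast
  obtain Q :: "real^'n^'n" where Q: "\<And>i j. g $ i $ j = (\<Sum>a\<in>UNIV. Q $ a $ i * Q $ a $ j)"
  proof -
    have "\<exists>Q :: real^'n^'n. \<forall>i j. g $ i $ j = (\<Sum>a\<in>UNIV. Q $ a $ i * Q $ a $ j) \<and> (i \<notin> UNIV \<longrightarrow> Q $ i = 0)"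
      by (rule main) (simp_all add: sym[symmetric] assms(2))
    then show ?thesis using that by blast
  qed
  have "g = transpose Q ** Q"
    by (simp add: vec_eq_iff matrix_matrix_mult_def transpose_def Q)
  then show ?thesis by blast
qed

text \<open>
  Cauchy-Schwarz for an endomorphism \<open>B\<close> that is self-adjoint with respect to the inner product \<open>g\<close>.
  If \<open>g = Q\<^sup>T Q\<close>, then \<open>C = Q B Q\<^sup>-\<^sup>1\<close> is a symmetric matrix, and \<open>tr(C\<^sup>2)\<close> is the sum of the
  squares of all entries of \<open>C\<close>.
\<close>

lemma trace_square_ge:
  fixes g B :: "real^'n^'n"
  assumes sym: "transpose g = g" and pos: "\<And>v. v \<noteq> 0 \<Longrightarrow> v \<bullet> (g *v v) > 0"
    and self: "transpose (g ** B) = g ** B"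
  shows "(trace B)\<^sup>2 \<le> real CARD('n) * trace (B ** B)"
proof -
  have "v \<bullet> (g *v v) \<ge> 0" for v
    using pos[of v] by (cases "v = 0") auto
  then obtain Q :: "real^'n^'n" where Q: "g = transpose Q ** Q"
    using psd_factorization[OF sym] by blast
  have "invertible Q"
  proof -
    have "v = 0" if "Q *v v = 0" for v
    proof (rule ccontr)
      assume "v \<noteq> 0"
      from pos[OF this] show False unfolding Q using that
        by (simp add: matrix_vector_mul_assoc[symmetric])
    qed
    then show ?thesis
      by (metis invertible_left_inverse matrix_left_invertible_ker)
  qed
  then obtain R where R: "Q ** R = mat 1" "R ** Q = mat 1" unfolding invertible_def by blast
  define C where "C = Q ** B ** R"
  have trR: "transpose R ** transpose Q = mat 1"
    using R(1) by (metis matrix_transpose_mul transpose_mat)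
  have C1: "C = transpose R ** (g ** B) ** R"
  proof -
    have "transpose R ** (g ** B) ** R = (transpose R ** transpose Q) ** Q ** B ** R"
      unfolding Q by (simp add: matrix_mul_assoc)
    then show ?thesis by (simp add: trR C_def)
  qed
  have Csym: "transpose C = C"
  proof -
    have "transpose (transpose R ** M ** R) = transpose R ** transpose M ** R" for M :: "real^'n^'n"
      by (simp add: matrix_transpose_mul matrix_mul_assoc)
    from this[of "g ** B"] show ?thesis unfolding C1 self .
  qed
  have "trace C = trace (R ** (Q ** B))" unfolding C_def by (rule trace_mul_sym)
  then have trC: "trace C = trace B" by (simp add: matrix_mul_assoc R)
  have "C ** C = Q ** (B ** B) ** R"
  proof -
    have "C ** C = Q ** B ** (R ** Q) ** B ** R" by (simp add: C_def matrix_mul_assoc)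
    then show ?thesis by (simp add: R matrix_mul_assoc)
  qed
  then have "trace (C ** C) = trace (R ** (Q ** (B ** B)))" using trace_mul_sym[of "Q ** (B ** B)" R] by simp
  then have trCC: "trace (C ** C) = trace (B ** B)" by (simp add: matrix_mul_assoc R)
  have cs: "C $ i $ j = C $ j $ i" for i j using Csym unfolding transpose_eq_self_iff by blast
  have "(trace C)\<^sup>2 \<le> (\<Sum>i\<in>(UNIV::'n set). (1::real)\<^sup>2) * (\<Sum>i\<in>(UNIV::'n set). (C $ i $ i)\<^sup>2)"
    using Cauchy_Schwarz_ineq_sum[of "\<lambda>_. 1" "\<lambda>i. C $ i $ i" UNIV] by (simp add: trace_def)
  also have "\<dots> = real CARD('n) * (\<Sum>i\<in>UNIV. (C $ i $ i)\<^sup>2)" by simp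
  also have "\<dots> \<le> real CARD('n) * (\<Sum>i\<in>UNIV. \<Sum>j\<in>UNIV. (C $ i $ j)\<^sup>2)"
  proof (intro mult_left_mono sum_mono)
    show "(C $ i $ i)\<^sup>2 \<le> (\<Sum>j\<in>UNIV. (C $ i $ j)\<^sup>2)" for i
      by (rule member_le_sum) auto
  qed simp
  also have "(\<Sum>i\<in>UNIV. \<Sum>j\<in>UNIV. (C $ i $ j)\<^sup>2) = trace (C ** C)"
  proof -
    have "(C $ i $ j)\<^sup>2 = C $ i $ j * C $ j $ i" for i j
      unfolding power2_eq_square by (subst (2) cs) (rule refl)
    then show ?thesis by (simp add: trace_def matrix_matrix_mult_def)
  qed
  finally show ?thesis by (simp add: trC trCC)
qed

section \<open>The Levi-Civita connection in one chart\<close>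

lemma partial_cong:
  assumes "open S" "x \<in> S" "\<And>y. y \<in> S \<Longrightarrow> f y = g y" "f differentiable (at x)"
  shows "partial i f x = partial i g x"
proof -
  have "(f has_derivative fderiv f x) (at x)"
    using assms(4) frechet_derivative_works by blast
  from has_derivative_transform_within_open[OF this assms(1,2,3)]
  have "(g has_derivative fderiv f x) (at x)" .
  from frechet_derivative_at[OF this] show ?thesis by (simp add: partial_def)
qed

lemma partial_add:
  assumes "f differentiable (at x)" "g differentiable (at x)"
  shows "partial i (\<lambda>y. f y + g y) x = partial i f x + partial i g x"
proof -
  have "((\<lambda>y. f y + g y) has_derivative (\<lambda>v. fderiv f x v + fderiv g x v)) (at x)"
    using assms frechet_derivative_works by (intro has_derivative_add) blast+
  from frechet_derivative_at[OF this] show ?thesis by (simp add: partial_def fun_eq_iff)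
qed

lemma partial_mult:
  assumes "f differentiable (at x)" "g differentiable (at x)"
  shows "partial i (\<lambda>y. f y * g y) x = f x * partial i g x + partial i f x * g x"
proof -
  have "((\<lambda>y. f y * g y) has_derivative (\<lambda>v. f x * fderiv g x v + fderiv f x v * g x)) (at x)"
    using assms frechet_derivative_works by (intro has_derivative_mult) blast+
  from frechet_derivative_at[OF this] show ?thesis by (simp add: partial_def fun_eq_iff)
qed

lemma partial_sum:
  assumes "\<And>j. j \<in> I \<Longrightarrow> f j differentiable (at x)"
  shows "partial i (\<lambda>y. \<Sum>j\<in>I. f j y) x = (\<Sum>j\<in>I. partial i (f j) x)"
proof -
  have "((\<lambda>y. \<Sum>j\<in>I. f j y) has_derivative (\<lambda>v. \<Sum>j\<in>I. fderiv (f j) x v)) (at x)"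
    using assms frechet_derivative_works by (intro has_derivative_sum) blast+
  from frechet_derivative_at[OF this] show ?thesis by (simp add: partial_def fun_eq_iff)
qed

lemma inner_matrix_vector_mult_sum:
  "v \<bullet> (M *v w) = (\<Sum>i\<in>UNIV. \<Sum>j\<in>UNIV. v $ i * M $ i $ j * w $ j)" for M :: "real^'n^'m"
  by (simp add: inner_vec_def matrix_vector_mult_def sum_distrib_left mult.assoc)

lemma inner_transpose_matrix: "v \<bullet> (transpose J *v z) = (J *v v) \<bullet> z" for J :: "real^'n^'m"
  by (metis dot_lmul_matrix inner_commute transpose_matrix_vector transpose_transpose)

lemma inner_symmetric_matrix:
  fixes M :: "real^'n^'n"
  assumes "transpose M = M"
  shows "v \<bullet> (M *v w) = w \<bullet> (M *v v)"
  by (metis assms dot_lmul_matrix inner_commute transpose_matrix_vector)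

definition christoffel_vec :: "(real^'n::finite \<Rightarrow> real^'n^'n) \<Rightarrow> real^'n \<Rightarrow> real^'n \<Rightarrow> real^'n \<Rightarrow> real^'n" where
  "christoffel_vec g x v w = (\<chi> k. \<Sum>i\<in>UNIV. \<Sum>j\<in>UNIV. christoffel g k i j x * v $ i * w $ j)"

text \<open>
  The matrix of the endomorphism \<open>v \<mapsto> \<nabla>\<^sub>v E\<close>.
\<close>

definition covariant_derivative :: "(real^'n::finite \<Rightarrow> real^'n^'n) \<Rightarrow> (real^'n \<Rightarrow> real^'n) \<Rightarrow> real^'n \<Rightarrow> real^'n^'n" where
  "covariant_derivative g E x =
     (\<chi> i j. partial j (\<lambda>y. E y $ i) x + (\<Sum>k\<in>UNIV. christoffel g i j k x * E x $ k))"

locale local_metric =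
  fixes U :: "(real^'n::finite) set" and g :: "real^'n \<Rightarrow> real^'n^'n"
  assumes open_U: "open U"
    and smooth_g: "smooth_on U g"
    and sym_g: "x \<in> U \<Longrightarrow> transpose (g x) = g x"
    and pos_g: "x \<in> U \<Longrightarrow> v \<noteq> 0 \<Longrightarrow> v \<bullet> (g x *v v) > 0"
begin

lemma invertible_g: "x \<in> U \<Longrightarrow> invertible (g x)"
proof -
  assume x: "x \<in> U"
  have "v = 0" if "g x *v v = 0" for v
    using pos_g[OF x, of v] that by (cases "v = 0") auto
  then show ?thesis
    by (metis invertible_left_inverse matrix_left_invertible_ker)
qed

lemma g_nth_commute: "x \<in> U \<Longrightarrow> g x $ i $ j = g x $ j $ i"
  using sym_g[of x] unfolding transpose_eq_self_iff by blast

lemma smooth_g_nth: "smooth_on U (\<lambda>x. g x $ i $ j)"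
  by (intro smooth_on_nth[OF open_U] smooth_g)

lemma partial_g_commute: "x \<in> U \<Longrightarrow> partial k (\<lambda>y. g y $ i $ j) x = partial k (\<lambda>y. g y $ j $ i) x"
  by (rule partial_cong[OF open_U _ _ smooth_on_differentiable[OF smooth_g_nth]]) (simp_all add: g_nth_commute)

lemma smooth_christoffel: "smooth_on U (christoffel g k i j)"
proof -
  have "smooth_on U (\<lambda>x. matrix_inv (g x))"
    by (rule smooth_on_matrix_inv[OF open_U smooth_g]) (use invertible_g in \<open>simp add: invertible_det_nz\<close>)
  then have m: "smooth_on U (\<lambda>x. matrix_inv (g x) $ k $ l)" for k l
    by (intro smooth_on_nth[OF open_U])
  have "smooth_on U (\<lambda>x. (1/2) * (\<Sum>l\<in>UNIV. matrix_inv (g x) $ k $ l *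
     (partial i (\<lambda>y. g y $ j $ l) x + partial j (\<lambda>y. g y $ i $ l) x - partial l (\<lambda>y. g y $ i $ j) x)))"
    by (intro smooth_on_mult[OF open_U] smooth_on_const smooth_on_sum[OF open_U] m
        smooth_on_diff[OF open_U] smooth_on_add[OF open_U] smooth_on_partial smooth_g_nth)
  then show ?thesis unfolding christoffel_def .
qed

lemma christoffel_commute: "x \<in> U \<Longrightarrow> christoffel g k i j x = christoffel g k j i x"
  unfolding christoffel_def using partial_g_commute[of x _ i j]
  by (intro arg_cong[where f="\<lambda>t. (1/2) * t"] sum.cong refl) simp

lemma christoffel_lower:
  assumes x: "x \<in> U"
  shows "(\<Sum>k\<in>UNIV. g x $ m $ k * christoffel g k i j x) =
    (1/2) * (partial i (\<lambda>y. g y $ j $ m) x + partial j (\<lambda>y. g y $ i $ m) x - partial m (\<lambda>y. g y $ i $ j) x)"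
proof -
  define w :: "real^'n" where "w = (\<chi> l. (1/2) * (partial i (\<lambda>y. g y $ j $ l) x + partial j (\<lambda>y. g y $ i $ l) x - partial l (\<lambda>y. g y $ i $ j) x))"
  have "christoffel g k i j x = (matrix_inv (g x) *v w) $ k" for k
    unfolding christoffel_def matrix_vector_mult_def w_def by (simp add: sum_distrib_left algebra_simps)
  then have "(\<Sum>k\<in>UNIV. g x $ m $ k * christoffel g k i j x) = (g x *v (matrix_inv (g x) *v w)) $ m"
    by (simp add: matrix_vector_mult_def[of "g x"])
  also have "\<dots> = w $ m"
    using matrix_inv_right[OF invertible_g[OF x]] by (simp add: matrix_vector_mul_assoc)
  finally show ?thesis by (simp add: w_def)
qed

lemma frechet_derivative_g:
  assumes x: "x \<in> U"
  shows "fderiv g x v $ i $ j = (\<Sum>k\<in>UNIV. v $ k * partial k (\<lambda>y. g y $ i $ j) x)"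
proof -
  have gx: "(g has_derivative fderiv g x) (at x)"
    by (rule smooth_on_has_derivative[OF smooth_g x])
  have "((\<lambda>y. g y $ i $ j) has_derivative (\<lambda>v. fderiv g x v $ i $ j)) (at x)"
    by (intro bounded_linear.has_derivative[OF bounded_linear_vec_nth] gx)
  from frechet_derivative_at[OF this]
  have "fderiv g x v $ i $ j = fderiv (\<lambda>y. g y $ i $ j) x v" by metis
  then show ?thesis
    using frechet_derivative_eq_sum_partial[OF smooth_on_differentiable[OF smooth_g_nth x]] by simp
qed

text \<open>
  The form in which the Levi-Civita connection is used below: only derivatives of the metric in the
  directions \<open>v\<close> and \<open>z\<close> appear, so that sums over indices can be avoided.
\<close>

lemma christoffel_vec_lower:
  assumes x: "x \<in> U"
  shows "z \<bullet> (g x *v christoffel_vec g x v v) =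
    v \<bullet> (fderiv g x v *v z) - (1/2) * (v \<bullet> (fderiv g x z *v v))"
proof -
  let ?d = "\<lambda>k i j. partial k (\<lambda>y. g y $ i $ j) x"
  have "z \<bullet> (g x *v christoffel_vec g x v v) =
     (\<Sum>m\<in>UNIV. z $ m * (\<Sum>k\<in>UNIV. \<Sum>i\<in>UNIV. \<Sum>j\<in>UNIV. g x $ m $ k * (christoffel g k i j x * v $ i * v $ j)))"
    by (simp add: inner_vec_def matrix_vector_mult_def christoffel_vec_def sum_distrib_left)
  also have "\<dots> = (\<Sum>m\<in>UNIV. z $ m * (\<Sum>i\<in>UNIV. \<Sum>j\<in>UNIV. (\<Sum>k\<in>UNIV. g x $ m $ k * christoffel g k i j x) * v $ i * v $ j))"
  proof -
    have "(\<Sum>k\<in>UNIV. \<Sum>i\<in>UNIV. \<Sum>j\<in>UNIV. g x $ m $ k * (christoffel g k i j x * v $ i * v $ j)) =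
      (\<Sum>i\<in>UNIV. \<Sum>j\<in>UNIV. (\<Sum>k\<in>UNIV. g x $ m $ k * christoffel g k i j x) * v $ i * v $ j)" for m
    proof -
      have "(\<Sum>k\<in>UNIV. \<Sum>i\<in>UNIV. \<Sum>j\<in>UNIV. g x $ m $ k * (christoffel g k i j x * v $ i * v $ j)) =
        (\<Sum>i\<in>UNIV. \<Sum>k\<in>UNIV. \<Sum>j\<in>UNIV. g x $ m $ k * (christoffel g k i j x * v $ i * v $ j))"
        by (rule sum.swap)
      also have "\<dots> = (\<Sum>i\<in>UNIV. \<Sum>j\<in>UNIV. \<Sum>k\<in>UNIV. g x $ m $ k * (christoffel g k i j x * v $ i * v $ j))"
        by (rule sum.cong[OF refl], rule sum.swap)
      finally show ?thesis by (simp add: sum_distrib_right mult.assoc)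
    qed
    then show ?thesis by simp
  qed
  also have "\<dots> = (\<Sum>m\<in>UNIV. \<Sum>i\<in>UNIV. \<Sum>j\<in>UNIV.
       (1/2) * (v $ i * v $ j * ?d i j m * z $ m) + (1/2) * (v $ i * v $ j * ?d j i m * z $ m) - (1/2) * (z $ m * ?d m i j * v $ i * v $ j))"
    unfolding christoffel_lower[OF x] by (simp add: sum_distrib_left algebra_simps)
  also have "\<dots> = (1/2) * (\<Sum>m\<in>UNIV. \<Sum>i\<in>UNIV. \<Sum>j\<in>UNIV. v $ i * v $ j * ?d i j m * z $ m)
     + (1/2) * (\<Sum>m\<in>UNIV. \<Sum>i\<in>UNIV. \<Sum>j\<in>UNIV. v $ i * v $ j * ?d j i m * z $ m)
     - (1/2) * (\<Sum>m\<in>UNIV. \<Sum>i\<in>UNIV. \<Sum>j\<in>UNIV. z $ m * ?d m i j * v $ i * v $ j)"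
    by (simp add: sum.distrib sum_subtractf sum_distrib_left)
  also have "(\<Sum>m\<in>UNIV. \<Sum>i\<in>UNIV. \<Sum>j\<in>UNIV. v $ i * v $ j * ?d j i m * z $ m) =
     (\<Sum>m\<in>UNIV. \<Sum>i\<in>UNIV. \<Sum>j\<in>UNIV. v $ i * v $ j * ?d i j m * z $ m)"
    by (rule sum.cong[OF refl], subst sum.swap) (simp add: mult.commute mult.left_commute)
  also have "(\<Sum>m\<in>UNIV. \<Sum>i\<in>UNIV. \<Sum>j\<in>UNIV. v $ i * v $ j * ?d i j m * z $ m) =
     v \<bullet> (fderiv g x v *v z)"
  proof -
    have "v \<bullet> (fderiv g x v *v z) = (\<Sum>j\<in>UNIV. \<Sum>m\<in>UNIV. \<Sum>i\<in>UNIV. v $ i * v $ j * ?d i j m * z $ m)"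
      unfolding inner_matrix_vector_mult_sum frechet_derivative_g[OF x]
      by (simp add: sum_distrib_left sum_distrib_right algebra_simps)
    also have "\<dots> = (\<Sum>m\<in>UNIV. \<Sum>j\<in>UNIV. \<Sum>i\<in>UNIV. v $ i * v $ j * ?d i j m * z $ m)"
      by (rule sum.swap)
    also have "\<dots> = (\<Sum>m\<in>UNIV. \<Sum>i\<in>UNIV. \<Sum>j\<in>UNIV. v $ i * v $ j * ?d i j m * z $ m)"
      by (rule sum.cong[OF refl], rule sum.swap)
    finally show ?thesis by simp
  qed
  also have "(\<Sum>m\<in>UNIV. \<Sum>i\<in>UNIV. \<Sum>j\<in>UNIV. z $ m * ?d m i j * v $ i * v $ j) =
     v \<bullet> (fderiv g x z *v v)"
  proof -
    have "v \<bullet> (fderiv g x z *v v) = (\<Sum>i\<in>UNIV. \<Sum>j\<in>UNIV. \<Sum>m\<in>UNIV. z $ m * ?d m i j * v $ i * v $ j)"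
      unfolding inner_matrix_vector_mult_sum frechet_derivative_g[OF x]
      by (simp add: sum_distrib_left sum_distrib_right algebra_simps)
    also have "\<dots> = (\<Sum>i\<in>UNIV. \<Sum>m\<in>UNIV. \<Sum>j\<in>UNIV. z $ m * ?d m i j * v $ i * v $ j)"
      by (rule sum.cong[OF refl], rule sum.swap)
    also have "\<dots> = (\<Sum>m\<in>UNIV. \<Sum>i\<in>UNIV. \<Sum>j\<in>UNIV. z $ m * ?d m i j * v $ i * v $ j)"
      by (rule sum.swap)
    finally show ?thesis by simp
  qed
  finally show ?thesis by simp
qed

lemma hessian_sym:
  assumes "smooth_on U H" "x \<in> U"
  shows "transpose (hessian g H x) = hessian g H x"
  unfolding transpose_eq_self_iff hessian_def
  using partial_commute[OF open_U assms] christoffel_commute[OF assms(2)] by simp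

text \<open>
  For a gradient field \<open>E = grad H\<close>, lowering an index commutes with covariant differentiation, so
  \<open>g(\<nabla>\<^sub>v E, w)\<close> is the Hessian of \<open>H\<close>. In particular \<open>\<nabla>E\<close> is self-adjoint.
\<close>

lemma metric_covariant_derivative_gradient:
  assumes E: "smooth_on U E" and H: "smooth_on U H"
    and grad: "\<And>y i. y \<in> U \<Longrightarrow> (g y *v E y) $ i = partial i H y"
    and x: "x \<in> U"
  shows "g x ** covariant_derivative g E x = hessian g H x"
proof -
  have En: "smooth_on U (\<lambda>y. E y $ i)" for i by (intro smooth_on_nth[OF open_U] E)
  have Ed: "(\<lambda>y. E y $ i) differentiable (at x)" for i
    by (rule smooth_on_differentiable[OF En x])
  have gd: "(\<lambda>y. g y $ i $ j) differentiable (at x)" for i j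
    by (rule smooth_on_differentiable[OF smooth_g_nth x])
  have gE: "(\<lambda>y. g y $ l $ i * E y $ i) differentiable (at x)" for l i
    by (rule smooth_on_differentiable[OF smooth_on_mult[OF open_U smooth_g_nth En] x])
  let ?d = "\<lambda>k i j. partial k (\<lambda>y. g y $ i $ j) x"
  have pp: "partial j (partial l H) x = (\<Sum>i\<in>UNIV. g x $ l $ i * partial j (\<lambda>y. E y $ i) x + ?d j l i * E x $ i)" for j l
  proof -
    have "partial j (\<lambda>y. \<Sum>i\<in>UNIV. g y $ l $ i * E y $ i) x = partial j (partial l H) x"
    proof (rule partial_cong[OF open_U x])
      show "(\<Sum>i\<in>UNIV. g y $ l $ i * E y $ i) = partial l H y" if "y \<in> U" for y
        using grad[OF that, of l] by (simp add: matrix_vector_mult_def)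
      show "(\<lambda>y. \<Sum>i\<in>UNIV. g y $ l $ i * E y $ i) differentiable (at x)"
        by (auto intro!: differentiable_sum gE)
    qed
    also have "partial j (\<lambda>y. \<Sum>i\<in>UNIV. g y $ l $ i * E y $ i) x =
       (\<Sum>i\<in>UNIV. g x $ l $ i * partial j (\<lambda>y. E y $ i) x + ?d j l i * E x $ i)"
      by (simp add: partial_sum partial_mult gd Ed gE)
    finally show ?thesis by simp
  qed
  have "(g x ** covariant_derivative g E x) $ l $ j = hessian g H x $ l $ j" for l j
  proof -
    have "(g x ** covariant_derivative g E x) $ l $ j =
      (\<Sum>i\<in>UNIV. g x $ l $ i * partial j (\<lambda>y. E y $ i) x) + (\<Sum>i\<in>UNIV. \<Sum>k\<in>UNIV. g x $ l $ i * (christoffel g i j k x * E x $ k))"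
      by (simp add: matrix_matrix_mult_def covariant_derivative_def distrib_left sum.distrib sum_distrib_left)
    also have "(\<Sum>i\<in>UNIV. \<Sum>k\<in>UNIV. g x $ l $ i * (christoffel g i j k x * E x $ k)) =
       (\<Sum>k\<in>UNIV. (\<Sum>i\<in>UNIV. g x $ l $ i * christoffel g i j k x) * E x $ k)"
      by (subst sum.swap) (simp add: sum_distrib_right mult.assoc)
    also have "\<dots> = (\<Sum>k\<in>UNIV. (1/2) * (?d j k l + ?d k j l - ?d l j k) * E x $ k)"
      by (simp add: christoffel_lower[OF x])
    finally have lhs: "(g x ** covariant_derivative g E x) $ l $ j =
      (\<Sum>i\<in>UNIV. g x $ l $ i * partial j (\<lambda>y. E y $ i) x + (1/2) * (?d j i l + ?d i j l - ?d l j i) * E x $ i)"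
      by (simp add: sum.distrib)
    have "(\<Sum>k\<in>UNIV. christoffel g k l j x * partial k H x) =
       (\<Sum>k\<in>UNIV. \<Sum>i\<in>UNIV. christoffel g k l j x * (g x $ k $ i * E x $ i))"
      using grad[OF x] by (simp add: matrix_vector_mult_def sum_distrib_left[symmetric])
    also have "\<dots> = (\<Sum>i\<in>UNIV. (\<Sum>k\<in>UNIV. g x $ i $ k * christoffel g k l j x) * E x $ i)"
    proof -
      have "christoffel g k l j x * (g x $ k $ i * E x $ i) = g x $ i $ k * christoffel g k l j x * E x $ i" for i k
        by (subst g_nth_commute[OF x, of k i]) (simp only: mult_ac)
      then show ?thesis by (subst sum.swap) (simp only: sum_distrib_right)
    qed
    also have "\<dots> = (\<Sum>i\<in>UNIV. (1/2) * (?d l j i + ?d j l i - ?d i l j) * E x $ i)"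
      by (simp add: christoffel_lower[OF x])
    finally have "hessian g H x $ l $ j = (\<Sum>i\<in>UNIV. g x $ l $ i * partial j (\<lambda>y. E y $ i) x + ?d j l i * E x $ i)
      - (\<Sum>i\<in>UNIV. (1/2) * (?d l j i + ?d j l i - ?d i l j) * E x $ i)"
      using pp[of j l] partial_commute[OF open_U H x, of l j] by (simp add: hessian_def)
    also have "\<dots> = (\<Sum>i\<in>UNIV. g x $ l $ i * partial j (\<lambda>y. E y $ i) x + (1/2) * (?d j i l + ?d i j l - ?d l j i) * E x $ i)"
      unfolding sum_subtractf[symmetric]
      using partial_g_commute[OF x, of j l] partial_g_commute[OF x, of _ l j]
      by (intro sum.cong refl) (simp add: algebra_simps)
    finally show ?thesis using lhs by simp
  qed
  then show ?thesis by (simp add: vec_eq_iff)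
qed

end

section \<open>The Euler field and the traced Riccati equation\<close>

text \<open>
  The algebra behind \<open>riccati_trace\<close>. Here \<open>e\<close>, \<open>d\<close> and \<open>h\<close> stand for the components of a vector field
  and for their first and second derivatives, \<open>G\<close> and \<open>dG\<close> for the Christoffel symbols and their
  derivatives. \<open>A2\<close> is the equation \<open>\<nabla>\<^sub>E E = E\<close>, and \<open>A1\<close> is its \<open>i\<close>-th component differentiated in
  direction \<open>i\<close>. The claim is the sum of \<open>A1\<close> over \<open>i\<close>, plus \<open>A2\<close> contracted with the traces
  \<open>G i i l\<close>; the remaining terms cancel after renaming summation indices.
\<close>

lemma riccati_contraction:
  fixes e :: "'n::finite \<Rightarrow> real" and d :: "'n \<Rightarrow> 'n \<Rightarrow> real" and h :: "'n \<Rightarrow> 'n \<Rightarrow> 'n \<Rightarrow> real"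
    and G :: "'n \<Rightarrow> 'n \<Rightarrow> 'n \<Rightarrow> real" and dG :: "'n \<Rightarrow> 'n \<Rightarrow> 'n \<Rightarrow> 'n \<Rightarrow> real"
  assumes hs: "\<And>i k j. h i k j = h k i j" and Gs: "\<And>k i j. G k i j = G k j i"
    and A1: "\<And>i. (\<Sum>k\<in>UNIV. d i k * d k i + e k * h i k i)
        + (\<Sum>j\<in>UNIV. \<Sum>k\<in>UNIV. dG i i j k * e j * e k + G i j k * (d i j * e k + e j * d i k)) = d i i"
    and A2: "\<And>i. (\<Sum>k\<in>UNIV. e k * d k i) + (\<Sum>j\<in>UNIV. \<Sum>k\<in>UNIV. G i j k * e j * e k) = e i"
  shows "(\<Sum>k\<in>UNIV. e k * (\<Sum>i\<in>UNIV. h k i i + (\<Sum>l\<in>UNIV. dG k i i l * e l + G i i l * d k l)))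
    + (\<Sum>i\<in>UNIV. \<Sum>j\<in>UNIV. (d j i + (\<Sum>k\<in>UNIV. G i j k * e k)) * (d i j + (\<Sum>k\<in>UNIV. G j i k * e k)))
    + (\<Sum>j\<in>UNIV. \<Sum>k\<in>UNIV. e j * (\<Sum>i\<in>UNIV. dG i i j k - dG j i i k
          + (\<Sum>m\<in>UNIV. G i i m * G m j k - G i j m * G m i k)) * e k)
    = (\<Sum>i\<in>UNIV. d i i + (\<Sum>k\<in>UNIV. G i i k * e k))"
proof -
  define S1 where "S1 = (\<Sum>k\<in>UNIV. \<Sum>i\<in>UNIV. e k * h k i i)"
  define S2 where "S2 = (\<Sum>k\<in>UNIV. \<Sum>i\<in>UNIV. \<Sum>l\<in>UNIV. e k * dG k i i l * e l)"
  define S3 where "S3 = (\<Sum>k\<in>UNIV. \<Sum>i\<in>UNIV. \<Sum>l\<in>UNIV. e k * G i i l * d k l)"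
  define T1 where "T1 = (\<Sum>i\<in>UNIV. \<Sum>j\<in>UNIV. d j i * d i j)"
  define T3 where "T3 = (\<Sum>i\<in>UNIV. \<Sum>j\<in>UNIV. \<Sum>k\<in>UNIV. d i j * G i j k * e k)"
  define T4 where "T4 = (\<Sum>i\<in>UNIV. \<Sum>j\<in>UNIV. (\<Sum>k\<in>UNIV. G i j k * e k) * (\<Sum>k\<in>UNIV. G j i k * e k))"
  define R1 where "R1 = (\<Sum>j\<in>UNIV. \<Sum>k\<in>UNIV. \<Sum>i\<in>UNIV. e j * dG i i j k * e k)"
  define R2 where "R2 = (\<Sum>j\<in>UNIV. \<Sum>k\<in>UNIV. \<Sum>i\<in>UNIV. e j * dG j i i k * e k)"
  define R3 where "R3 = (\<Sum>j\<in>UNIV. \<Sum>k\<in>UNIV. \<Sum>i\<in>UNIV. \<Sum>m\<in>UNIV. e j * (G i i m * G m j k) * e k)"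
  define R4 where "R4 = (\<Sum>j\<in>UNIV. \<Sum>k\<in>UNIV. \<Sum>i\<in>UNIV. \<Sum>m\<in>UNIV. e j * (G i j m * G m i k) * e k)"
  have a: "(\<Sum>k\<in>UNIV. e k * (\<Sum>i\<in>UNIV. h k i i + (\<Sum>l\<in>UNIV. dG k i i l * e l + G i i l * d k l))) = S1 + S2 + S3"
    unfolding S1_def S2_def S3_def
    by (simp add: sum_distrib_left distrib_left sum.distrib mult.assoc)
  have b: "(\<Sum>i\<in>UNIV. \<Sum>j\<in>UNIV. (d j i + (\<Sum>k\<in>UNIV. G i j k * e k)) * (d i j + (\<Sum>k\<in>UNIV. G j i k * e k))) = T1 + 2 * T3 + T4"
  proof -
    have "(\<Sum>i\<in>UNIV. \<Sum>j\<in>UNIV. (d j i + (\<Sum>k\<in>UNIV. G i j k * e k)) * (d i j + (\<Sum>k\<in>UNIV. G j i k * e k)))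
      = T1 + (\<Sum>i\<in>UNIV. \<Sum>j\<in>UNIV. d j i * (\<Sum>k\<in>UNIV. G j i k * e k)) + (\<Sum>i\<in>UNIV. \<Sum>j\<in>UNIV. d i j * (\<Sum>k\<in>UNIV. G i j k * e k)) + T4"
      unfolding T1_def T4_def by (simp add: distrib_left distrib_right sum.distrib mult.commute)
    also have "(\<Sum>i\<in>UNIV. \<Sum>j\<in>UNIV. d j i * (\<Sum>k\<in>UNIV. G j i k * e k)) = T3"
      unfolding T3_def by (subst sum.swap) (simp add: sum_distrib_left mult.assoc)
    also have "(\<Sum>i\<in>UNIV. \<Sum>j\<in>UNIV. d i j * (\<Sum>k\<in>UNIV. G i j k * e k)) = T3"
      unfolding T3_def by (simp add: sum_distrib_left mult.assoc)
    finally show ?thesis by simp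
  qed
  have c: "(\<Sum>j\<in>UNIV. \<Sum>k\<in>UNIV. e j * (\<Sum>i\<in>UNIV. dG i i j k - dG j i i k
          + (\<Sum>m\<in>UNIV. G i i m * G m j k - G i j m * G m i k)) * e k) = R1 - R2 + R3 - R4"
    unfolding R1_def R2_def R3_def R4_def
    by (simp add: sum_distrib_left sum_distrib_right distrib_left distrib_right right_diff_distrib left_diff_distrib
        sum.distrib sum_subtractf)
  have S2R2: "S2 = R2"
    unfolding S2_def R2_def by (rule sum.cong[OF refl], rule sum.swap)
  have T4R4: "T4 = R4"
  proof -
    have "R4 = (\<Sum>j\<in>UNIV. \<Sum>i\<in>UNIV. \<Sum>m\<in>UNIV. \<Sum>k\<in>UNIV. e j * (G i j m * G m i k) * e k)"
      unfolding R4_def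
      by (rule sum.cong[OF refl], subst sum.swap, rule sum.cong[OF refl], rule sum.swap)
    also have "\<dots> = (\<Sum>i\<in>UNIV. \<Sum>m\<in>UNIV. \<Sum>j\<in>UNIV. \<Sum>k\<in>UNIV. e j * (G i j m * G m i k) * e k)"
      by (subst sum.swap, rule sum.cong[OF refl], rule sum.swap)
    also have "\<dots> = T4"
      unfolding T4_def sum_product
      by (intro sum.cong refl) (simp add: Gs[of _ _ _] mult.assoc mult.commute mult.left_commute)
    finally show ?thesis by simp
  qed
  have A1': "T1 + S1 + R1 + 2 * T3 = (\<Sum>i\<in>UNIV. d i i)"
  proof -
    have "(\<Sum>i\<in>UNIV. d i i) = (\<Sum>i\<in>UNIV. (\<Sum>k\<in>UNIV. d i k * d k i + e k * h i k i)
        + (\<Sum>j\<in>UNIV. \<Sum>k\<in>UNIV. dG i i j k * e j * e k + G i j k * (d i j * e k + e j * d i k)))"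
      using A1 by simp
    also have "\<dots> = (\<Sum>i\<in>UNIV. \<Sum>k\<in>UNIV. d i k * d k i) + (\<Sum>i\<in>UNIV. \<Sum>k\<in>UNIV. e k * h i k i)
       + (\<Sum>i\<in>UNIV. \<Sum>j\<in>UNIV. \<Sum>k\<in>UNIV. dG i i j k * e j * e k)
       + (\<Sum>i\<in>UNIV. \<Sum>j\<in>UNIV. \<Sum>k\<in>UNIV. d i j * G i j k * e k)
       + (\<Sum>i\<in>UNIV. \<Sum>j\<in>UNIV. \<Sum>k\<in>UNIV. G i j k * e j * d i k)"
      by (simp add: sum.distrib distrib_left mult.assoc mult.commute mult.left_commute)
    also have "(\<Sum>i\<in>UNIV. \<Sum>k\<in>UNIV. d i k * d k i) = T1"
      unfolding T1_def by (simp add: mult.commute)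
    also have "(\<Sum>i\<in>UNIV. \<Sum>k\<in>UNIV. e k * h i k i) = S1"
      unfolding S1_def by (subst sum.swap) (intro sum.cong refl, metis hs)
    also have "(\<Sum>i\<in>UNIV. \<Sum>j\<in>UNIV. \<Sum>k\<in>UNIV. dG i i j k * e j * e k) = R1"
      unfolding R1_def
      by (subst sum.swap, rule sum.cong[OF refl], subst sum.swap) (simp add: mult.commute mult.left_commute)
    also have "(\<Sum>i\<in>UNIV. \<Sum>j\<in>UNIV. \<Sum>k\<in>UNIV. d i j * G i j k * e k) = T3"
      unfolding T3_def ..
    also have "(\<Sum>i\<in>UNIV. \<Sum>j\<in>UNIV. \<Sum>k\<in>UNIV. G i j k * e j * d i k) = T3"
      unfolding T3_def
      by (rule sum.cong[OF refl], subst sum.swap, intro sum.cong refl) (simp add: Gs[of _ _ _] mult.commute mult.left_commute)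
    finally show ?thesis by simp
  qed
  have A2': "S3 + R3 = (\<Sum>i\<in>UNIV. \<Sum>l\<in>UNIV. G i i l * e l)"
  proof -
    have "(\<Sum>i\<in>UNIV. \<Sum>l\<in>UNIV. G i i l * e l) =
      (\<Sum>i\<in>UNIV. \<Sum>l\<in>UNIV. G i i l * ((\<Sum>k\<in>UNIV. e k * d k l) + (\<Sum>j\<in>UNIV. \<Sum>k\<in>UNIV. G l j k * e j * e k)))"
      using A2 by simp
    also have "\<dots> = (\<Sum>i\<in>UNIV. \<Sum>l\<in>UNIV. \<Sum>k\<in>UNIV. e k * G i i l * d k l)
      + (\<Sum>i\<in>UNIV. \<Sum>l\<in>UNIV. \<Sum>j\<in>UNIV. \<Sum>k\<in>UNIV. e j * (G i i l * G l j k) * e k)"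
      by (simp add: distrib_left sum.distrib sum_distrib_left mult.assoc mult.commute mult.left_commute)
    also have "(\<Sum>i\<in>UNIV. \<Sum>l\<in>UNIV. \<Sum>k\<in>UNIV. e k * G i i l * d k l) = S3"
      unfolding S3_def by (subst (2) sum.swap) (rule sum.cong[OF refl], rule sum.swap)
    also have "(\<Sum>i\<in>UNIV. \<Sum>l\<in>UNIV. \<Sum>j\<in>UNIV. \<Sum>k\<in>UNIV. e j * (G i i l * G l j k) * e k) = R3"
    proof -
      have "R3 = (\<Sum>j\<in>UNIV. \<Sum>i\<in>UNIV. \<Sum>m\<in>UNIV. \<Sum>k\<in>UNIV. e j * (G i i m * G m j k) * e k)"
        unfolding R3_def
        by (rule sum.cong[OF refl], subst sum.swap, rule sum.cong[OF refl], rule sum.swap)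
      also have "\<dots> = (\<Sum>i\<in>UNIV. \<Sum>m\<in>UNIV. \<Sum>j\<in>UNIV. \<Sum>k\<in>UNIV. e j * (G i i m * G m j k) * e k)"
        by (subst sum.swap, rule sum.cong[OF refl], rule sum.swap)
      finally show ?thesis by simp
    qed
    finally show ?thesis by simp
  qed
  have "(\<Sum>i\<in>UNIV. d i i + (\<Sum>k\<in>UNIV. G i i k * e k)) = (\<Sum>i\<in>UNIV. d i i) + (\<Sum>i\<in>UNIV. \<Sum>l\<in>UNIV. G i i l * e l)"
    by (simp add: sum.distrib)
  then show ?thesis unfolding a b c using A1' A2' S2R2 T4R4 by simp
qed

lemma bounded_bilinear_matrix_vector_mult:
  "bounded_bilinear ((*v) :: real^'n^'m \<Rightarrow> real^'n \<Rightarrow> real^'m)"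
proof (rule bilinear_conv_bounded_bilinear[THEN iffD1])
  show "bilinear ((*v) :: real^'n^'m \<Rightarrow> real^'n \<Rightarrow> real^'m)"
    unfolding bilinear_def
    by (auto intro!: linearI simp: matrix_vector_right_distrib matrix_vector_mult_add_rdistrib
        vec_eq_iff matrix_vector_mul_component inner_add_left)
qed

lemmas smooth_on_matrix_vector_mult = smooth_on_bilinear[OF bounded_bilinear_matrix_vector_mult]

lemma frechet_derivative_eqI:
  "(f has_derivative f') (at x) \<Longrightarrow> fderiv f x v = f' v"
  by (metis frechet_derivative_at)

lemma second_derivative_symmetric_vec:
  fixes F :: "'a::real_normed_vector \<Rightarrow> real^'n"
  assumes S: "open S" and F: "smooth_on S F" and x: "x \<in> S"
  shows "fderiv (\<lambda>y. fderiv F y u) x v =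
         fderiv (\<lambda>y. fderiv F y v) x u"
proof -
  have "fderiv (\<lambda>y. fderiv F y u) x v $ i =
      fderiv (\<lambda>y. fderiv (\<lambda>z. F z $ i) y u) x v" for u v i
  proof -
    have d1: "((\<lambda>y. fderiv F y u $ i) has_derivative
          (\<lambda>v. fderiv (\<lambda>y. fderiv F y u) x v $ i)) (at x)"
      by (intro bounded_linear.has_derivative[OF bounded_linear_vec_nth] smooth_on_has_derivative[OF smooth_on_frechet_derivative[OF F] x])
    have "((\<lambda>y. fderiv (\<lambda>z. F z $ i) y u) has_derivative
          (\<lambda>v. fderiv (\<lambda>y. fderiv F y u) x v $ i)) (at x)"
      by (rule has_derivative_transform_within_open[OF d1 S x])
        (simp add: frechet_derivative_nth[OF smooth_on_differentiable[OF F]])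
    from frechet_derivative_eqI[OF this, of v] show ?thesis by simp
  qed
  then show ?thesis
    using second_derivative_symmetric[OF S smooth_on_nth[OF S F] x] by (simp add: vec_eq_iff)
qed

text \<open>
  The equation \<open>\<nabla>\<^sub>E E = E\<close>, expressed in a chart, says that the integral curves of \<open>E\<close> are geodesics
  traversed with exponentially growing speed. In normal coordinates around the pole
  \<open>E\<close> is the identity vector field.
\<close>

locale euler_field = local_metric U g for U :: "(real^'n::finite) set" and g +
  fixes E :: "real^'n \<Rightarrow> real^'n"
  assumes smooth_E: "smooth_on U E"
    and euler: "x \<in> U \<Longrightarrow> fderiv E x (E x) + christoffel_vec g x (E x) (E x) = E x"
begin

definition energy :: "real^'n \<Rightarrow> real" where
  "energy x = E x \<bullet> (g x *v E x)"

lemma smooth_energy: "smooth_on U energy"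
  unfolding energy_def[abs_def]
  by (intro smooth_on_inner[OF open_U] smooth_on_matrix_vector_mult[OF open_U] smooth_E smooth_g)

lemma E_has_derivative: "x \<in> U \<Longrightarrow> (E has_derivative fderiv E x) (at x)"
  by (rule smooth_on_has_derivative[OF smooth_E])

lemma g_has_derivative: "x \<in> U \<Longrightarrow> (g has_derivative fderiv g x) (at x)"
  by (rule smooth_on_has_derivative[OF smooth_g])

lemma frechet_derivative_energy:
  assumes x: "x \<in> U"
  shows "fderiv energy x v =
    2 * (E x \<bullet> (g x *v fderiv E x v)) + E x \<bullet> (fderiv g x v *v E x)"
proof -
  have "(energy has_derivative (\<lambda>v. E x \<bullet> (g x *v fderiv E x v + fderiv g x v *v E x)
      + fderiv E x v \<bullet> (g x *v E x))) (at x)"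
    unfolding energy_def[abs_def]
    by (intro has_derivative_inner bounded_bilinear.FDERIV[OF bounded_bilinear_matrix_vector_mult]
        E_has_derivative g_has_derivative x)
  from frechet_derivative_eqI[OF this, of v]
  show ?thesis
    using inner_symmetric_matrix[OF sym_g[OF x], of "fderiv E x v" "E x"]
    by (simp add: inner_add_right)
qed

lemma euler_lower:
  assumes x: "x \<in> U"
  shows "fderiv E x (E x) \<bullet> (g x *v v) + E x \<bullet> (fderiv g x (E x) *v v)
     = E x \<bullet> (g x *v v) + (1/2) * (E x \<bullet> (fderiv g x v *v E x))"
proof -
  have "fderiv E x (E x) = E x - christoffel_vec g x (E x) (E x)"
    using euler[OF x] by (simp add: eq_diff_eq)
  then have "fderiv E x (E x) \<bullet> (g x *v v)
      = E x \<bullet> (g x *v v) - v \<bullet> (g x *v christoffel_vec g x (E x) (E x))"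
    using inner_symmetric_matrix[OF sym_g[OF x], of v "christoffel_vec g x (E x) (E x)"]
    by (simp add: inner_diff_left)
  then show ?thesis unfolding christoffel_vec_lower[OF x] by simp
qed

lemma energy_homogeneous:
  assumes x: "x \<in> U"
  shows "fderiv energy x (E x) = 2 * energy x"
  using euler_lower[OF x, of "E x"] inner_symmetric_matrix[OF sym_g[OF x], of "fderiv E x (E x)" "E x"]
  unfolding frechet_derivative_energy[OF x] energy_def by simp

definition div_E :: "real^'n \<Rightarrow> real" where
  "div_E x = trace (covariant_derivative g E x)"

lemma smooth_div_E: "smooth_on U div_E"
proof -
  have "smooth_on U (\<lambda>x. \<Sum>i\<in>UNIV. partial i (\<lambda>y. E y $ i) x + (\<Sum>k\<in>UNIV. christoffel g i i k x * E x $ k))"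
    by (intro smooth_on_sum[OF open_U] smooth_on_add[OF open_U] smooth_on_mult[OF open_U] smooth_christoffel
        smooth_on_partial smooth_on_nth[OF open_U] smooth_E)
  then show ?thesis by (simp add: div_E_def[abs_def] trace_def covariant_derivative_def)
qed

text \<open>
  Trace of the curvature equation \<open>\<nabla>\<^sub>E B + B\<^sup>2 + R(-, E) E = B\<close> for \<open>B = \<nabla>E\<close>.
\<close>

theorem riccati_trace:
  assumes x: "x \<in> U"
  shows "fderiv div_E x (E x)
      + trace (covariant_derivative g E x ** covariant_derivative g E x)
      + E x \<bullet> (ricci g x *v E x) = div_E x"
proof -
  let ?e = "\<lambda>i. E x $ i" and ?d = "\<lambda>k i. partial k (\<lambda>y. E y $ i) x"
  let ?h = "\<lambda>i k j. partial i (partial k (\<lambda>y. E y $ j)) x"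
  let ?G = "\<lambda>k i j. christoffel g k i j x" and ?dG = "\<lambda>l k i j. partial l (christoffel g k i j) x"
  have En: "smooth_on U (\<lambda>y. E y $ i)" for i by (intro smooth_on_nth[OF open_U] smooth_E)
  note dE = smooth_on_differentiable[OF En]
  note dpE = smooth_on_differentiable[OF smooth_on_partial[OF En] x]
  note dG = smooth_on_differentiable[OF smooth_christoffel x]
  have dm1: "(\<lambda>y. E y $ k * partial k (\<lambda>y. E y $ i) y) differentiable (at x)" for k i
    by (rule smooth_on_differentiable[OF smooth_on_mult[OF open_U En smooth_on_partial[OF En]] x])
  have dm2: "(\<lambda>y. christoffel g i j k y * E y $ l) differentiable (at x)" for i j k l
    by (rule smooth_on_differentiable[OF smooth_on_mult[OF open_U smooth_christoffel En] x])
  have dm3: "(\<lambda>y. christoffel g i j k y * E y $ l * E y $ m) differentiable (at x)" for i j k l m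
    by (rule smooth_on_differentiable[OF smooth_on_mult[OF open_U smooth_on_mult[OF open_U smooth_christoffel En] En] x])
  have A2: "(\<Sum>k\<in>UNIV. E y $ k * partial k (\<lambda>y. E y $ i) y)
      + (\<Sum>j\<in>UNIV. \<Sum>k\<in>UNIV. christoffel g i j k y * E y $ j * E y $ k) = E y $ i" if y: "y \<in> U" for y i
  proof -
    have "(fderiv E y (E y) + christoffel_vec g y (E y) (E y)) $ i = E y $ i"
      using euler[OF y] by simp
    moreover have "fderiv E y (E y) $ i = (\<Sum>k\<in>UNIV. E y $ k * partial k (\<lambda>y. E y $ i) y)"
      using frechet_derivative_nth[OF smooth_on_differentiable[OF smooth_E y], of i "E y"]
        frechet_derivative_eq_sum_partial[OF dE[OF y], of i "E y"] by simp
    ultimately show ?thesis by (simp add: christoffel_vec_def)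
  qed
  have A1: "(\<Sum>k\<in>UNIV. ?d i k * ?d k i + ?e k * ?h i k i)
        + (\<Sum>j\<in>UNIV. \<Sum>k\<in>UNIV. ?dG i i j k * ?e j * ?e k + ?G i j k * (?d i j * ?e k + ?e j * ?d i k)) = ?d i i" for i
  proof -
    have s1: "(\<lambda>y. \<Sum>k\<in>UNIV. E y $ k * partial k (\<lambda>y. E y $ i) y) differentiable (at x)"
      by (auto intro!: differentiable_sum dm1)
    have s3: "(\<lambda>y. \<Sum>k\<in>UNIV. christoffel g i j k y * E y $ j * E y $ k) differentiable (at x)" for j
      by (auto intro!: differentiable_sum dm3)
    have s2: "(\<lambda>y. \<Sum>j\<in>UNIV. \<Sum>k\<in>UNIV. christoffel g i j k y * E y $ j * E y $ k) differentiable (at x)"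
      by (auto intro!: differentiable_sum s3)
    have "partial i (\<lambda>y. (\<Sum>k\<in>UNIV. E y $ k * partial k (\<lambda>y. E y $ i) y)
      + (\<Sum>j\<in>UNIV. \<Sum>k\<in>UNIV. christoffel g i j k y * E y $ j * E y $ k)) x = partial i (\<lambda>y. E y $ i) x"
      by (rule partial_cong[OF open_U x A2]) (auto intro: differentiable_add s1 s2)
    also have "partial i (\<lambda>y. (\<Sum>k\<in>UNIV. E y $ k * partial k (\<lambda>y. E y $ i) y)
      + (\<Sum>j\<in>UNIV. \<Sum>k\<in>UNIV. christoffel g i j k y * E y $ j * E y $ k)) x =
      (\<Sum>k\<in>UNIV. ?e k * ?h i k i + ?d i k * ?d k i)
        + (\<Sum>j\<in>UNIV. \<Sum>k\<in>UNIV. ?G i j k * ?e j * ?d i k + (?G i j k * ?d i j + ?dG i i j k * ?e j) * ?e k)"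
      by (simp add: partial_add[OF s1 s2] partial_sum dm1 dm2 dm3 s3 partial_mult dE[OF x] dpE dG)
    finally show ?thesis by (simp add: algebra_simps)
  qed
  have dv: "partial k div_E x = (\<Sum>i\<in>UNIV. ?h k i i + (\<Sum>l\<in>UNIV. ?dG k i i l * ?e l + ?G i i l * ?d k l))" for k
  proof -
    have s: "(\<lambda>y. \<Sum>l\<in>UNIV. christoffel g i i l y * E y $ l) differentiable (at x)" for i
      by (auto intro!: differentiable_sum dm2)
    have t: "(\<lambda>y. partial i (\<lambda>y. E y $ i) y + (\<Sum>l\<in>UNIV. christoffel g i i l y * E y $ l)) differentiable (at x)" for i
      by (intro differentiable_add s dpE)
    have "div_E = (\<lambda>y. \<Sum>i\<in>UNIV. partial i (\<lambda>y. E y $ i) y + (\<Sum>l\<in>UNIV. christoffel g i i l y * E y $ l))"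
      by (simp add: div_E_def[abs_def] trace_def covariant_derivative_def)
    then have "partial k div_E x = (\<Sum>i\<in>UNIV. partial k (\<lambda>y. partial i (\<lambda>y. E y $ i) y + (\<Sum>l\<in>UNIV. christoffel g i i l y * E y $ l)) x)"
      using partial_sum[OF t] by simp
    also have "\<dots> = (\<Sum>i\<in>UNIV. ?h k i i + (\<Sum>l\<in>UNIV. ?G i i l * ?d k l + ?dG k i i l * ?e l))"
      by (simp add: partial_add[OF dpE s] partial_sum dm2 partial_mult dE[OF x] dG)
    finally show ?thesis by (simp add: add.commute)
  qed
  have dE1: "fderiv div_E x (E x) =
      (\<Sum>k\<in>UNIV. ?e k * (\<Sum>i\<in>UNIV. ?h k i i + (\<Sum>l\<in>UNIV. ?dG k i i l * ?e l + ?G i i l * ?d k l)))"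
    unfolding frechet_derivative_eq_sum_partial[OF smooth_on_differentiable[OF smooth_div_E x]] dv ..
  have BB: "trace (covariant_derivative g E x ** covariant_derivative g E x) =
     (\<Sum>i\<in>UNIV. \<Sum>j\<in>UNIV. (?d j i + (\<Sum>k\<in>UNIV. ?G i j k * ?e k)) * (?d i j + (\<Sum>k\<in>UNIV. ?G j i k * ?e k)))"
    by (simp add: trace_def matrix_matrix_mult_def covariant_derivative_def)
  have RR: "E x \<bullet> (ricci g x *v E x) =
    (\<Sum>j\<in>UNIV. \<Sum>k\<in>UNIV. ?e j * (\<Sum>i\<in>UNIV. ?dG i i j k - ?dG j i i k
          + (\<Sum>m\<in>UNIV. ?G i i m * ?G m j k - ?G i j m * ?G m i k)) * ?e k)"
    unfolding inner_matrix_vector_mult_sum by (simp add: ricci_def riemann_def)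
  have tr: "div_E x = (\<Sum>i\<in>UNIV. ?d i i + (\<Sum>k\<in>UNIV. ?G i i k * ?e k))"
    by (simp add: div_E_def trace_def covariant_derivative_def)
  show ?thesis
    unfolding dE1 BB RR tr
    by (rule riccati_contraction[where e = ?e and d = ?d and h = ?h and G = ?G and dG = ?dG,
          OF partial_commute[OF open_U En x] christoffel_commute[OF x] A1 A2[OF x]])
qed

lemma energy_pullback_homogeneous:
  assumes V: "open V" and F: "smooth_on V F" and FU: "\<And>y. y \<in> V \<Longrightarrow> F y \<in> U"
    and EF: "\<And>y. y \<in> V \<Longrightarrow> fderiv F y y = E (F y)" and y: "y \<in> V"
  shows "((\<lambda>y. energy (F y)) has_derivative (\<lambda>w. fderiv energy (F y) (fderiv F y w))) (at y)"
    and "fderiv energy (F y) (fderiv F y y) = 2 * energy (F y)"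
  using has_derivative_compose[OF smooth_on_has_derivative[OF F y] smooth_on_has_derivative[OF smooth_energy FU[OF y]]]
    energy_homogeneous[OF FU[OF y]] EF[OF y] by simp_all

text \<open>
  Let \<open>F\<close> be a parametrization in which \<open>E\<close> becomes the identity field. The derivative of the 1-form
  \<open>w \<mapsto> g(E, dF w)\<close> along the ray through \<open>y\<close> is half the differential of the energy. This is the first
  variation formula: since \<open>dF y = E\<close>, the symmetry of the second derivative of \<open>F\<close> expresses the
  derivative of \<open>dF w\<close> along the ray by \<open>\<nabla>E\<close>.
\<close>

theorem gauss_pointwise:
  fixes w :: "real^'n"
  assumes V: "open V" and F: "smooth_on V F" and FU: "\<And>y. y \<in> V \<Longrightarrow> F y \<in> U"
    and EF: "\<And>y. y \<in> V \<Longrightarrow> fderiv F y y = E (F y)" and y: "y \<in> V"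
  defines "\<beta> \<equiv> \<lambda>y. E (F y) \<bullet> (g (F y) *v fderiv F y w)"
  shows "fderiv \<beta> y y = (1/2) * fderiv energy (F y) (fderiv F y w)"
proof -
  let ?x = "F y"
  define DF where "DF = fderiv F y"
  define Y where "Y = (\<lambda>y. fderiv F y w)"
  define DE where "DE = fderiv E ?x"
  define Dg where "Dg = fderiv g ?x"
  have \<beta>_Y: "\<beta> = (\<lambda>y. E (F y) \<bullet> (g (F y) *v Y y))" by (simp add: \<beta>_def Y_def)
  have dF: "(F has_derivative DF) (at y)"
    unfolding DF_def by (rule smooth_on_has_derivative[OF F y])
  have dEF: "((\<lambda>y. E (F y)) has_derivative (\<lambda>v. DE (DF v))) (at y)"
    unfolding DE_def by (rule has_derivative_compose[OF dF E_has_derivative[OF FU[OF y]]])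
  have dgF: "((\<lambda>y. g (F y)) has_derivative (\<lambda>v. Dg (DF v))) (at y)"
    unfolding Dg_def by (rule has_derivative_compose[OF dF g_has_derivative[OF FU[OF y]]])
  have dY: "(Y has_derivative fderiv Y y) (at y)"
    unfolding Y_def by (rule smooth_on_has_derivative[OF smooth_on_frechet_derivative[OF F] y])
  have DFy: "DF y = E ?x" unfolding DF_def by (rule EF[OF y])
  have DFsum: "fderiv F y' u = (\<Sum>i\<in>UNIV. (u $ i) *\<^sub>R fderiv F y' (axis i 1))"
    if "y' \<in> V" for y' u
    by (rule linear_axis_expansion[OF linear_frechet_derivative[OF smooth_on_differentiable[OF F that]]])
  have DYy: "fderiv Y y y = DE (Y y) - Y y"
  proof -
    have dA: "((\<lambda>y. fderiv F y u) has_derivative fderiv (\<lambda>y. fderiv F y u) y) (at y)" for u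
      by (rule smooth_on_has_derivative[OF smooth_on_frechet_derivative[OF F] y])
    have dsum: "((\<lambda>y'. \<Sum>i\<in>UNIV. (y' $ i) *\<^sub>R fderiv F y' (axis i 1)) has_derivative
      (\<lambda>v. \<Sum>i\<in>UNIV. (y $ i) *\<^sub>R fderiv (\<lambda>y. fderiv F y (axis i 1)) y v
          + (v $ i) *\<^sub>R fderiv F y (axis i 1))) (at y)"
      by (intro has_derivative_sum has_derivative_scaleR dA bounded_linear_imp_has_derivative bounded_linear_vec_nth)
    have eqE: "E (F y') = (\<Sum>i\<in>UNIV. (y' $ i) *\<^sub>R fderiv F y' (axis i 1))" if "y' \<in> V" for y'
      using DFsum[OF that, of y'] unfolding EF[OF that] .
    have d2: "((\<lambda>y. E (F y)) has_derivative
      (\<lambda>v. \<Sum>i\<in>UNIV. (y $ i) *\<^sub>R fderiv (\<lambda>y. fderiv F y (axis i 1)) y v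
          + (v $ i) *\<^sub>R fderiv F y (axis i 1))) (at y)"
      by (rule has_derivative_transform_within_open[OF dsum V y]) (simp only: eqE)
    have "(\<Sum>i\<in>UNIV. (y $ i) *\<^sub>R fderiv (\<lambda>y. fderiv F y (axis i 1)) y w)
       = (\<Sum>i\<in>UNIV. (y $ i) *\<^sub>R fderiv Y y (axis i 1))"
      unfolding Y_def using second_derivative_symmetric_vec[OF V F y] by simp
    also have "\<dots> = fderiv Y y y"
      by (rule linear_axis_expansion[OF has_derivative_linear[OF dY], symmetric])
    finally have e1: "(\<Sum>i\<in>UNIV. (y $ i) *\<^sub>R fderiv (\<lambda>y. fderiv F y (axis i 1)) y w)
      = fderiv Y y y" .
    have "DE (DF w) = (\<Sum>i\<in>UNIV. (y $ i) *\<^sub>R fderiv (\<lambda>y. fderiv F y (axis i 1)) y w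
          + (w $ i) *\<^sub>R fderiv F y (axis i 1))"
      using has_derivative_unique[OF dEF d2] by (rule fun_cong)
    also have "\<dots> = fderiv Y y y + DF w"
      unfolding sum.distrib e1 DF_def DFsum[OF y, of w] ..
    finally show ?thesis by (simp add: Y_def DF_def)
  qed
  have "(\<beta> has_derivative (\<lambda>v. E ?x \<bullet> (g ?x *v fderiv Y y v + Dg (DF v) *v Y y)
      + DE (DF v) \<bullet> (g ?x *v Y y))) (at y)"
    unfolding \<beta>_Y
    by (intro has_derivative_inner bounded_bilinear.FDERIV[OF bounded_bilinear_matrix_vector_mult] dEF dgF dY)
  from frechet_derivative_eqI[OF this, of y]
  have "fderiv \<beta> y y = E ?x \<bullet> (g ?x *v (DE (Y y) - Y y)) + E ?x \<bullet> (Dg (E ?x) *v Y y)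
      + DE (E ?x) \<bullet> (g ?x *v Y y)"
    by (simp add: DYy DFy inner_add_right)
  also have "\<dots> = E ?x \<bullet> (g ?x *v DE (Y y)) + (1/2) * (E ?x \<bullet> (Dg (Y y) *v E ?x))"
    using euler_lower[OF FU[OF y], of "Y y"]
    by (simp add: DE_def Dg_def matrix_vector_mult_diff_distrib inner_diff_right)
  also have "\<dots> = (1/2) * fderiv energy ?x (Y y)"
    unfolding frechet_derivative_energy[OF FU[OF y]] by (simp add: DE_def Dg_def)
  finally show ?thesis by (simp add: Y_def)
qed

end

section \<open>Changes of charts\<close>

locale riemannian_atlas =
  fixes A :: "('m::topological_space, 'n::finite) chart set" and G :: "('m, 'n) metric"
  assumes riemannian: "riemannian_manifold A G"
begin

lemma chart: "c \<in> A \<Longrightarrow> is_chart c"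
  using riemannian by (auto simp: riemannian_manifold_def smooth_atlas_def)

lemma chart_exists: "\<exists>c\<in>A. q \<in> chart_dom c"
  using riemannian by (auto simp: riemannian_manifold_def smooth_atlas_def)

lemma open_chart_dom: "c \<in> A \<Longrightarrow> open (chart_dom c)"
  using chart by (auto simp: is_chart_def)

lemma open_chart_img: "c \<in> A \<Longrightarrow> open (chart_img c)"
  using chart by (auto simp: is_chart_def)

lemma chart_homeo: "c \<in> A \<Longrightarrow> homeomorphism (chart_dom c) (chart_img c) (chart_map c) (chart_inv c)"
  using chart by (auto simp: is_chart_def)

lemma chart_map_in: "q \<in> chart_dom c \<Longrightarrow> chart_map c q \<in> chart_img c"
  by (auto simp: chart_img_def)

lemma chart_inv_map: "c \<in> A \<Longrightarrow> q \<in> chart_dom c \<Longrightarrow> chart_inv c (chart_map c q) = q"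
  using chart_homeo by (auto simp: homeomorphism_def)

lemma chart_inv_in: "c \<in> A \<Longrightarrow> x \<in> chart_img c \<Longrightarrow> chart_inv c x \<in> chart_dom c"
  by (auto simp: chart_img_def chart_inv_map)

lemma chart_map_inv: "c \<in> A \<Longrightarrow> x \<in> chart_img c \<Longrightarrow> chart_map c (chart_inv c x) = x"
  by (auto simp: chart_img_def chart_inv_map)

lemma chart_local_metric: "c \<in> A \<Longrightarrow> local_metric (chart_img c) (G c)"
  using riemannian open_chart_img
  by (auto simp: local_metric_def riemannian_manifold_def riemannian_metric_def)

lemma overlap_in: "q \<in> chart_dom c \<Longrightarrow> q \<in> chart_dom d \<Longrightarrow> chart_map c q \<in> overlap c d"
  by (auto simp: overlap_def)

lemma transition_smooth: "c \<in> A \<Longrightarrow> d \<in> A \<Longrightarrow> smooth_on (overlap c d) (transition c d)"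
  using riemannian by (auto simp: riemannian_manifold_def smooth_atlas_def)

lemma transition_map: "c \<in> A \<Longrightarrow> q \<in> chart_dom c \<Longrightarrow> transition c d (chart_map c q) = chart_map d q"
  by (simp add: transition_def chart_inv_map)

lemma transition_has_derivative:
  assumes "c \<in> A" "d \<in> A" "x \<in> overlap c d"
  shows "(transition c d has_derivative (\<lambda>v. jacobian c d x *v v)) (at x)"
proof -
  have d: "(transition c d has_derivative fderiv (transition c d) x) (at x)"
    using smooth_on_has_derivative[OF transition_smooth[OF assms(1,2)] assms(3)] .
  moreover have "fderiv (transition c d) x = (\<lambda>v. jacobian c d x *v v)"
    unfolding jacobian_def using matrix_vector_mul(2)[OF has_derivative_linear[OF d]] by simp
  ultimately show ?thesis by simp
qed

lemma metric_transform:
  assumes c: "c \<in> A" and d: "d \<in> A" and x: "x \<in> overlap c d"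
  shows "G c x = transpose (jacobian c d x) ** G d (transition c d x) ** jacobian c d x"
  using riemannian assms by (auto simp: riemannian_manifold_def riemannian_metric_def)

lemma metric_transform_inner:
  assumes c: "c \<in> A" and d: "d \<in> A" and x: "x \<in> overlap c d"
  shows "u \<bullet> (G c x *v w) = (jacobian c d x *v u) \<bullet> (G d (transition c d x) *v (jacobian c d x *v w))"
  unfolding metric_transform[OF assms]
  by (simp only: matrix_vector_mul_assoc[symmetric] inner_transpose_matrix)

end

section \<open>Polar parametrizations and the Gauss lemma\<close>

text \<open>
  A parametrization \<open>h\<close> of the manifold by \<open>real^'n\<close>, later the exponential map at the pole, is read
  in a chart \<open>c\<close> as \<open>polar_map h c\<close>, with inverse \<open>polar_coord h c\<close>; \<open>polar_field h c\<close> is the push-forward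
  of the Euler field \<open>y \<mapsto> y\<close>.
\<close>

definition polar_map :: "(real^'n \<Rightarrow> 'm) \<Rightarrow> ('m, 'n::finite) chart \<Rightarrow> real^'n \<Rightarrow> real^'n" where
  "polar_map h c = chart_map c \<circ> h"

definition polar_coord :: "(real^'n \<Rightarrow> 'm) \<Rightarrow> ('m, 'n::finite) chart \<Rightarrow> real^'n \<Rightarrow> real^'n" where
  "polar_coord h c = inv h \<circ> chart_inv c"

definition polar_field :: "(real^'n \<Rightarrow> 'm) \<Rightarrow> ('m, 'n::finite) chart \<Rightarrow> real^'n \<Rightarrow> real^'n" where
  "polar_field h c x = fderiv (polar_map h c) (polar_coord h c x) (polar_coord h c x)"

locale parametrized = riemannian_atlas A G for A :: "('m::topological_space, 'n::finite) chart set" and G +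
  fixes h :: "real^'n \<Rightarrow> 'm"
  assumes bij_h: "bij h"
    and smooth_h: "smooth_to_manifold A h"
    and smooth_inv_h: "smooth_from_manifold A (inv h)"
begin

lemma inv_h [simp]: "inv h (h y) = y"
  using bij_h by (simp add: bij_def)

lemma h_inv [simp]: "h (inv h q) = q"
  using bij_h by (simp add: bij_def surj_f_inv_f)

lemma open_dom: "c \<in> A \<Longrightarrow> open (h -` chart_dom c)"
  using smooth_h open_chart_dom[of c]
  by (auto simp: smooth_to_manifold_def intro!: open_vimage)

lemma smooth_polar_map: "c \<in> A \<Longrightarrow> smooth_on (h -` chart_dom c) (polar_map h c)"
  using smooth_h by (auto simp: smooth_to_manifold_def polar_map_def)

lemma polar_map_in: "y \<in> h -` chart_dom c \<Longrightarrow> polar_map h c y \<in> chart_img c"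
  by (simp add: polar_map_def chart_map_in)

lemma smooth_polar_coord: "c \<in> A \<Longrightarrow> smooth_on (chart_img c) (polar_coord h c)"
  using smooth_inv_h by (auto simp: smooth_from_manifold_def polar_coord_def)

lemma polar_coord_in: "c \<in> A \<Longrightarrow> x \<in> chart_img c \<Longrightarrow> polar_coord h c x \<in> h -` chart_dom c"
  by (simp add: polar_coord_def chart_inv_in)

lemma polar_map_coord: "c \<in> A \<Longrightarrow> x \<in> chart_img c \<Longrightarrow> polar_map h c (polar_coord h c x) = x"
  by (simp add: polar_coord_def polar_map_def chart_map_inv)

lemma polar_coord_map: "c \<in> A \<Longrightarrow> y \<in> h -` chart_dom c \<Longrightarrow> polar_coord h c (polar_map h c y) = y"
  by (simp add: polar_coord_def polar_map_def chart_inv_map)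

lemma smooth_polar_field:
  assumes c: "c \<in> A" shows "smooth_on (chart_img c) (polar_field h c)"
proof -
  have f: "smooth_on (h -` chart_dom c) (\<lambda>y. fderiv (polar_map h c) y y)"
    by (rule smooth_on_frechet_derivative_apply[OF open_dom[OF c] smooth_polar_map[OF c]
          smooth_on_linear[OF bounded_linear_ident open_dom[OF c]]])
  show ?thesis
    unfolding polar_field_def[abs_def]
    by (rule smooth_on_compose[OF open_chart_img[OF c] open_dom[OF c] polar_coord_in[OF c] smooth_polar_coord[OF c] f])
qed

lemma polar_map_transition:
  assumes c: "c \<in> A" and d: "d \<in> A" and y: "h y \<in> chart_dom c" "h y \<in> chart_dom d"
  shows "fderiv (polar_map h d) y w =
    jacobian c d (polar_map h c y) *v fderiv (polar_map h c) y w"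
proof -
  have ov: "polar_map h c y \<in> overlap c d" using y by (simp add: polar_map_def overlap_in)
  have "(polar_map h c has_derivative fderiv (polar_map h c) y) (at y)"
    using smooth_on_has_derivative[OF smooth_polar_map[OF c]] y by simp
  from has_derivative_compose[OF this transition_has_derivative[OF c d ov]]
  have "((\<lambda>y. transition c d (polar_map h c y)) has_derivative
     (\<lambda>w. jacobian c d (polar_map h c y) *v fderiv (polar_map h c) y w)) (at y)" .
  then have "(polar_map h d has_derivative
     (\<lambda>w. jacobian c d (polar_map h c y) *v fderiv (polar_map h c) y w)) (at y)"
    by (rule has_derivative_transform_within_open[OF _ open_dom[OF c]])
      (use y in \<open>auto simp: polar_map_def transition_map[OF c]\<close>)
  from frechet_derivative_eqI[OF this] show ?thesis .
qed

definition pullback_in :: "('m, 'n) chart \<Rightarrow> real^'n \<Rightarrow> real^'n \<Rightarrow> real^'n \<Rightarrow> real" where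
  "pullback_in c y u w = fderiv (polar_map h c) y u \<bullet>
     (G c (polar_map h c y) *v fderiv (polar_map h c) y w)"

text \<open>
  The metric pulled back by \<open>h\<close>. The value does not depend on the chart, see \<open>pullback_eq\<close>.
\<close>

definition pullback :: "real^'n \<Rightarrow> real^'n \<Rightarrow> real^'n \<Rightarrow> real" where
  "pullback y = pullback_in (SOME c. c \<in> A \<and> h y \<in> chart_dom c) y"

lemma pullback_eq:
  assumes c: "c \<in> A" "h y \<in> chart_dom c"
  shows "pullback y u w = pullback_in c y u w"
proof -
  define d where "d = (SOME c. c \<in> A \<and> h y \<in> chart_dom c)"
  have d: "d \<in> A" "h y \<in> chart_dom d"
    using someI_ex[of "\<lambda>c. c \<in> A \<and> h y \<in> chart_dom c"] c unfolding d_def by blast+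
  have ov: "polar_map h c y \<in> overlap c d" using c(2) d(2) by (simp add: polar_map_def overlap_in)
  have tr: "transition c d (polar_map h c y) = polar_map h d y"
    using transition_map[OF c] by (simp add: polar_map_def)
  show ?thesis
    unfolding pullback_def d_def[symmetric] pullback_in_def metric_transform_inner[OF c(1) d(1) ov] tr
      polar_map_transition[OF c(1) d(1) c(2) d(2)] ..
qed

lemma smooth_pullback_in:
  assumes c: "c \<in> A" shows "smooth_on (h -` chart_dom c) (\<lambda>y. pullback_in c y u w)"
proof -
  interpret local_metric "chart_img c" "G c" by (rule chart_local_metric[OF c])
  have "smooth_on (h -` chart_dom c) (\<lambda>y. G c (polar_map h c y))"
    by (rule smooth_on_compose[OF open_dom[OF c] open_chart_img[OF c] polar_map_in smooth_polar_map[OF c] smooth_g])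
  then show ?thesis unfolding pullback_in_def
    by (intro smooth_on_inner smooth_on_matrix_vector_mult open_dom[OF c] smooth_on_frechet_derivative smooth_polar_map c)
qed

lemma isCont_pullback: "isCont (\<lambda>y. pullback y u w) y"
proof -
  obtain c where c: "c \<in> A" "h y \<in> chart_dom c" using chart_exists by blast
  have "continuous_on (h -` chart_dom c) (\<lambda>y. pullback_in c y u w)"
    by (rule smooth_on_imp_continuous_on[OF smooth_pullback_in[OF c(1)]])
  then have "continuous_on (h -` chart_dom c) (\<lambda>y. pullback y u w)"
    by (rule continuous_on_eq) (simp add: pullback_eq[OF c(1)])
  then show ?thesis
    using continuous_on_eq_continuous_at[OF open_dom[OF c(1)], of "\<lambda>y. pullback y u w"] c(2) by blast
qed

lemma pullback_linear:
  shows "linear (pullback y u)" "linear (\<lambda>u. pullback y u w)" "pullback y u w = pullback y w u"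
proof -
  obtain c where c: "c \<in> A" "h y \<in> chart_dom c" using chart_exists by blast
  interpret local_metric "chart_img c" "G c" by (rule chart_local_metric[OF c(1)])
  have l: "linear (fderiv (polar_map h c) y)"
    using linear_frechet_derivative[OF smooth_on_differentiable[OF smooth_polar_map[OF c(1)]]] c(2) by simp
  have e: "pullback y = pullback_in c y" by (simp add: pullback_eq[OF c] fun_eq_iff)
  show "linear (pullback y u)" unfolding e pullback_in_def
    by (rule linearI) (simp_all add: linear_add[OF l] linear_scale[OF l] matrix_vector_right_distrib inner_add_right
        matrix_vector_mult_scaleR)
  show "linear (\<lambda>u. pullback y u w)" unfolding e pullback_in_def
    by (rule linearI) (simp_all add: linear_add[OF l] linear_scale[OF l] inner_add_left)
  show "pullback y u w = pullback y w u" unfolding e pullback_in_def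
    by (rule inner_symmetric_matrix[OF sym_g]) (use c(2) in \<open>simp add: polar_map_in\<close>)
qed

text \<open>
  If \<open>h\<close> is the exponential map at the pole, this is half the squared distance from the pole.
\<close>

definition potential :: "'m \<Rightarrow> real" where
  "potential q = (1/2) * pullback 0 (inv h q) (inv h q)"

end

text \<open>
  The additional assumption says that the lines through the origin are mapped to geodesics.
\<close>

locale polar = parametrized A G h for A :: "('m::topological_space, 'n::finite) chart set" and G h +
  assumes polar_euler: "c \<in> A \<Longrightarrow> x \<in> chart_img c \<Longrightarrow>
    fderiv (polar_field h c) x (polar_field h c x)
      + christoffel_vec (G c) x (polar_field h c x) (polar_field h c x) = polar_field h c x"
begin

lemma euler_field: "c \<in> A \<Longrightarrow> euler_field (chart_img c) (G c) (polar_field h c)"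
  by (simp add: euler_field_def euler_field_axioms_def chart_local_metric smooth_polar_field polar_euler)

lemma polar_field_map:
  assumes "c \<in> A" "y \<in> h -` chart_dom c"
  shows "fderiv (polar_map h c) y y = polar_field h c (polar_map h c y)"
  by (simp add: polar_field_def polar_coord_map[OF assms])

lemma pullback_self:
  assumes c: "c \<in> A" and y: "y \<in> h -` chart_dom c"
  shows "pullback y y y = euler_field.energy (G c) (polar_field h c) (polar_map h c y)"
proof -
  interpret euler_field "chart_img c" "G c" "polar_field h c" by (rule euler_field[OF c])
  show ?thesis
    using y by (simp add: pullback_eq[OF c] pullback_in_def energy_def polar_field_map[OF c y])
qed

text \<open>
  The two facts on the pulled back metric that do not mention charts any more: the squared length of
  \<open>y\<close> at the point \<open>y\<close> is homogeneous of degree 2 (constant speed of geodesics), and the derivative of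
  its product with a fixed vector along the ray is given by the first variation formula.
\<close>

lemma pullback_self_has_derivative:
  "\<exists>D. ((\<lambda>y. pullback y y y) has_derivative D) (at y) \<and> D y = 2 * pullback y y y \<and>
     (\<forall>w. \<exists>B. ((\<lambda>y. pullback y y w) has_derivative B) (at y) \<and> B y = (1/2) * D w)"
proof -
  obtain c where c: "c \<in> A" "h y \<in> chart_dom c" using chart_exists by blast
  then have y: "y \<in> h -` chart_dom c" by simp
  interpret euler_field "chart_img c" "G c" "polar_field h c" by (rule euler_field[OF c(1)])
  note pc = open_dom[OF c(1)] smooth_polar_map[OF c(1)] polar_map_in polar_field_map[OF c(1)] y
  define D where "D = (\<lambda>w. fderiv energy (polar_map h c y) (fderiv (polar_map h c) y w))"
  have d1: "((\<lambda>y. energy (polar_map h c y)) has_derivative D) (at y)"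
    unfolding D_def by (rule energy_pullback_homogeneous(1)[OF pc])
  have D: "((\<lambda>y. pullback y y y) has_derivative D) (at y)"
    by (rule has_derivative_transform_within_open[OF d1 open_dom[OF c(1)] y]) (simp add: pullback_self[OF c(1)])
  moreover have "D y = 2 * pullback y y y"
    unfolding D_def pullback_self[OF c(1) y] by (rule energy_pullback_homogeneous(2)[OF pc])
  moreover have "\<exists>B. ((\<lambda>y. pullback y y w) has_derivative B) (at y) \<and> B y = (1/2) * D w" for w
  proof -
    let ?b = "\<lambda>y. polar_field h c (polar_map h c y) \<bullet> (G c (polar_map h c y) *v fderiv (polar_map h c) y w)"
    have e: "?b y = pullback y y w" if "y \<in> h -` chart_dom c" for y
      using that by (simp add: pullback_eq[OF c(1)] pullback_in_def polar_field_map[OF c(1)])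
    have "smooth_on (h -` chart_dom c) ?b"
      by (intro smooth_on_inner smooth_on_matrix_vector_mult open_dom[OF c(1)] smooth_on_frechet_derivative smooth_polar_map c(1)
         smooth_on_compose[OF open_dom[OF c(1)] open_chart_img[OF c(1)] polar_map_in smooth_polar_map[OF c(1)] smooth_g]
         smooth_on_compose[OF open_dom[OF c(1)] open_chart_img[OF c(1)] polar_map_in smooth_polar_map[OF c(1)] smooth_E])
    then have "(?b has_derivative fderiv ?b y) (at y)"
      using smooth_on_has_derivative y by blast
    then have "((\<lambda>y. pullback y y w) has_derivative fderiv ?b y) (at y)"
      by (rule has_derivative_transform_within_open[OF _ open_dom[OF c(1)] y]) (rule e)
    moreover have "fderiv ?b y y = (1/2) * D w"
      unfolding D_def by (rule gauss_pointwise[OF pc])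
    ultimately show ?thesis by blast
  qed
  ultimately show ?thesis by blast
qed

lemma ray_derivative:
  fixes f :: "real^'n \<Rightarrow> real"
  assumes "(f has_derivative D) (at (s *\<^sub>R y))"
  shows "((\<lambda>s. f (s *\<^sub>R y)) has_real_derivative D y) (at s)"
proof -
  have "((\<lambda>s. s *\<^sub>R y) has_derivative (\<lambda>t. t *\<^sub>R y)) (at s)" by (auto intro!: derivative_eq_intros)
  from has_derivative_compose[OF this assms]
  show ?thesis
    unfolding has_field_derivative_def
    by (rule has_derivative_eq_rhs) (simp add: fun_eq_iff linear_scale[OF has_derivative_linear[OF assms]] mult.commute)
qed

text \<open>
  By homogeneity \<open>s \<mapsto> pullback (s y) y y\<close> has derivative 0 for \<open>s > 0\<close>, and it is continuous at 0.
\<close>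

lemma speed_constant: "pullback y y y = pullback 0 y y"
proof -
  let ?k = "\<lambda>s. pullback (s *\<^sub>R y) y y"
  have scale: "pullback (s *\<^sub>R y) (s *\<^sub>R y) (s *\<^sub>R y) = s * s * ?k s" for s
    using linear_scale[OF pullback_linear(1)] linear_scale[OF pullback_linear(2)] by simp
  have der: "DERIV ?k s :> 0" if s: "0 < s" "s < 1" for s
  proof -
    obtain D where D: "((\<lambda>y. pullback y y y) has_derivative D) (at (s *\<^sub>R y))"
      "D (s *\<^sub>R y) = 2 * pullback (s *\<^sub>R y) (s *\<^sub>R y) (s *\<^sub>R y)"
      using pullback_self_has_derivative by blast
    have "s * D y = 2 * (s * s * ?k s)"
      using D(2) linear_scale[OF has_derivative_linear[OF D(1)]] scale by simp
    then have Dy: "D y = 2 * s * ?k s" using s by simp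
    have "((\<lambda>s. pullback (s *\<^sub>R y) (s *\<^sub>R y) (s *\<^sub>R y)) has_real_derivative D y) (at s)"
      using ray_derivative[OF D(1)] .
    then have "((\<lambda>s. s * s * ?k s) has_real_derivative D y) (at s)" by (simp only: scale)
    then have q: "((\<lambda>s. (s * s * ?k s) / (s * s)) has_real_derivative
        (D y * (s * s) - (s * s * ?k s) * (1 * s + s * 1)) / ((s * s) * (s * s))) (at s)"
      using s by (intro DERIV_divide derivative_intros) (auto intro!: derivative_eq_intros)
    have z: "(D y * (s * s) - (s * s * ?k s) * (1 * s + s * 1)) / ((s * s) * (s * s)) = 0"
      unfolding Dy by (simp add: algebra_simps)
    have "((\<lambda>s. (s * s * ?k s) / (s * s)) has_real_derivative 0) (at s)" using q unfolding z .
    then show ?thesis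
      by (rule has_field_derivative_transform_within_open[where S="{0<..}"]) (use s in auto)
  qed
  have "continuous_on {0..1} ?k"
  proof (rule continuous_at_imp_continuous_on, rule ballI)
    fix s :: real
    have "isCont (\<lambda>s. s *\<^sub>R y) s" by (intro continuous_intros)
    then show "isCont ?k s" by (rule isCont_o2[where g="\<lambda>z. pullback z y y"]) (rule isCont_pullback)
  qed
  then have "?k 1 = ?k 0" using DERIV_isconst_end[of 0 1 ?k] der by auto
  then show ?thesis by simp
qed

lemma pullback0_self_derivative:
  "((\<lambda>y. pullback y y y) has_derivative (\<lambda>w. 2 * pullback 0 y w)) (at y)"
proof -
  have e: "(\<lambda>y. pullback y y y) = (\<lambda>y. pullback 0 y y)" using speed_constant by blast
  have "bilinear (pullback 0)"
    unfolding bilinear_def using pullback_linear by blast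
  then have b: "bounded_bilinear (pullback 0)" by (simp add: bilinear_conv_bounded_bilinear)
  have "((\<lambda>y. pullback 0 y y) has_derivative (\<lambda>w. pullback 0 y w + pullback 0 w y)) (at y)"
    by (rule bounded_bilinear.FDERIV[OF b]) (rule has_derivative_ident)+
  then show ?thesis unfolding e by (rule has_derivative_eq_rhs) (simp add: fun_eq_iff pullback_linear(3)[of 0 y])
qed

text \<open>
  Constant speed makes the energy the quadratic form \<open>pullback 0 y y\<close>, so the first variation formula
  says that \<open>pullback (s y) (s y) w - s pullback 0 y w\<close> has derivative 0 in \<open>s\<close>; it vanishes at \<open>s = 0\<close>.
\<close>

theorem gauss_lemma: "pullback y y w = pullback 0 y w"
proof -
  have B: "\<exists>B. ((\<lambda>y. pullback y y w) has_derivative B) (at y) \<and> B y = pullback 0 y w" for y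
  proof -
    obtain D where D: "((\<lambda>y. pullback y y y) has_derivative D) (at y)"
      "\<And>w. \<exists>B. ((\<lambda>y. pullback y y w) has_derivative B) (at y) \<and> B y = (1/2) * D w"
      using pullback_self_has_derivative by blast
    have "D = (\<lambda>w. 2 * pullback 0 y w)" using has_derivative_unique[OF D(1) pullback0_self_derivative] .
    then show ?thesis using D(2)[of w] by simp
  qed
  let ?k = "\<lambda>s. pullback (s *\<^sub>R y) (s *\<^sub>R y) w - s * pullback 0 y w"
  have b: "\<exists>d. ((\<lambda>s. pullback (s *\<^sub>R y) (s *\<^sub>R y) w) has_real_derivative d) (at s) \<and> (s \<noteq> 0 \<longrightarrow> d = pullback 0 y w)" for s
  proof -
    obtain B where B: "((\<lambda>y. pullback y y w) has_derivative B) (at (s *\<^sub>R y))" "B (s *\<^sub>R y) = pullback 0 (s *\<^sub>R y) w"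
      using B by blast
    have "s * B y = s * pullback 0 y w"
      using B(2) linear_scale[OF has_derivative_linear[OF B(1)]] linear_scale[OF pullback_linear(2)] by simp
    then show ?thesis using ray_derivative[OF B(1)] by auto
  qed
  have der: "DERIV ?k s :> 0" if s: "0 < s" "s < 1" for s
  proof -
    have "((\<lambda>s. pullback (s *\<^sub>R y) (s *\<^sub>R y) w) has_real_derivative pullback 0 y w) (at s)" using b[of s] s by auto
    then have "DERIV ?k s :> pullback 0 y w - 1 * pullback 0 y w"
      by (intro DERIV_diff DERIV_cmult_right DERIV_ident)
    then show ?thesis by simp
  qed
  have "continuous_on {0..1} ?k"
  proof (rule continuous_at_imp_continuous_on, rule ballI)
    fix s :: real
    obtain d where "DERIV (\<lambda>s. pullback (s *\<^sub>R y) (s *\<^sub>R y) w) s :> d" using b[of s] by blast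
    then show "isCont ?k s" by (intro continuous_intros) (rule DERIV_isCont)
  qed
  then have "?k 1 = ?k 0" using DERIV_isconst_end[of 0 1 ?k] der by auto
  moreover have "?k 0 = 0" using linear_0[OF pullback_linear(2)] by simp
  ultimately show ?thesis by simp
qed

lemma potential_energy:
  assumes c: "c \<in> A" and x: "x \<in> chart_img c"
  shows "(potential \<circ> chart_inv c) x = (1/2) * euler_field.energy (G c) (polar_field h c) x"
proof -
  have "euler_field.energy (G c) (polar_field h c) x = pullback (polar_coord h c x) (polar_coord h c x) (polar_coord h c x)"
    using pullback_self[OF c polar_coord_in[OF c x]] polar_map_coord[OF c x] by simp
  then show ?thesis unfolding speed_constant by (simp add: potential_def polar_coord_def)
qed

lemma smooth_potential: "c \<in> A \<Longrightarrow> smooth_on (chart_img c) (potential \<circ> chart_inv c)"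
proof -
  assume c: "c \<in> A"
  interpret euler_field "chart_img c" "G c" "polar_field h c" by (rule euler_field[OF c])
  show ?thesis
    by (rule smooth_on_cong[OF open_U _ smooth_on_mult[OF open_U smooth_on_const smooth_energy]])
      (rule potential_energy[OF c, symmetric])
qed

text \<open>
  The Gauss lemma, read in a chart: \<open>g(E, v)\<close> is the derivative of the potential in direction \<open>v\<close>.
\<close>

theorem gradient_potential:
  assumes c: "c \<in> A" and x: "x \<in> chart_img c"
  shows "(G c x *v polar_field h c x) $ i = partial i (potential \<circ> chart_inv c) x"
proof -
  interpret euler_field "chart_img c" "G c" "polar_field h c" by (rule euler_field[OF c])
  define y where "y = polar_coord h c x"
  have y: "y \<in> h -` chart_dom c" unfolding y_def by (rule polar_coord_in[OF c x])
  have Fy: "polar_map h c y = x" unfolding y_def by (rule polar_map_coord[OF c x])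
  \<comment> \<open>the \<open>i\<close>-th coordinate vector is the image of some \<open>w\<close> under the derivative of the polar map\<close>
  define v :: "real^'n" where "v = axis i 1"
  define w where "w = fderiv (polar_coord h c) x v"
  have "((\<lambda>x. polar_map h c (polar_coord h c x)) has_derivative
      (\<lambda>v. fderiv (polar_map h c) (polar_coord h c x) (fderiv (polar_coord h c) x v))) (at x)"
    by (rule has_derivative_compose[OF smooth_on_has_derivative[OF smooth_polar_coord[OF c] x]
          smooth_on_has_derivative[OF smooth_polar_map[OF c] polar_coord_in[OF c x]]])
  then have "((\<lambda>x. x) has_derivative
      (\<lambda>v. fderiv (polar_map h c) (polar_coord h c x) (fderiv (polar_coord h c) x v))) (at x)"
    by (rule has_derivative_transform_within_open[OF _ open_U x]) (rule polar_map_coord[OF c])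
  from fun_cong[OF has_derivative_unique[OF this has_derivative_ident], of v]
  have Fw: "fderiv (polar_map h c) y w = v" by (simp add: w_def y_def)
  have "((\<lambda>y. energy (polar_map h c y)) has_derivative
      (\<lambda>w. fderiv energy (polar_map h c y) (fderiv (polar_map h c) y w))) (at y)"
    by (rule energy_pullback_homogeneous(1)[OF open_dom[OF c] smooth_polar_map[OF c] polar_map_in polar_field_map[OF c] y])
  then have "((\<lambda>y. pullback y y y) has_derivative
      (\<lambda>w. fderiv energy (polar_map h c y) (fderiv (polar_map h c) y w))) (at y)"
    by (rule has_derivative_transform_within_open[OF _ open_dom[OF c] y]) (simp add: pullback_self[OF c])
  from fun_cong[OF has_derivative_unique[OF this pullback0_self_derivative], of w]
  have "fderiv energy x v = 2 * pullback 0 y w" by (simp add: Fw Fy)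
  also have "\<dots> = 2 * pullback_in c y y w"
    using gauss_lemma[of y w] pullback_eq[OF c, of y y w] y by simp
  also have "pullback_in c y y w = polar_field h c x \<bullet> (G c x *v v)"
    unfolding pullback_in_def Fw polar_field_map[OF c y] Fy ..
  also have "\<dots> = v \<bullet> (G c x *v polar_field h c x)"
    by (rule inner_symmetric_matrix[OF sym_g[OF x]])
  finally have e: "fderiv energy x v = 2 * (G c x *v polar_field h c x) $ i"
    by (simp add: v_def inner_axis')
  have "((\<lambda>x. (1/2) * energy x) has_derivative (\<lambda>v. (1/2) * fderiv energy x v)) (at x)"
    by (rule has_derivative_mult_right[OF smooth_on_has_derivative[OF smooth_energy x]])
  then have "((potential \<circ> chart_inv c) has_derivative (\<lambda>v. (1/2) * fderiv energy x v)) (at x)"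
    by (rule has_derivative_transform_within_open[OF _ open_U x]) (rule potential_energy[OF c, symmetric])
  from frechet_derivative_eqI[OF this, of v] show ?thesis
    unfolding partial_def v_def[symmetric] e by simp
qed

theorem metric_covariant_derivative_polar_field:
  assumes c: "c \<in> A" and x: "x \<in> chart_img c"
  shows "G c x ** covariant_derivative (G c) (polar_field h c) x = hessian (G c) (potential \<circ> chart_inv c) x"
proof -
  interpret euler_field "chart_img c" "G c" "polar_field h c" by (rule euler_field[OF c])
  show ?thesis
    by (rule metric_covariant_derivative_gradient[OF smooth_E smooth_potential[OF c] gradient_potential[OF c] x])
qed

end

section \<open>Uniqueness for ordinary differential equations\<close>

lemma smooth_on_locally_lipschitz:
  fixes f :: "'a::euclidean_space \<Rightarrow> 'b::real_normed_vector"
  assumes S: "open S" and f: "smooth_on S f" and x: "x \<in> S"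
  shows "\<exists>r>0. \<exists>L\<ge>0. cball x r \<subseteq> S \<and> (\<forall>a\<in>cball x r. \<forall>b\<in>cball x r. norm (f a - f b) \<le> L * norm (a - b))"
proof -
  obtain r where r: "r > 0" "cball x r \<subseteq> S" using S x open_contains_cball by blast
  have "continuous_on (cball x r) (\<lambda>z. \<Sum>b\<in>Basis. norm (fderiv f z b))"
    by (intro continuous_intros continuous_on_subset[OF smooth_on_imp_continuous_on[OF smooth_on_frechet_derivative[OF f]] r(2)])
  then have "compact ((\<lambda>z. \<Sum>b\<in>Basis. norm (fderiv f z b)) ` cball x r)"
    by (rule compact_continuous_image) (rule compact_cball)
  then have "bounded ((\<lambda>z. \<Sum>b\<in>Basis. norm (fderiv f z b)) ` cball x r)"
    by (rule compact_imp_bounded)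
  then obtain L where
    "\<forall>y\<in>(\<lambda>z. \<Sum>b\<in>Basis. norm (fderiv f z b)) ` cball x r. norm y \<le> L"
    unfolding bounded_iff by (elim exE)
  then have L: "\<bar>\<Sum>b\<in>Basis. norm (fderiv f z b)\<bar> \<le> L" if "z \<in> cball x r" for z
    using that by (simp only: ball_simps real_norm_def)
  have on: "onorm (fderiv f z) \<le> L" if z: "z \<in> cball x r" for z
  proof (rule onorm_le)
    fix v :: 'a
    have l: "linear (fderiv f z)"
      using linear_frechet_derivative[OF smooth_on_differentiable[OF f]] z r(2) by blast
    have "fderiv f z v = fderiv f z (\<Sum>b\<in>Basis. (v \<bullet> b) *\<^sub>R b)"
      by (simp add: euclidean_representation)
    also have "\<dots> = (\<Sum>b\<in>Basis. (v \<bullet> b) *\<^sub>R fderiv f z b)"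
      by (simp add: linear_sum[OF l] linear_scale[OF l])
    finally have "norm (fderiv f z v) \<le> (\<Sum>b\<in>Basis. norm ((v \<bullet> b) *\<^sub>R fderiv f z b))"
      by (simp only: norm_sum)
    also have "\<dots> \<le> (\<Sum>b\<in>Basis. norm v * norm (fderiv f z b))"
      by (intro sum_mono) (simp add: mult_right_mono Basis_le_norm)
    also have "\<dots> = (\<Sum>b\<in>Basis. norm (fderiv f z b)) * norm v"
      by (simp add: sum_distrib_left[symmetric] mult.commute)
    also have "\<dots> \<le> L * norm v"
      using L[OF z] by (intro mult_right_mono) auto
    finally show "norm (fderiv f z v) \<le> L * norm v" .
  qed
  have "norm (f a - f b) \<le> L * norm (a - b)" if "a \<in> cball x r" "b \<in> cball x r" for a b
  proof (rule differentiable_bound[OF convex_cball _ on that])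
    fix z assume "z \<in> cball x r"
    then show "(f has_derivative fderiv f z) (at z within cball x r)"
      using smooth_on_has_derivative[OF f] r(2) has_derivative_at_withinI by blast
  qed
  moreover have "L \<ge> 0" using L[of x] r(1) by force
  ultimately show ?thesis using r by blast
qed

lemma at_within_atLeast_pos: "0 < t \<Longrightarrow> at t within {0::real..} = at t"
  by (rule at_within_open_subset[of t "{0<..}"]) auto

lemma at_within_atLeast_nontrivial:
  assumes "0 \<le> t" shows "at t within {0::real..} \<noteq> bot"
proof
  assume "at t within {0..} = bot"
  moreover have "at_right t \<le> at t within {0..}" by (rule at_le) (use assms in auto)
  ultimately show False using trivial_limit_at_right_real[of t] by (metis bot_unique)
qed

text \<open>
  Gronwall's argument: with a Lipschitz constant \<open>L\<close> of the vector field, the function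
  \<open>exp(- 2 L t) \<bar>z1 - z2\<bar>\<^sup>2\<close> is nonincreasing. Derivatives are taken within the half-line because
  geodesics on \<open>{0..}\<close> have only a one-sided derivative at 0.
\<close>

lemma ode_unique_forward:
  fixes f :: "'a::euclidean_space \<Rightarrow> 'a"
  assumes S: "open S" and f: "smooth_on S f" and T: "0 \<le> T" and d: "0 < d"
    and z1: "\<And>t. T \<le> t \<Longrightarrow> t < T + d \<Longrightarrow> z1 t \<in> S \<and> (z1 has_vector_derivative f (z1 t)) (at t within {0..})"
    and z2: "\<And>t. T \<le> t \<Longrightarrow> t < T + d \<Longrightarrow> z2 t \<in> S \<and> (z2 has_vector_derivative f (z2 t)) (at t within {0..})"
    and eq: "z1 T = z2 T"
  shows "\<exists>e>0. \<forall>t. T \<le> t \<longrightarrow> t \<le> T + e \<longrightarrow> z1 t = z2 t"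
proof -
  have "z1 T \<in> S" using z1[of T] d by simp
  then obtain r L where r: "r > 0" and L: "L \<ge> 0" "cball (z1 T) r \<subseteq> S"
    "\<And>a b. a \<in> cball (z1 T) r \<Longrightarrow> b \<in> cball (z1 T) r \<Longrightarrow> norm (f a - f b) \<le> L * norm (a - b)"
    using smooth_on_locally_lipschitz[OF S f] by blast
  have near: "\<exists>e>0. \<forall>t. T \<le> t \<and> t < T + e \<longrightarrow> z t \<in> cball (z1 T) r"
    if "(z has_vector_derivative D) (at T within {0..})" "z T = z1 T" for z D
  proof -
    have "continuous (at T within {0..}) z" using that(1) has_vector_derivative_continuous by blast
    then obtain e where e: "e > 0" "\<And>t. t \<in> {0..} \<Longrightarrow> dist t T < e \<Longrightarrow> dist (z t) (z T) < r"
      using r unfolding continuous_within_eps_delta by blast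
    show ?thesis
    proof (intro exI[of _ e] conjI allI impI)
      fix t assume "T \<le> t \<and> t < T + e"
      then show "z t \<in> cball (z1 T) r"
        using e(2)[of t] T that(2) by (simp add: dist_real_def dist_commute)
    qed (rule e(1))
  qed
  have dz1: "(z1 has_vector_derivative f (z1 T)) (at T within {0..})"
    and dz2: "(z2 has_vector_derivative f (z2 T)) (at T within {0..})"
    using z1[of T] z2[of T] d by simp_all
  obtain e1 where e1: "e1 > 0" "\<And>t. T \<le> t \<Longrightarrow> t < T + e1 \<Longrightarrow> z1 t \<in> cball (z1 T) r"
    using near[OF dz1 refl] by blast
  obtain e2 where e2: "e2 > 0" "\<And>t. T \<le> t \<Longrightarrow> t < T + e2 \<Longrightarrow> z2 t \<in> cball (z1 T) r"
    using near[OF dz2 eq[symmetric]] by blast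
  define e where "e = min d (min e1 e2) / 2"
  have e: "e > 0" "e < d" "e < e1" "e < e2" unfolding e_def using d e1(1) e2(1) by auto
  define w where "w = (\<lambda>t. z1 t - z2 t)"
  define \<phi> where "\<phi> = (\<lambda>t. exp (- (2 * L * t)) * (w t \<bullet> w t))"
  have wd: "(w has_vector_derivative (f (z1 t) - f (z2 t))) (at t within {0..})" if "T \<le> t" "t < T + d" for t
    unfolding w_def using z1[OF that] z2[OF that] by (intro has_vector_derivative_diff) auto
  have \<phi>d: "(\<phi> has_real_derivative (exp (- (2 * L * t)) * (2 * (w t \<bullet> (f (z1 t) - f (z2 t)))) + (exp (- (2 * L * t)) * (- (2 * L))) * (w t \<bullet> w t))) (at t within {0..})"
    if "T \<le> t" "t < T + d" for t
  proof -
    have "((\<lambda>t. w t \<bullet> w t) has_derivative (\<lambda>h. w t \<bullet> (h *\<^sub>R (f (z1 t) - f (z2 t))) + (h *\<^sub>R (f (z1 t) - f (z2 t))) \<bullet> w t)) (at t within {0..})"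
      using wd[OF that] unfolding has_vector_derivative_def by (intro has_derivative_inner)
    then have i: "((\<lambda>t. w t \<bullet> w t) has_real_derivative 2 * (w t \<bullet> (f (z1 t) - f (z2 t)))) (at t within {0..})"
      unfolding has_field_derivative_def
      by (rule has_derivative_eq_rhs) (simp add: fun_eq_iff inner_commute)
    have x: "((\<lambda>t. exp (- (2 * L * t))) has_real_derivative exp (- (2 * L * t)) * (- (2 * L))) (at t within {0..})"
      by (auto intro!: derivative_eq_intros)
    show ?thesis unfolding \<phi>_def by (rule DERIV_mult'[OF x i])
  qed
  have "z1 t = z2 t" if t: "T \<le> t" "t \<le> T + e" for t
  proof (cases "t = T")
    case False
    then have Tt: "T < t" using t by simp
    have "\<phi> t \<le> \<phi> T"
    proof (rule DERIV_nonpos_imp_decreasing_open[OF less_imp_le[OF Tt]])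
      fix s assume s: "T < s" "s < t"
      have sd: "T \<le> s" "s < T + d" "s < T + e1" "s < T + e2" using s t e by auto
      have at: "at s within {0..} = at s" using s T by (intro at_within_atLeast_pos) simp
      have "w s \<bullet> (f (z1 s) - f (z2 s)) \<le> norm (w s) * norm (f (z1 s) - f (z2 s))" by (rule norm_cauchy_schwarz)
      also have "\<dots> \<le> norm (w s) * (L * norm (w s))"
        using L(3)[OF e1(2)[OF sd(1,3)] e2(2)[OF sd(1,4)]] by (intro mult_left_mono) (simp_all add: w_def)
      also have "\<dots> = L * (w s \<bullet> w s)" by (simp add: dot_square_norm power2_eq_square)
      finally have b: "w s \<bullet> (f (z1 s) - f (z2 s)) \<le> L * (w s \<bullet> w s)" .
      have "exp (- (2 * L * s)) * (2 * (w s \<bullet> (f (z1 s) - f (z2 s)))) + (exp (- (2 * L * s)) * (- (2 * L))) * (w s \<bullet> w s)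
         = exp (- (2 * L * s)) * (2 * (w s \<bullet> (f (z1 s) - f (z2 s))) - 2 * (L * (w s \<bullet> w s)))"
        by (simp add: algebra_simps)
      also have "\<dots> \<le> 0" using b by (intro mult_nonneg_nonpos) auto
      finally show "\<exists>y. DERIV \<phi> s :> y \<and> y \<le> 0"
        using \<phi>d[OF sd(1,2)] unfolding at by blast
    next
      show "continuous_on {T..t} \<phi>"
      proof (rule continuous_on_eq_continuous_within[THEN iffD2], rule ballI)
        fix s assume s: "s \<in> {T..t}"
        then have "continuous (at s within {0..}) \<phi>"
          using \<phi>d[of s] t e by (intro DERIV_continuous) auto
        then show "continuous (at s within {T..t}) \<phi>"
          by (rule continuous_within_subset) (use T in auto)
      qed
    qed
    moreover have "\<phi> T = 0" by (simp add: \<phi>_def w_def eq)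
    ultimately have "w t \<bullet> w t \<le> 0" by (simp add: \<phi>_def mult_le_0_iff)
    then have "w t = 0" by (metis inner_eq_zero_iff inner_ge_zero order_antisym)
    then show ?thesis by (simp add: w_def)
  qed (simp add: eq)
  then show ?thesis using e(1) by blast
qed

section \<open>Functions along geodesics\<close>

context riemannian_atlas
begin

lemma geodesic_near:
  assumes \<gamma>: "geodesic_on A G I \<gamma>" and t: "t \<in> I" and c: "c \<in> A" "\<gamma> t \<in> chart_dom c"
  obtains e where "e > 0" "\<And>s. s \<in> I \<Longrightarrow> dist s t < e \<Longrightarrow> \<gamma> s \<in> chart_dom c"
proof -
  have "continuous_on I \<gamma>" using \<gamma> by (simp add: geodesic_on_def)
  then obtain W where W: "open W" "W \<inter> I = \<gamma> -` chart_dom c \<inter> I"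
    using open_chart_dom[OF c(1)] unfolding continuous_on_open_invariant by blast
  then have "t \<in> W" using t c by blast
  then obtain e where "e > 0" "\<And>s. dist s t < e \<Longrightarrow> s \<in> W"
    using W(1) unfolding open_dist by blast
  then show thesis using W(2) that[of e] by blast
qed

lemma geodesic_has_velocity:
  assumes "geodesic_on A G I \<gamma>" "t \<in> I" "c \<in> A" "\<gamma> t \<in> chart_dom c"
  shows "((\<lambda>s. chart_map c (\<gamma> s)) has_vector_derivative velocity c I \<gamma> t) (at t within I)"
  using assms vector_derivative_works[of "chart_map c \<circ> \<gamma>" "at t within I"]
  by (auto simp: geodesic_on_def velocity_def comp_def)

lemma geodesic_has_acceleration:
  assumes "geodesic_on A G I \<gamma>" "t \<in> I" "c \<in> A" "\<gamma> t \<in> chart_dom c"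
  shows "(velocity c I \<gamma> has_vector_derivative
     - christoffel_vec (G c) (chart_map c (\<gamma> t)) (velocity c I \<gamma> t) (velocity c I \<gamma> t)) (at t within I)"
proof -
  have "(velocity c I \<gamma> has_vector_derivative
           (\<chi> k. - (\<Sum>i\<in>UNIV. \<Sum>j\<in>UNIV. christoffel (G c) k i j (chart_map c (\<gamma> t)) *
                     velocity c I \<gamma> t $ i * velocity c I \<gamma> t $ j))) (at t within I)"
    using assms by (simp add: geodesic_on_def)
  moreover have "(\<chi> k. - (\<Sum>i\<in>UNIV. \<Sum>j\<in>UNIV. christoffel (G c) k i j (chart_map c (\<gamma> t)) *
                     velocity c I \<gamma> t $ i * velocity c I \<gamma> t $ j)) =
      - christoffel_vec (G c) (chart_map c (\<gamma> t)) (velocity c I \<gamma> t) (velocity c I \<gamma> t)"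
    by (simp add: vec_eq_iff christoffel_vec_def)
  ultimately show ?thesis by simp
qed

lemma velocity_transition:
  assumes \<gamma>: "geodesic_on A G I \<gamma>" and t: "t \<in> I" "at t within I \<noteq> bot"
    and c: "c \<in> A" "\<gamma> t \<in> chart_dom c" and d: "d \<in> A" "\<gamma> t \<in> chart_dom d"
  shows "velocity d I \<gamma> t = jacobian c d (chart_map c (\<gamma> t)) *v velocity c I \<gamma> t"
proof -
  let ?J = "jacobian c d (chart_map c (\<gamma> t))"
  obtain e where e: "e > 0" "\<And>s. s \<in> I \<Longrightarrow> dist s t < e \<Longrightarrow> \<gamma> s \<in> chart_dom c"
    using geodesic_near[OF \<gamma> t(1) c] by blast
  have "((\<lambda>s. transition c d (chart_map c (\<gamma> s))) has_derivative (\<lambda>h. ?J *v (h *\<^sub>R velocity c I \<gamma> t))) (at t within I)"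
    using has_derivative_compose[OF geodesic_has_velocity[OF \<gamma> t(1) c, unfolded has_vector_derivative_def]
        transition_has_derivative[OF c(1) d(1) overlap_in[OF c(2) d(2)]]] .
  then have "((\<lambda>s. transition c d (chart_map c (\<gamma> s))) has_vector_derivative ?J *v velocity c I \<gamma> t) (at t within I)"
    by (simp add: has_vector_derivative_def matrix_vector_mult_scaleR)
  then have "((\<lambda>s. chart_map d (\<gamma> s)) has_vector_derivative ?J *v velocity c I \<gamma> t) (at t within I)"
    by (rule has_vector_derivative_transform_within[OF _ e(1) t(1)]) (simp add: transition_map[OF c(1) e(2)])
  from vector_derivative_within[OF t(2) this] show ?thesis by (simp add: velocity_def comp_def)
qed

lemma derivative_along_geodesic:
  assumes \<gamma>: "geodesic_on A G I \<gamma>" and t: "t \<in> I"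
    and c: "c \<in> A" "\<gamma> t \<in> chart_dom c"
    and u: "smooth_on (chart_img c) (u \<circ> chart_inv c)"
  shows "((\<lambda>s. u (\<gamma> s)) has_vector_derivative
     fderiv (u \<circ> chart_inv c) (chart_map c (\<gamma> t)) (velocity c I \<gamma> t)) (at t within I)"
proof -
  obtain e where e: "e > 0" "\<And>s. s \<in> I \<Longrightarrow> dist s t < e \<Longrightarrow> \<gamma> s \<in> chart_dom c"
    using geodesic_near[OF \<gamma> t(1) c] by blast
  let ?D = "fderiv (u \<circ> chart_inv c) (chart_map c (\<gamma> t))"
  have D: "((u \<circ> chart_inv c) has_derivative ?D) (at (chart_map c (\<gamma> t)))"
    by (rule smooth_on_has_derivative[OF u chart_map_in[OF c(2)]])
  have "((\<lambda>s. (u \<circ> chart_inv c) (chart_map c (\<gamma> s))) has_derivative (\<lambda>h. ?D (h *\<^sub>R velocity c I \<gamma> t))) (at t within I)"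
    using has_derivative_compose[OF geodesic_has_velocity[OF \<gamma> t(1) c, unfolded has_vector_derivative_def] D] .
  then have "((\<lambda>s. (u \<circ> chart_inv c) (chart_map c (\<gamma> s))) has_vector_derivative ?D (velocity c I \<gamma> t)) (at t within I)"
    by (simp add: has_vector_derivative_def linear_scale[OF has_derivative_linear[OF D]])
  then show ?thesis
    by (rule has_vector_derivative_transform_within[OF _ e(1) t(1)]) (simp add: chart_inv_map[OF c(1) e(2)])
qed

text \<open>
  Along a geodesic the acceleration contributes exactly the Christoffel term of the Hessian. The
  left-hand side does not mention any chart.
\<close>

theorem second_derivative_along_geodesic:
  fixes u :: "'m \<Rightarrow> real"
  assumes \<gamma>: "geodesic_on A G I \<gamma>" and t: "t \<in> I" and I: "\<And>s. s \<in> I \<Longrightarrow> at s within I \<noteq> bot"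
    and c: "c \<in> A" "\<gamma> t \<in> chart_dom c"
    and u: "smooth_on (chart_img c) (u \<circ> chart_inv c)"
  defines "v \<equiv> velocity c I \<gamma> t" and "x \<equiv> chart_map c (\<gamma> t)"
  shows "((\<lambda>s. vector_derivative (\<lambda>s. u (\<gamma> s)) (at s within I)) has_real_derivative
     v \<bullet> (hessian (G c) (u \<circ> chart_inv c) x *v v)) (at t within I)"
proof -
  define U where "U = u \<circ> chart_inv c"
  have U: "smooth_on (chart_img c) U" using u by (simp add: U_def)
  have x: "x \<in> chart_img c" unfolding x_def by (rule chart_map_in[OF c(2)])
  obtain e where e: "e > 0" "\<And>s. s \<in> I \<Longrightarrow> dist s t < e \<Longrightarrow> \<gamma> s \<in> chart_dom c"
    using geodesic_near[OF \<gamma> t(1) c] by blast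
  have eq: "(\<Sum>i\<in>UNIV. velocity c I \<gamma> s $ i * partial i U (chart_map c (\<gamma> s))) = vector_derivative (\<lambda>s. u (\<gamma> s)) (at s within I)"
    if s: "s \<in> I" "dist s t < e" for s
    using vector_derivative_within[OF I[OF s(1)] derivative_along_geodesic[OF \<gamma> s(1) c(1) e(2)[OF s] u]]
      frechet_derivative_eq_sum_partial[OF smooth_on_differentiable[OF U chart_map_in[OF e(2)[OF s]]]]
    by (simp add: U_def)
  have vd: "((\<lambda>s. velocity c I \<gamma> s $ i) has_real_derivative - christoffel_vec (G c) x v v $ i) (at t within I)" for i
    using bounded_linear.has_vector_derivative[OF bounded_linear_vec_nth geodesic_has_acceleration[OF \<gamma> t c], of i]
    by (simp add: has_real_derivative_iff_has_vector_derivative v_def x_def)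
  have pd: "((\<lambda>s. partial i U (chart_map c (\<gamma> s))) has_real_derivative (\<Sum>j\<in>UNIV. v $ j * partial j (partial i U) x)) (at t within I)" for i
  proof -
    have sp: "smooth_on (chart_img c) (partial i U)" by (rule smooth_on_partial[OF U])
    have D: "(partial i U has_derivative fderiv (partial i U) x) (at x)"
      by (rule smooth_on_has_derivative[OF sp x])
    have "((\<lambda>s. partial i U (chart_map c (\<gamma> s))) has_derivative (\<lambda>h. fderiv (partial i U) x (h *\<^sub>R v))) (at t within I)"
      using has_derivative_compose[OF geodesic_has_velocity[OF \<gamma> t(1) c, unfolded has_vector_derivative_def] D[unfolded x_def]]
      by (simp add: v_def x_def)
    then show ?thesis
      unfolding has_field_derivative_def
      by (rule has_derivative_eq_rhs)
        (simp add: fun_eq_iff linear_scale[OF has_derivative_linear[OF D]] sum_distrib_left mult_ac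
          frechet_derivative_eq_sum_partial[OF smooth_on_differentiable[OF sp x]])
  qed
  have "((\<lambda>s. \<Sum>i\<in>UNIV. velocity c I \<gamma> s $ i * partial i U (chart_map c (\<gamma> s))) has_real_derivative
     (\<Sum>i\<in>UNIV. v $ i * (\<Sum>j\<in>UNIV. v $ j * partial j (partial i U) x) + - christoffel_vec (G c) x v v $ i * partial i U x)) (at t within I)"
    unfolding v_def x_def by (intro DERIV_sum DERIV_mult' vd[unfolded v_def x_def] pd[unfolded v_def x_def])
  then have "((\<lambda>s. vector_derivative (\<lambda>s. u (\<gamma> s)) (at s within I)) has_real_derivative
     (\<Sum>i\<in>UNIV. v $ i * (\<Sum>j\<in>UNIV. v $ j * partial j (partial i U) x) + - christoffel_vec (G c) x v v $ i * partial i U x)) (at t within I)"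
    by (rule has_field_derivative_transform_within[OF _ e(1) t]) (rule eq)
  moreover have "(\<Sum>i\<in>UNIV. v $ i * (\<Sum>j\<in>UNIV. v $ j * partial j (partial i U) x) + - christoffel_vec (G c) x v v $ i * partial i U x)
     = v \<bullet> (hessian (G c) U x *v v)"
  proof -
    have "v \<bullet> (hessian (G c) U x *v v) =
      (\<Sum>i\<in>UNIV. \<Sum>j\<in>UNIV. v $ i * partial i (partial j U) x * v $ j) -
      (\<Sum>i\<in>UNIV. \<Sum>j\<in>UNIV. \<Sum>k\<in>UNIV. v $ i * (christoffel (G c) k i j x * partial k U x) * v $ j)"
      unfolding inner_matrix_vector_mult_sum hessian_def
      by (simp add: left_diff_distrib right_diff_distrib sum_subtractf sum_distrib_left sum_distrib_right)
    also have "(\<Sum>i\<in>UNIV. \<Sum>j\<in>UNIV. v $ i * partial i (partial j U) x * v $ j) =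
       (\<Sum>i\<in>UNIV. v $ i * (\<Sum>j\<in>UNIV. v $ j * partial j (partial i U) x))"
      by (subst sum.swap) (simp add: sum_distrib_left mult.commute mult.left_commute)
    also have "(\<Sum>i\<in>UNIV. \<Sum>j\<in>UNIV. \<Sum>k\<in>UNIV. v $ i * (christoffel (G c) k i j x * partial k U x) * v $ j) =
       (\<Sum>i\<in>UNIV. \<Sum>k\<in>UNIV. \<Sum>j\<in>UNIV. v $ i * (christoffel (G c) k i j x * partial k U x) * v $ j)"
      by (rule sum.cong[OF refl], rule sum.swap)
    also have "\<dots> = (\<Sum>k\<in>UNIV. \<Sum>i\<in>UNIV. \<Sum>j\<in>UNIV. v $ i * (christoffel (G c) k i j x * partial k U x) * v $ j)"
      by (rule sum.swap)
    also have "\<dots> = (\<Sum>k\<in>UNIV. christoffel_vec (G c) x v v $ k * partial k U x)"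
      by (simp add: christoffel_vec_def sum_distrib_left sum_distrib_right mult_ac)
    finally show ?thesis by (simp add: sum.distrib sum_negf sum_subtractf)
  qed
  ultimately show ?thesis unfolding U_def[symmetric] by simp
qed

end

section \<open>Invariance of the Hessian and of its trace\<close>

lemma quadratic_form_eq_imp_eq:
  fixes M N :: "real^'n^'n"
  assumes M: "transpose M = M" and N: "transpose N = N" and q: "\<And>v. v \<bullet> (M *v v) = v \<bullet> (N *v v)"
  shows "M = N"
proof -
  have pol: "2 * (u \<bullet> (K *v w)) = (u + w) \<bullet> (K *v (u + w)) - u \<bullet> (K *v u) - w \<bullet> (K *v w)"
    if "transpose K = K" for K :: "real^'n^'n" and u w
    using inner_symmetric_matrix[OF that, of u w]
    by (simp add: matrix_vector_right_distrib inner_add_left inner_add_right)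
  have "u \<bullet> (M *v w) = u \<bullet> (N *v w)" for u w
    using pol[OF M, of u w] pol[OF N, of u w] by (simp add: q)
  then have "M *v w = N *v w" for w by (metis inner_commute vector_eq_rdot)
  then show ?thesis by (simp add: matrix_eq)
qed

text \<open>
  If two bilinear forms transform alike under a change of basis \<open>J\<close>, then the endomorphisms \<open>B1\<close> and
  \<open>B2\<close> that relate them are conjugate: \<open>J B1 = B2 J\<close>.
\<close>

lemma trace_transform:
  fixes G1 G2 S1 S2 B1 B2 J :: "real^'n^'n"
  assumes G: "G1 = transpose J ** G2 ** J" and S: "S1 = transpose J ** S2 ** J"
    and B1: "G1 ** B1 = S1" and B2: "G2 ** B2 = S2" and inv: "invertible G1"
  shows "trace B1 = trace B2"
proof -
  have "det G1 \<noteq> 0" using inv invertible_det_nz by blast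
  then have "det J \<noteq> 0" "det G2 \<noteq> 0" unfolding G by (auto simp: det_mul)
  then have "invertible J" and iG2: "invertible G2" and "invertible (transpose J)"
    by (simp_all add: invertible_det_nz)
  then obtain K T where K: "J ** K = mat 1" "K ** J = mat 1" and T: "T ** transpose J = mat 1"
    unfolding invertible_def by blast
  have cancelT: "X = Y" if "transpose J ** X = transpose J ** Y" for X Y :: "real^'n^'n"
  proof -
    have "T ** (transpose J ** X) = T ** (transpose J ** Y)" using that by simp
    then show ?thesis by (simp add: matrix_mul_assoc T)
  qed
  have cancelG: "X = Y" if "G2 ** X = G2 ** Y" for X Y :: "real^'n^'n"
  proof -
    have "matrix_inv G2 ** (G2 ** X) = matrix_inv G2 ** (G2 ** Y)" using that by simp
    then show ?thesis by (simp add: matrix_mul_assoc matrix_inv_left[OF iG2])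
  qed
  have "transpose J ** (G2 ** (J ** B1)) = transpose J ** (G2 ** (B2 ** J))"
    using B1 unfolding G S B2[symmetric] by (simp only: matrix_mul_assoc)
  then have "J ** B1 = B2 ** J" using cancelT cancelG by blast
  then have "K ** (J ** B1) = K ** (B2 ** J)" by simp
  then have "B1 = K ** (B2 ** J)" by (simp add: matrix_mul_assoc K)
  then have "trace B1 = trace (K ** (B2 ** J))" by simp
  also have "\<dots> = trace ((B2 ** J) ** K)" by (rule trace_mul_sym)
  also have "(B2 ** J) ** K = B2" by (simp add: matrix_mul_assoc[symmetric] K)
  finally show ?thesis .
qed

context riemannian_atlas
begin

text \<open>
  Take a geodesic through \<open>q\<close> in direction \<open>v\<close>, which exists by completeness. Both sides, as quadratic
  forms in \<open>v\<close>, are the second derivative of \<open>u\<close> along it.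
\<close>

theorem hessian_transform:
  fixes u :: "'m \<Rightarrow> real"
  assumes complete: "geodesically_complete A G"
    and u: "\<And>c. c \<in> A \<Longrightarrow> smooth_on (chart_img c) (u \<circ> chart_inv c)"
    and c: "c \<in> A" "q \<in> chart_dom c" and d: "d \<in> A" "q \<in> chart_dom d"
  defines "J \<equiv> jacobian c d (chart_map c q)"
  shows "hessian (G c) (u \<circ> chart_inv c) (chart_map c q) =
    transpose J ** hessian (G d) (u \<circ> chart_inv d) (chart_map d q) ** J"
proof (rule quadratic_form_eq_imp_eq)
  interpret c: local_metric "chart_img c" "G c" by (rule chart_local_metric[OF c(1)])
  interpret d: local_metric "chart_img d" "G d" by (rule chart_local_metric[OF d(1)])
  let ?H = "hessian (G d) (u \<circ> chart_inv d) (chart_map d q)"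
  have Hd: "transpose ?H = ?H" by (rule d.hessian_sym[OF u[OF d(1)] chart_map_in[OF d(2)]])
  show "transpose (hessian (G c) (u \<circ> chart_inv c) (chart_map c q)) = hessian (G c) (u \<circ> chart_inv c) (chart_map c q)"
    by (rule c.hessian_sym[OF u[OF c(1)] chart_map_in[OF c(2)]])
  show "transpose (transpose J ** ?H ** J) = transpose J ** ?H ** J"
    by (simp add: matrix_transpose_mul Hd matrix_mul_assoc)
  fix v :: "real^'n"
  obtain \<gamma> where \<gamma>: "geodesic_on A G UNIV \<gamma>" "\<gamma> 0 = q" "velocity c UNIV \<gamma> 0 = v"
    using complete c unfolding geodesically_complete_def geodesic_from_def by blast
  have nb: "at s within UNIV \<noteq> bot" for s :: real by simp
  have qc: "\<gamma> 0 \<in> chart_dom c" and qd: "\<gamma> 0 \<in> chart_dom d" using \<gamma>(2) c d by simp_all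
  have vd: "velocity d UNIV \<gamma> 0 = J *v v"
    using velocity_transition[OF \<gamma>(1) UNIV_I nb c(1) qc d(1) qd] unfolding \<gamma>(2,3) J_def .
  have "((\<lambda>s. vector_derivative (\<lambda>s. u (\<gamma> s)) (at s within UNIV)) has_real_derivative
     v \<bullet> (hessian (G c) (u \<circ> chart_inv c) (chart_map c q) *v v)) (at 0 within UNIV)"
    using second_derivative_along_geodesic[OF \<gamma>(1) UNIV_I nb c(1) qc u[OF c(1)]] unfolding \<gamma>(2,3) .
  moreover have "((\<lambda>s. vector_derivative (\<lambda>s. u (\<gamma> s)) (at s within UNIV)) has_real_derivative
     (J *v v) \<bullet> (?H *v (J *v v))) (at 0 within UNIV)"
    using second_derivative_along_geodesic[OF \<gamma>(1) UNIV_I nb d(1) qd u[OF d(1)]] unfolding vd \<gamma>(2) .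
  ultimately have "v \<bullet> (hessian (G c) (u \<circ> chart_inv c) (chart_map c q) *v v) = (J *v v) \<bullet> (?H *v (J *v v))"
    by (rule DERIV_unique)
  also have "\<dots> = v \<bullet> (transpose J *v (?H *v (J *v v)))"
    by (rule inner_transpose_matrix[symmetric])
  finally show "v \<bullet> (hessian (G c) (u \<circ> chart_inv c) (chart_map c q) *v v) =
      v \<bullet> ((transpose J ** ?H ** J) *v v)"
    by (simp only: matrix_vector_mul_assoc matrix_mul_assoc)
qed

section \<open>Uniqueness of geodesics and rays of the exponential map\<close>

lemma geodesic_atLeast:
  assumes \<gamma>: "geodesic_on A G UNIV \<gamma>"
  shows "geodesic_on A G {0..} \<gamma>"
    and "c \<in> A \<Longrightarrow> 0 \<le> t \<Longrightarrow> \<gamma> t \<in> chart_dom c \<Longrightarrow> velocity c {0..} \<gamma> t = velocity c UNIV \<gamma> t"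
proof -
  have v: "velocity c {0..} \<gamma> t = velocity c UNIV \<gamma> t" if "c \<in> A" "0 \<le> t" "\<gamma> t \<in> chart_dom c" for c t
    using vector_derivative_within[OF at_within_atLeast_nontrivial[OF that(2)]
        has_vector_derivative_within_subset[OF geodesic_has_velocity[OF \<gamma> UNIV_I that(1,3)]]]
    by (simp add: velocity_def comp_def)
  show "c \<in> A \<Longrightarrow> 0 \<le> t \<Longrightarrow> \<gamma> t \<in> chart_dom c \<Longrightarrow> velocity c {0..} \<gamma> t = velocity c UNIV \<gamma> t"
    by (rule v)
  show "geodesic_on A G {0..} \<gamma>"
    unfolding geodesic_on_def
  proof (intro conjI ballI impI)
    have "continuous_on UNIV \<gamma>" using \<gamma> by (simp add: geodesic_on_def)
    then show "continuous_on {0..} \<gamma>" by (rule continuous_on_subset) simp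
    fix c and t :: real assume c: "c \<in> A" "\<gamma> t \<in> chart_dom c" and t: "t \<in> {0..}"
    show "(chart_map c \<circ> \<gamma>) differentiable (at t within {0..})"
      using has_vector_derivative_within_subset[OF geodesic_has_velocity[OF \<gamma> UNIV_I c], of "{0..}"]
      by (auto simp: comp_def intro: differentiableI_vector)
    obtain e where e: "e > 0" "\<And>s. s \<in> UNIV \<Longrightarrow> dist s t < e \<Longrightarrow> \<gamma> s \<in> chart_dom c"
      by (rule geodesic_near[OF \<gamma> UNIV_I c]) (rule that)
    let ?a = "\<chi> k. - (\<Sum>i\<in>UNIV. \<Sum>j\<in>UNIV. christoffel (G c) k i j (chart_map c (\<gamma> t)) *
                     velocity c UNIV \<gamma> t $ i * velocity c UNIV \<gamma> t $ j)"
    have "(velocity c UNIV \<gamma> has_vector_derivative ?a) (at t)"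
      using \<gamma> c by (simp add: geodesic_on_def)
    then have "(velocity c UNIV \<gamma> has_vector_derivative ?a) (at t within {0..})"
      by (rule has_vector_derivative_at_within)
    then have "(velocity c {0..} \<gamma> has_vector_derivative ?a) (at t within {0..})"
      by (rule has_vector_derivative_transform_within[OF _ e(1) t]) (use v[OF c(1)] e(2) in simp)
    then show "(velocity c {0..} \<gamma> has_vector_derivative
           (\<chi> k. - (\<Sum>i\<in>UNIV. \<Sum>j\<in>UNIV. christoffel (G c) k i j (chart_map c (\<gamma> t)) *
                     velocity c {0..} \<gamma> t $ i * velocity c {0..} \<gamma> t $ j))) (at t within {0..})"
      using v[OF c(1) _ c(2)] t by simp
  qed
qed

lemma geodesic_rescale:
  assumes \<gamma>: "geodesic_on A G UNIV \<gamma>"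
  shows "geodesic_on A G UNIV (\<lambda>s. \<gamma> (r * s))"
    and "c \<in> A \<Longrightarrow> \<gamma> (r * s) \<in> chart_dom c \<Longrightarrow> velocity c UNIV (\<lambda>s. \<gamma> (r * s)) s = r *\<^sub>R velocity c UNIV \<gamma> (r * s)"
proof -
  have lin: "((\<lambda>s. r * s) has_vector_derivative r) (at s)" for s :: real
    by (auto intro!: derivative_eq_intros simp: has_real_derivative_iff_has_vector_derivative[symmetric])
  have hv: "((\<lambda>s. chart_map c (\<gamma> (r * s))) has_vector_derivative r *\<^sub>R velocity c UNIV \<gamma> (r * s)) (at s)"
    if "c \<in> A" "\<gamma> (r * s) \<in> chart_dom c" for c s
    using vector_diff_chain_at[OF lin geodesic_has_velocity[OF \<gamma> UNIV_I that]] by (simp add: comp_def)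
  have v: "velocity c UNIV (\<lambda>s. \<gamma> (r * s)) s = r *\<^sub>R velocity c UNIV \<gamma> (r * s)"
    if "c \<in> A" "\<gamma> (r * s) \<in> chart_dom c" for c s
    using vector_derivative_at[OF hv[OF that]] by (simp add: velocity_def comp_def)
  show "c \<in> A \<Longrightarrow> \<gamma> (r * s) \<in> chart_dom c \<Longrightarrow> velocity c UNIV (\<lambda>s. \<gamma> (r * s)) s = r *\<^sub>R velocity c UNIV \<gamma> (r * s)"
    by (rule v)
  have cont: "continuous_on UNIV (\<lambda>s. \<gamma> (r * s))"
  proof -
    have "continuous_on UNIV \<gamma>" using \<gamma> by (simp add: geodesic_on_def)
    then show ?thesis by (rule continuous_on_compose2) (auto intro!: continuous_intros)
  qed
  show "geodesic_on A G UNIV (\<lambda>s. \<gamma> (r * s))"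
    unfolding geodesic_on_def
  proof (intro conjI ballI impI)
    show "continuous_on UNIV (\<lambda>s. \<gamma> (r * s))" by (rule cont)
    fix c and t :: real assume c: "c \<in> A" "\<gamma> (r * t) \<in> chart_dom c"
    show "(chart_map c \<circ> (\<lambda>s. \<gamma> (r * s))) differentiable (at t)"
      using hv[OF c] by (auto simp: comp_def intro: differentiableI_vector)
    let ?v = "velocity c UNIV \<gamma> (r * t)"
    have "open ((\<lambda>s. \<gamma> (r * s)) -` chart_dom c)"
      using cont open_chart_dom[OF c(1)] by (simp add: continuous_on_open_vimage)
    then obtain e where e: "e > 0" "\<And>s. dist s t < e \<Longrightarrow> \<gamma> (r * s) \<in> chart_dom c"
      using c(2) unfolding open_dist by auto
    have "((\<lambda>s. velocity c UNIV \<gamma> (r * s)) has_vector_derivative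
        r *\<^sub>R (- christoffel_vec (G c) (chart_map c (\<gamma> (r * t))) ?v ?v)) (at t)"
      using vector_diff_chain_at[OF lin geodesic_has_acceleration[OF \<gamma> UNIV_I c]] by (simp add: comp_def)
    then have "((\<lambda>s. r *\<^sub>R velocity c UNIV \<gamma> (r * s)) has_vector_derivative
        r *\<^sub>R (r *\<^sub>R (- christoffel_vec (G c) (chart_map c (\<gamma> (r * t))) ?v ?v))) (at t)"
      by (rule bounded_linear.has_vector_derivative[OF bounded_linear_scaleR_right])
    then have "(velocity c UNIV (\<lambda>s. \<gamma> (r * s)) has_vector_derivative
        r *\<^sub>R (r *\<^sub>R (- christoffel_vec (G c) (chart_map c (\<gamma> (r * t))) ?v ?v))) (at t)"
      by (rule has_vector_derivative_transform_within[OF _ e(1) UNIV_I]) (use v[OF c(1)] e(2) in simp)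
    moreover have "r *\<^sub>R (r *\<^sub>R (- christoffel_vec (G c) (chart_map c (\<gamma> (r * t))) ?v ?v)) =
       (\<chi> k. - (\<Sum>i\<in>UNIV. \<Sum>j\<in>UNIV. christoffel (G c) k i j (chart_map c (\<gamma> (r * t))) *
                     velocity c UNIV (\<lambda>s. \<gamma> (r * s)) t $ i * velocity c UNIV (\<lambda>s. \<gamma> (r * s)) t $ j))"
      unfolding v[OF c] by (simp add: vec_eq_iff christoffel_vec_def sum_distrib_left mult_ac)
    ultimately show "(velocity c UNIV (\<lambda>s. \<gamma> (r * s)) has_vector_derivative
           (\<chi> k. - (\<Sum>i\<in>UNIV. \<Sum>j\<in>UNIV. christoffel (G c) k i j (chart_map c (\<gamma> (r * t))) *
                     velocity c UNIV (\<lambda>s. \<gamma> (r * s)) t $ i * velocity c UNIV (\<lambda>s. \<gamma> (r * s)) t $ j))) (at t)"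
      by simp
  qed
qed

text \<open>
  In a chart the geodesic equation is a first order equation for the pair of position and velocity.
\<close>

lemma geodesic_unique_local:
  assumes \<gamma>1: "geodesic_on A G {0..} \<gamma>1" and \<gamma>2: "geodesic_on A G {0..} \<gamma>2"
    and T: "0 \<le> T" and c: "c \<in> A" "\<gamma>1 T \<in> chart_dom c"
    and eq: "\<gamma>1 T = \<gamma>2 T" "velocity c {0..} \<gamma>1 T = velocity c {0..} \<gamma>2 T"
  shows "\<exists>e>0. \<forall>t. T \<le> t \<longrightarrow> t \<le> T + e \<longrightarrow> \<gamma>1 t = \<gamma>2 t"
proof -
  interpret local_metric "chart_img c" "G c" by (rule chart_local_metric[OF c(1)])
  define S where "S = chart_img c \<times> (UNIV :: (real^'n) set)"
  define f where "f = (\<lambda>z. (snd z, - christoffel_vec (G c) (fst z) (snd z) (snd z)))"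
  have S: "open S" unfolding S_def by (intro open_Times open_U open_UNIV)
  have f: "smooth_on S f"
  proof -
    have bl1: "bounded_linear (\<lambda>v :: real^'n. (v, 0 :: real^'n))" and bl2: "bounded_linear (\<lambda>v :: real^'n. (0 :: real^'n, v))"
      by (intro bounded_linear_Pair bounded_linear_ident bounded_linear_zero)+
    have fs: "smooth_on S (fst :: (real^'n) \<times> (real^'n) \<Rightarrow> real^'n)" and sn: "smooth_on S (snd :: (real^'n) \<times> (real^'n) \<Rightarrow> real^'n)"
      by (intro smooth_on_linear[OF _ S] bounded_linear_fst bounded_linear_snd)+
    have sni: "smooth_on S (\<lambda>z :: (real^'n) \<times> (real^'n). snd z $ i)" for i by (rule smooth_on_nth[OF S sn])
    have ch: "smooth_on S (\<lambda>z. christoffel (G c) k i j (fst z))" for k i j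
      by (rule smooth_on_compose[OF S open_U _ fs smooth_christoffel]) (auto simp: S_def)
    have comp: "christoffel_vec (G c) (fst z) (snd z) (snd z) $ k =
       (\<Sum>i\<in>UNIV. \<Sum>j\<in>UNIV. christoffel (G c) k i j (fst z) * snd z $ i * snd z $ j)" for z k
      by (simp add: christoffel_vec_def)
    have "smooth_on S (\<lambda>z. christoffel_vec (G c) (fst z) (snd z) (snd z))"
      by (rule smooth_on_vec[OF S], unfold comp) (intro smooth_on_sum[OF S] smooth_on_mult[OF S] ch sni)
    then have a: "smooth_on S (\<lambda>z. - christoffel_vec (G c) (fst z) (snd z) (snd z))"
      by (rule smooth_on_minus[OF S])
    have "smooth_on S (\<lambda>z. (snd z, 0) + (0, - christoffel_vec (G c) (fst z) (snd z) (snd z)))"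
      by (rule smooth_on_add[OF S smooth_on_linear_compose[OF bl1 S sn] smooth_on_linear_compose[OF bl2 S a]])
    then show ?thesis by (simp add: f_def)
  qed
  have ode: "\<exists>e>0. \<forall>t. T \<le> t \<longrightarrow> t < T + e \<longrightarrow> \<gamma> t \<in> chart_dom c \<and>
      (chart_map c (\<gamma> t), velocity c {0..} \<gamma> t) \<in> S \<and>
      ((\<lambda>t. (chart_map c (\<gamma> t), velocity c {0..} \<gamma> t)) has_vector_derivative
        f (chart_map c (\<gamma> t), velocity c {0..} \<gamma> t)) (at t within {0..})"
    if \<gamma>: "geodesic_on A G {0..} \<gamma>" "\<gamma> T \<in> chart_dom c" for \<gamma>
  proof -
    have T': "T \<in> {0..}" using T by simp
    obtain e where e: "e > 0" "\<And>s. s \<in> {0..} \<Longrightarrow> dist s T < e \<Longrightarrow> \<gamma> s \<in> chart_dom c"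
      using geodesic_near[OF \<gamma>(1) T' c(1) \<gamma>(2)] by blast
    show ?thesis
    proof (intro exI[of _ e] conjI allI impI)
      show "e > 0" by (rule e(1))
      fix t assume t: "T \<le> t" "t < T + e"
      then have t0: "t \<in> {0..}" using T by simp
      show d: "\<gamma> t \<in> chart_dom c" using t T by (intro e(2)) (simp_all add: dist_real_def)
      show "(chart_map c (\<gamma> t), velocity c {0..} \<gamma> t) \<in> S" using chart_map_in[OF d] by (simp add: S_def)
      show "((\<lambda>t. (chart_map c (\<gamma> t), velocity c {0..} \<gamma> t)) has_vector_derivative
        f (chart_map c (\<gamma> t), velocity c {0..} \<gamma> t)) (at t within {0..})"
        unfolding f_def fst_conv snd_conv
        by (intro has_vector_derivative_Pair geodesic_has_velocity[OF \<gamma>(1) t0 c(1) d] geodesic_has_acceleration[OF \<gamma>(1) t0 c(1) d])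
    qed
  qed
  let ?z = "\<lambda>\<gamma> t. (chart_map c (\<gamma> t), velocity c {0..} \<gamma> t)"
  obtain e1 where e1: "e1 > 0" "\<And>t. T \<le> t \<Longrightarrow> t < T + e1 \<Longrightarrow> \<gamma>1 t \<in> chart_dom c \<and> ?z \<gamma>1 t \<in> S \<and>
      (?z \<gamma>1 has_vector_derivative f (?z \<gamma>1 t)) (at t within {0..})"
    using ode[OF \<gamma>1 c(2)] by blast
  obtain e2 where e2: "e2 > 0" "\<And>t. T \<le> t \<Longrightarrow> t < T + e2 \<Longrightarrow> \<gamma>2 t \<in> chart_dom c \<and> ?z \<gamma>2 t \<in> S \<and>
      (?z \<gamma>2 has_vector_derivative f (?z \<gamma>2 t)) (at t within {0..})"
    using ode[OF \<gamma>2] c(2) eq(1) by auto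
  define d where "d = min e1 e2"
  have d: "d > 0" "d \<le> e1" "d \<le> e2" using e1(1) e2(1) by (auto simp: d_def)
  have "\<exists>e>0. \<forall>t. T \<le> t \<longrightarrow> t \<le> T + e \<longrightarrow> ?z \<gamma>1 t = ?z \<gamma>2 t"
  proof (rule ode_unique_forward[OF S f T d(1)])
    show "?z \<gamma>1 t \<in> S \<and> (?z \<gamma>1 has_vector_derivative f (?z \<gamma>1 t)) (at t within {0..})" if "T \<le> t" "t < T + d" for t
      using e1(2)[of t] that d by auto
    show "?z \<gamma>2 t \<in> S \<and> (?z \<gamma>2 has_vector_derivative f (?z \<gamma>2 t)) (at t within {0..})" if "T \<le> t" "t < T + d" for t
      using e2(2)[of t] that d by auto
  qed (simp add: eq)
  then obtain e where e: "e > 0" "\<And>t. T \<le> t \<Longrightarrow> t \<le> T + e \<Longrightarrow> ?z \<gamma>1 t = ?z \<gamma>2 t" by blast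
  show ?thesis
  proof (intro exI[of _ "min e (d / 2)"] conjI allI impI)
    show "min e (d / 2) > 0" using e d by simp
    fix t assume t: "T \<le> t" "t \<le> T + min e (d / 2)"
    then have "\<gamma>1 t \<in> chart_dom c" "\<gamma>2 t \<in> chart_dom c" "chart_map c (\<gamma>1 t) = chart_map c (\<gamma>2 t)"
      using e1(2)[of t] e2(2)[of t] e(2)[of t] d by auto
    then show "\<gamma>1 t = \<gamma>2 t" using chart_inv_map[OF c(1)] by metis
  qed
qed

end

locale hausdorff_riemannian = riemannian_atlas A G for A :: "('m::t2_space, 'n::finite) chart set" and G
begin

text \<open>
  Consider the infimum \<open>T\<close> of the times at which the geodesics differ. Their positions and velocities
  agree at \<open>T\<close>: by assumption if \<open>T = 0\<close>, and otherwise as limits from the left, which are unique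
  because the space is Hausdorff. So the geodesics agree a little longer.
\<close>

theorem geodesic_unique:
  assumes \<gamma>1: "geodesic_on A G {0..} \<gamma>1" and \<gamma>2: "geodesic_on A G {0..} \<gamma>2"
    and c: "c \<in> A" "\<gamma>1 0 \<in> chart_dom c"
    and eq: "\<gamma>1 0 = \<gamma>2 0" "velocity c {0..} \<gamma>1 0 = velocity c {0..} \<gamma>2 0"
    and t: "0 \<le> t"
  shows "\<gamma>1 t = \<gamma>2 t"
proof (rule ccontr)
  assume ne: "\<gamma>1 t \<noteq> \<gamma>2 t"
  define N where "N = {t. 0 \<le> t \<and> \<gamma>1 t \<noteq> \<gamma>2 t}"
  have N: "N \<noteq> {}" "bdd_below N" using ne t by (auto simp: N_def intro!: bdd_belowI[of _ 0])
  define T where "T = Inf N"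
  have T0: "0 \<le> T" unfolding T_def using N(1) by (rule cInf_greatest) (simp add: N_def)
  have before: "\<gamma>1 s = \<gamma>2 s" if "0 \<le> s" "s < T" for s
  proof (rule ccontr)
    assume "\<gamma>1 s \<noteq> \<gamma>2 s"
    then have "s \<in> N" using that by (simp add: N_def)
    then have "T \<le> s" unfolding T_def using N(2) by (rule cInf_lower)
    then show False using that by simp
  qed
  have "\<exists>c\<in>A. \<gamma>1 T \<in> chart_dom c \<and> \<gamma>1 T = \<gamma>2 T \<and> velocity c {0..} \<gamma>1 T = velocity c {0..} \<gamma>2 T"
  proof (cases "T = 0")
    case True
    then show ?thesis using c eq by auto
  next
    case False
    then have Tp: "T > 0" using T0 by simp
    have le: "at_left T \<le> at T within {0..}"
    proof -
      have "at_left T = at T within {0<..<T}"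
        by (rule at_within_nhd[of T "{0<..}"]) (use Tp in auto)
      also have "\<dots> \<le> at T within {0..}" by (rule at_le) auto
      finally show ?thesis .
    qed
    have ev: "\<forall>\<^sub>F s in at_left T. 0 < s \<and> s < T"
      using eventually_at_left_real[OF Tp] by eventually_elim auto
    have lim: "(\<gamma> \<longlongrightarrow> \<gamma> T) (at_left T)" if "geodesic_on A G {0..} \<gamma>" for \<gamma>
    proof -
      have "(\<gamma> \<longlongrightarrow> \<gamma> T) (at T within {0..})"
        using that T0 by (auto simp: geodesic_on_def continuous_on_def)
      then show ?thesis by (rule tendsto_mono[OF le])
    qed
    have eqT: "\<gamma>1 T = \<gamma>2 T"
    proof (rule tendsto_unique[OF trivial_limit_at_left_real lim[OF \<gamma>1]])
      show "(\<gamma>1 \<longlongrightarrow> \<gamma>2 T) (at_left T)"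
        by (rule Lim_transform_eventually[OF lim[OF \<gamma>2]])
          (use ev in eventually_elim, simp add: before)
    qed
    obtain d where d: "d \<in> A" "\<gamma>1 T \<in> chart_dom d" using chart_exists by blast
    have d2: "\<gamma>2 T \<in> chart_dom d" using d eqT by simp
    have T': "T \<in> {0..}" using T0 by simp
    have vlim: "(velocity d {0..} \<gamma> \<longlongrightarrow> velocity d {0..} \<gamma> T) (at_left T)"
      if "geodesic_on A G {0..} \<gamma>" "\<gamma> T \<in> chart_dom d" for \<gamma>
    proof -
      have "(velocity d {0..} \<gamma> \<longlongrightarrow> velocity d {0..} \<gamma> T) (at T within {0..})"
        using has_vector_derivative_continuous[OF geodesic_has_acceleration[OF that(1) T' d(1) that(2)]]
        by (simp add: continuous_within)
      then show ?thesis by (rule tendsto_mono[OF le])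
    qed
    have veq: "velocity d {0..} \<gamma>2 s = velocity d {0..} \<gamma>1 s" if s: "0 < s" "s < T" "\<gamma>2 s \<in> chart_dom d" for s
    proof -
      have s0: "s \<in> {0..}" using s by simp
      have "((\<lambda>s. chart_map d (\<gamma>2 s)) has_vector_derivative velocity d {0..} \<gamma>2 s) (at s within {0..})"
        by (rule geodesic_has_velocity[OF \<gamma>2 s0 d(1) s(3)])
      then have "((\<lambda>s. chart_map d (\<gamma>1 s)) has_vector_derivative velocity d {0..} \<gamma>2 s) (at s within {0..})"
        by (rule has_vector_derivative_transform_within[where d = "T - s"])
          (use s before in \<open>auto simp: dist_real_def\<close>)
      from vector_derivative_within[OF at_within_atLeast_nontrivial this] s
      show ?thesis by (simp add: velocity_def comp_def)
    qed
    have "velocity d {0..} \<gamma>1 T = velocity d {0..} \<gamma>2 T"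
    proof (rule tendsto_unique[OF trivial_limit_at_left_real vlim[OF \<gamma>1 d(2)]])
      have "\<forall>\<^sub>F s in at_left T. \<gamma>2 s \<in> chart_dom d"
        using topological_tendstoD[OF lim[OF \<gamma>2] open_chart_dom[OF d(1)] d2] .
      then have "\<forall>\<^sub>F s in at_left T. velocity d {0..} \<gamma>2 s = velocity d {0..} \<gamma>1 s"
        using ev by eventually_elim (simp add: veq)
      then show "(velocity d {0..} \<gamma>1 \<longlongrightarrow> velocity d {0..} \<gamma>2 T) (at_left T)"
        by (rule Lim_transform_eventually[OF vlim[OF \<gamma>2 d2]])
    qed
    then show ?thesis using d eqT by blast
  qed
  then obtain d where d: "d \<in> A" "\<gamma>1 T \<in> chart_dom d" "\<gamma>1 T = \<gamma>2 T"
    "velocity d {0..} \<gamma>1 T = velocity d {0..} \<gamma>2 T" by blast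
  obtain e where e: "e > 0" "\<And>t. T \<le> t \<Longrightarrow> t \<le> T + e \<Longrightarrow> \<gamma>1 t = \<gamma>2 t"
    using geodesic_unique_local[OF \<gamma>1 \<gamma>2 T0 d] by blast
  have "T + e \<le> Inf N"
  proof (rule cInf_greatest[OF N(1)])
    fix s assume "s \<in> N"
    then have "0 \<le> s" "\<gamma>1 s \<noteq> \<gamma>2 s" by (simp_all add: N_def)
    then show "T + e \<le> s" using before[of s] e(2)[of s] by (metis linear linorder_not_less)
  qed
  then show False using e(1) by (simp add: T_def)
qed

text \<open>
  Rescaling the parameter by \<open>t\<close> multiplies the initial velocity by \<open>t\<close>. Uniqueness of geodesics makes
  the definite description in \<open>exp_map\<close> meaningful.
\<close>

theorem exp_map_ray:
  assumes c: "c \<in> A" "p \<in> chart_dom c" and \<gamma>: "geodesic_from A G c p v \<gamma>" and t: "0 \<le> t"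
  shows "exp_map A G c p (t *\<^sub>R v) = \<gamma> t"
  unfolding exp_map_def
proof (rule the_equality)
  have \<gamma>': "geodesic_on A G UNIV \<gamma>" "\<gamma> 0 = p" "velocity c UNIV \<gamma> 0 = v"
    using \<gamma> by (simp_all add: geodesic_from_def)
  have r: "geodesic_from A G c p (t *\<^sub>R v) (\<lambda>s. \<gamma> (t * s))"
    unfolding geodesic_from_def
    using geodesic_rescale(1)[OF \<gamma>'(1), of t] geodesic_rescale(2)[OF \<gamma>'(1) c(1), of t 0] \<gamma>' c by simp
  then show "\<exists>\<gamma>'. geodesic_from A G c p (t *\<^sub>R v) \<gamma>' \<and> \<gamma>' 1 = \<gamma> t"
    by (intro exI[of _ "\<lambda>s. \<gamma> (t * s)"]) simp
  fix q assume "\<exists>\<gamma>'. geodesic_from A G c p (t *\<^sub>R v) \<gamma>' \<and> \<gamma>' 1 = q"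
  then obtain \<delta> where \<delta>: "geodesic_from A G c p (t *\<^sub>R v) \<delta>" "\<delta> 1 = q" by blast
  have at0: "geodesic_on A G {0..} \<beta>" "\<beta> 0 = p" "velocity c {0..} \<beta> 0 = t *\<^sub>R v"
    if "geodesic_from A G c p (t *\<^sub>R v) \<beta>" for \<beta>
    using that geodesic_atLeast(1)[of \<beta>] geodesic_atLeast(2)[of \<beta> c 0] c
    by (simp_all add: geodesic_from_def)
  have "\<delta> 1 = (\<lambda>s. \<gamma> (t * s)) 1"
    by (rule geodesic_unique[OF at0(1)[OF \<delta>(1)] at0(1)[OF r] c(1)])
      (use at0[OF \<delta>(1)] at0[OF r] c in simp_all)
  then show "q = \<gamma> t" using \<delta>(2) by simp
qed

end

section \<open>Riccati inequalities on the half-line\<close>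

text \<open>
  If \<open>u\<close> is negative at \<open>t0\<close>, it stays negative, and \<open>1 / u\<close> grows at least with slope \<open>1 / n\<close>; so it
  reaches 0 in finite time, which is absurd.
\<close>

lemma riccati_nonneg:
  fixes u :: "real \<Rightarrow> real" and n :: real
  assumes n: "0 < n"
    and u: "\<And>t. 0 < t \<Longrightarrow> \<exists>d. (u has_real_derivative d) (at t) \<and> d \<le> - (u t)\<^sup>2 / n"
    and t0: "0 < t0"
  shows "0 \<le> u t0"
proof (rule ccontr)
  assume "\<not> 0 \<le> u t0"
  then have neg0: "u t0 < 0" by simp
  have mono: "u t \<le> u t0" if "t0 \<le> t" for t
  proof (rule DERIV_nonpos_imp_nonincreasing[OF that])
    fix s assume s: "t0 \<le> s" "s \<le> t"
    obtain d where "(u has_real_derivative d) (at s)" "d \<le> - (u s)\<^sup>2 / n" using u[of s] s t0 by auto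
    moreover have "- (u s)\<^sup>2 / n \<le> 0" using n by simp
    ultimately show "\<exists>y. DERIV u s :> y \<and> y \<le> 0" by force
  qed
  then have neg: "u t < 0" if "t0 \<le> t" for t using that neg0 by force
  define w where "w = (\<lambda>t. inverse (u t) - t / n)"
  have inc: "w t0 \<le> w t" if "t0 \<le> t" for t
  proof (rule DERIV_nonneg_imp_nondecreasing[OF that])
    fix s assume s: "t0 \<le> s" "s \<le> t"
    obtain d where d: "(u has_real_derivative d) (at s)" "d \<le> - (u s)\<^sup>2 / n" using u[of s] s t0 by auto
    have us: "u s \<noteq> 0" using neg[of s] s by simp
    have dw: "(w has_real_derivative - (inverse (u s) * d * inverse (u s)) - 1 / n) (at s)"
      unfolding w_def by (intro DERIV_diff DERIV_inverse' d us DERIV_cdivide DERIV_ident)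
    have "- (inverse (u s) * d * inverse (u s)) = - d / (u s)\<^sup>2"
      by (simp add: field_simps power2_eq_square)
    moreover have "1 / n \<le> - d / (u s)\<^sup>2"
      using d(2) us n by (simp add: field_simps)
    ultimately show "\<exists>y. DERIV w s :> y \<and> 0 \<le> y" using dw by (intro exI conjI) (assumption, simp)
  qed
  \<comment> \<open>the time at which the lower bound for \<open>1 / u\<close> reaches 0\<close>
  define t where "t = t0 - n * inverse (u t0)"
  have "t0 \<le> t" unfolding t_def using n neg0 by (simp add: mult_nonneg_nonpos)
  then have "inverse (u t0) - t0 / n \<le> inverse (u t) - t / n" using inc unfolding w_def by blast
  moreover have "t / n = t0 / n - inverse (u t0)"
    unfolding t_def using n by (simp add: diff_divide_distrib)
  ultimately have "0 \<le> inverse (u t)" by linarith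
  then show False using neg[OF \<open>t0 \<le> t\<close>] by simp
qed

text \<open>
  In the application \<open>m\<close> is the Laplacian of the potential along \<open>\<sigma>\<close>, \<open>\<rho>\<close> is the Ricci curvature in
  direction \<open>\<sigma>'\<close>, \<open>q\<close> is \<open>tr(B\<^sup>2)\<close>, and \<open>F1\<close> is the derivative of \<open>F = f \<circ> \<sigma>\<close>. For \<open>u = m / t\<close> the
  function \<open>F1 - lam t - u\<close> is nondecreasing, so \<open>u \<ge> 0\<close> bounds \<open>F1\<close> below by \<open>lam t\<close> plus a constant.
\<close>

lemma riccati_growth:
  fixes F F1 m :: "real \<Rightarrow> real" and n lam a b :: real
  assumes n: "0 < n"
    and m: "\<And>t. 0 < t \<Longrightarrow> \<exists>q \<rho>. (m has_real_derivative (m t - q - t\<^sup>2 * \<rho>) / t) (at t) \<and> (m t)\<^sup>2 \<le> n * q \<and> 0 \<le> \<rho>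
        \<and> (F1 has_real_derivative lam - \<rho>) (at t)"
    and F: "\<And>t. 0 < t \<Longrightarrow> (F has_real_derivative F1 t) (at t)"
    and bound: "\<And>t. 0 < t \<Longrightarrow> F t \<le> a * t + b"
  shows "lam \<le> 0"
proof (rule ccontr)
  assume "\<not> lam \<le> 0"
  then have lam: "lam > 0" by simp
  define u where "u = (\<lambda>t. m t / t)"
  have u': "\<exists>q \<rho>. (u has_real_derivative - q / t\<^sup>2 - \<rho>) (at t) \<and> (m t)\<^sup>2 \<le> n * q \<and> 0 \<le> \<rho>
        \<and> (F1 has_real_derivative lam - \<rho>) (at t)" if t: "0 < t" for t
  proof -
    obtain q \<rho> where q: "(m has_real_derivative (m t - q - t\<^sup>2 * \<rho>) / t) (at t)" "(m t)\<^sup>2 \<le> n * q" "0 \<le> \<rho>"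
        "(F1 has_real_derivative lam - \<rho>) (at t)" using m[OF t] by blast
    have "(u has_real_derivative ((m t - q - t\<^sup>2 * \<rho>) / t * t - m t * 1) / (t * t)) (at t)"
      unfolding u_def by (intro DERIV_divide q(1) DERIV_ident) (use t in simp)
    moreover have "((m t - q - t\<^sup>2 * \<rho>) / t * t - m t * 1) / (t * t) = - q / t\<^sup>2 - \<rho>"
      using t by (simp add: field_simps power2_eq_square)
    ultimately show ?thesis using q by metis
  qed
  have unn: "0 \<le> u t" if "0 < t" for t
  proof (rule riccati_nonneg[OF n _ that])
    fix s :: real assume s: "0 < s"
    obtain q \<rho> where q: "(u has_real_derivative - q / s\<^sup>2 - \<rho>) (at s)" "(m s)\<^sup>2 \<le> n * q" "0 \<le> \<rho>"
      using u'[OF s] by blast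
    have "(u s)\<^sup>2 / n = ((m s)\<^sup>2 / n) / s\<^sup>2" by (simp add: u_def power_divide)
    also have "\<dots> \<le> q / s\<^sup>2" using q(2) n by (intro divide_right_mono) (simp_all add: field_simps)
    finally have "- q / s\<^sup>2 - \<rho> \<le> - (u s)\<^sup>2 / n" using q(3) by simp
    then show "\<exists>d. (u has_real_derivative d) (at s) \<and> d \<le> - (u s)\<^sup>2 / n" using q(1) by blast
  qed
  define k where "k = (\<lambda>t. F1 t - lam * t - u t)"
  have kinc: "k 1 \<le> k t" if "1 \<le> t" for t
  proof (rule DERIV_nonneg_imp_nondecreasing[OF that])
    fix s :: real assume "1 \<le> s" "s \<le> t"
    then have s: "0 < s" by simp
    obtain q \<rho> where q: "(u has_real_derivative - q / s\<^sup>2 - \<rho>) (at s)" "(m s)\<^sup>2 \<le> n * q"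
      "(F1 has_real_derivative lam - \<rho>) (at s)" using u'[OF s] by blast
    have "(k has_real_derivative (lam - \<rho>) - lam * 1 - (- q / s\<^sup>2 - \<rho>)) (at s)"
      unfolding k_def by (intro DERIV_diff q DERIV_cmult DERIV_ident)
    moreover have "0 \<le> n * q" using q(2) zero_le_power2[of "m s"] by linarith
    then have "0 \<le> q" using n by (simp add: zero_le_mult_iff)
    then have "(lam - \<rho>) - lam * 1 - (- q / s\<^sup>2 - \<rho>) \<ge> 0" by simp
    ultimately show "\<exists>y. DERIV k s :> y \<and> 0 \<le> y" by blast
  qed
  define K where "K = (\<lambda>t. F t - (lam * (t * t) / 2 + k 1 * t))"
  have Kinc: "K 1 \<le> K t" if "1 \<le> t" for t
  proof (rule DERIV_nonneg_imp_nondecreasing[OF that])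
    fix s :: real assume s1: "1 \<le> s" "s \<le> t"
    then have s: "0 < s" by simp
    have "(K has_real_derivative F1 s - (lam * s + k 1)) (at s)"
      unfolding K_def by (auto intro!: derivative_eq_intros F[OF s])
    moreover have "0 \<le> F1 s - (lam * s + k 1)"
      using kinc[OF s1(1)] unn[OF s] by (simp add: k_def)
    ultimately show "\<exists>y. DERIV K s :> y \<and> 0 \<le> y" by blast
  qed
  define C where "C = \<bar>a - k 1\<bar> + \<bar>b - K 1\<bar>"
  \<comment> \<open>late enough for the quadratic lower bound to exceed the linear upper bound\<close>
  define t where "t = 2 * C / lam + 1"
  have t: "1 \<le> t" unfolding t_def C_def using lam by simp
  have "lam * (t * t) / 2 \<le> (a - k 1) * t + (b - K 1)"
    using Kinc[OF t] bound[of t] t by (simp add: K_def algebra_simps)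
  also have "\<dots> \<le> \<bar>a - k 1\<bar> * t + \<bar>b - K 1\<bar> * t"
  proof (rule add_mono)
    show "(a - k 1) * t \<le> \<bar>a - k 1\<bar> * t" using t by (intro mult_right_mono) auto
    have "b - K 1 \<le> \<bar>b - K 1\<bar> * 1" by simp
    also have "\<dots> \<le> \<bar>b - K 1\<bar> * t" using t by (intro mult_left_mono) auto
    finally show "b - K 1 \<le> \<bar>b - K 1\<bar> * t" .
  qed
  also have "\<dots> = C * t" by (simp add: C_def algebra_simps)
  finally have "(lam * t) * t \<le> (2 * C) * t" by simp
  then have "lam * t \<le> 2 * C" using t by (simp add: mult_le_cancel_right)
  then show False unfolding t_def using lam by (simp add: distrib_left)
qed

section \<open>The exponential map at a pole\<close>

text \<open>
  The push-forward of the Euler field at the end of \<open>s y\<close> is \<open>s\<close> times the velocity of the ray through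
  \<open>y\<close>. The interval \<open>I\<close> will be \<open>UNIV\<close> or \<open>{0..}\<close>; at positive times derivatives within it are full
  derivatives.
\<close>

lemma (in parametrized) polar_field_along_ray:
  assumes \<gamma>: "geodesic_on A G I \<gamma>" and ray: "\<And>s. 0 \<le> s \<Longrightarrow> \<gamma> s = h (s *\<^sub>R y)"
    and s: "0 < s" "s \<in> I" "at s within I = at s" and c: "c \<in> A" "\<gamma> s \<in> chart_dom c"
  shows "polar_field h c (chart_map c (\<gamma> s)) = s *\<^sub>R velocity c I \<gamma> s"
proof -
  have V: "s *\<^sub>R y \<in> h -` chart_dom c" using c(2) ray[of s] s(1) by simp
  let ?D = "fderiv (polar_map h c) (s *\<^sub>R y)"
  have D: "(polar_map h c has_derivative ?D) (at (s *\<^sub>R y))"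
    by (rule smooth_on_has_derivative[OF smooth_polar_map[OF c(1)] V])
  have "((\<lambda>s. s *\<^sub>R y) has_derivative (\<lambda>t. t *\<^sub>R y)) (at s)" by (auto intro!: derivative_eq_intros)
  from has_derivative_compose[OF this D]
  have "((\<lambda>s. polar_map h c (s *\<^sub>R y)) has_vector_derivative ?D y) (at s)"
    by (simp add: has_vector_derivative_def linear_scale[OF has_derivative_linear[OF D]])
  then have "((\<lambda>s. chart_map c (\<gamma> s)) has_vector_derivative ?D y) (at s)"
    by (rule has_vector_derivative_transform_within_open[where S = "{0<..}"])
      (use s(1) ray in \<open>auto simp: polar_map_def\<close>)
  moreover have "((\<lambda>s. chart_map c (\<gamma> s)) has_vector_derivative velocity c I \<gamma> s) (at s)"
    using geodesic_has_velocity[OF \<gamma> s(2) c] unfolding s(3) .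
  ultimately have v: "?D y = velocity c I \<gamma> s" by (rule vector_derivative_unique_at)
  have x: "chart_map c (\<gamma> s) = polar_map h c (s *\<^sub>R y)" using ray[of s] s(1) by (simp add: polar_map_def)
  show ?thesis
    unfolding x polar_field_def polar_coord_map[OF c(1) V]
    using linear_scale[OF has_derivative_linear[OF D], of s y] v by simp
qed

text \<open>
  At the end of the ray \<open>\<gamma>\<close> through \<open>y\<close> differentiate \<open>E(\<gamma>(s)) = s \<gamma>'(s)\<close> at \<open>s = 1\<close> and use the geodesic
  equation for \<open>\<gamma>\<close>.
\<close>

theorem (in hausdorff_riemannian) exp_map_polar:
  fixes c0 p
  defines "h \<equiv> exp_map A G c0 p"
  assumes complete: "geodesically_complete A G" and c0: "c0 \<in> A" "p \<in> chart_dom c0"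
    and h: "bij h" "smooth_to_manifold A h" "smooth_from_manifold A (inv h)"
  shows "polar A G h"
proof -
  interpret parametrized A G h by standard (use h in auto)
  show ?thesis
  proof
    fix c x assume c: "c \<in> A" and x: "x \<in> chart_img c"
    define y where "y = polar_coord h c x"
    obtain \<gamma> where \<gamma>: "geodesic_from A G c0 p y \<gamma>"
      using complete c0 unfolding geodesically_complete_def by blast
    then have g: "geodesic_on A G UNIV \<gamma>" by (simp add: geodesic_from_def)
    have ray: "\<gamma> s = h (s *\<^sub>R y)" if "0 \<le> s" for s
      unfolding h_def by (rule exp_map_ray[OF c0 \<gamma> that, symmetric])
    have d1: "\<gamma> 1 \<in> chart_dom c" using ray[of 1] polar_coord_in[OF c x] by (simp add: y_def)
    have x1: "chart_map c (\<gamma> 1) = x"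
      using ray[of 1] polar_map_coord[OF c x] by (simp add: y_def polar_map_def)
    let ?v = "velocity c UNIV \<gamma>"
    have Ev: "polar_field h c (chart_map c (\<gamma> s)) = s *\<^sub>R ?v s" if "0 < s" "\<gamma> s \<in> chart_dom c" for s
      by (rule polar_field_along_ray[OF g ray that(1) UNIV_I _ c that(2)]) simp_all
    have "continuous_on UNIV \<gamma>" using g by (simp add: geodesic_on_def)
    then have op: "open (\<gamma> -` chart_dom c \<inter> {0<..})"
      using open_chart_dom[OF c] by (intro open_Int) (simp_all add: continuous_on_open_vimage)
    have E: "(polar_field h c has_derivative fderiv (polar_field h c) x) (at x)"
      by (rule smooth_on_has_derivative[OF smooth_polar_field[OF c] x])
    have "((\<lambda>s. chart_map c (\<gamma> s)) has_derivative (\<lambda>t. t *\<^sub>R ?v 1)) (at 1)"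
      using geodesic_has_velocity[OF g UNIV_I c d1] by (simp add: has_vector_derivative_def)
    from has_derivative_compose[OF this, unfolded x1, OF E]
    have "((\<lambda>s. polar_field h c (chart_map c (\<gamma> s))) has_vector_derivative
        fderiv (polar_field h c) x (?v 1)) (at 1)"
      by (simp add: has_vector_derivative_def linear_scale[OF has_derivative_linear[OF E]])
    then have "((\<lambda>s. s *\<^sub>R ?v s) has_vector_derivative
        fderiv (polar_field h c) x (?v 1)) (at 1)"
      by (rule has_vector_derivative_transform_within_open[OF _ op]) (use d1 Ev in auto)
    moreover have "((\<lambda>s. s *\<^sub>R ?v s) has_vector_derivative
        1 *\<^sub>R (- christoffel_vec (G c) x (?v 1) (?v 1)) + 1 *\<^sub>R ?v 1) (at 1)"
      using geodesic_has_acceleration[OF g UNIV_I c d1] unfolding x1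
      by (intro has_vector_derivative_scaleR DERIV_ident)
    ultimately have "fderiv (polar_field h c) x (?v 1) =
        1 *\<^sub>R (- christoffel_vec (G c) x (?v 1) (?v 1)) + 1 *\<^sub>R ?v 1"
      by (rule vector_derivative_unique_at)
    moreover have "polar_field h c x = ?v 1" using Ev[of 1] d1 x1 by simp
    ultimately show "fderiv (polar_field h c) x (polar_field h c x)
      + christoffel_vec (G c) x (polar_field h c x) (polar_field h c x) = polar_field h c x" by simp
  qed
qed

context polar
begin

text \<open>
  The divergence of a gradient field. The value does not depend on the chart, see
  \<open>laplacian_potential_eq\<close>.
\<close>

definition laplacian_potential :: "'m \<Rightarrow> real" where
  "laplacian_potential q = (let c = (SOME c. c \<in> A \<and> q \<in> chart_dom c) in
     euler_field.div_E (G c) (polar_field h c) (chart_map c q))"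

lemma laplacian_potential_eq:
  assumes complete: "geodesically_complete A G" and c: "c \<in> A" "q \<in> chart_dom c"
  shows "laplacian_potential q = euler_field.div_E (G c) (polar_field h c) (chart_map c q)"
proof -
  define d where "d = (SOME c. c \<in> A \<and> q \<in> chart_dom c)"
  have d: "d \<in> A" "q \<in> chart_dom d"
    using someI_ex[of "\<lambda>c. c \<in> A \<and> q \<in> chart_dom c"] c unfolding d_def by blast+
  interpret c: euler_field "chart_img c" "G c" "polar_field h c" by (rule euler_field[OF c(1)])
  interpret d: euler_field "chart_img d" "G d" "polar_field h d" by (rule euler_field[OF d(1)])
  have "trace (covariant_derivative (G c) (polar_field h c) (chart_map c q)) =
      trace (covariant_derivative (G d) (polar_field h d) (chart_map d q))"
  proof (rule trace_transform)
    show "G c (chart_map c q) = transpose (jacobian c d (chart_map c q)) ** G d (chart_map d q) ** jacobian c d (chart_map c q)"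
      using metric_transform[OF c(1) d(1) overlap_in[OF c(2) d(2)]] by (simp add: transition_map[OF c])
    show "hessian (G c) (potential \<circ> chart_inv c) (chart_map c q) =
        transpose (jacobian c d (chart_map c q)) ** hessian (G d) (potential \<circ> chart_inv d) (chart_map d q) ** jacobian c d (chart_map c q)"
      by (rule hessian_transform[OF complete smooth_potential c d])
    show "G c (chart_map c q) ** covariant_derivative (G c) (polar_field h c) (chart_map c q) =
        hessian (G c) (potential \<circ> chart_inv c) (chart_map c q)"
      by (rule metric_covariant_derivative_polar_field[OF c(1) chart_map_in[OF c(2)]])
    show "G d (chart_map d q) ** covariant_derivative (G d) (polar_field h d) (chart_map d q) =
        hessian (G d) (potential \<circ> chart_inv d) (chart_map d q)"
      by (rule metric_covariant_derivative_polar_field[OF d(1) chart_map_in[OF d(2)]])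
    show "invertible (G c (chart_map c q))" by (rule c.invertible_g[OF chart_map_in[OF c(2)]])
  qed
  then show ?thesis
    by (simp add: laplacian_potential_def d_def[symmetric] c.div_E_def d.div_E_def)
qed

text \<open>
  The traced Riccati equation along a geodesic from the pole, where \<open>E = t v\<close>. The number \<open>q\<close> is
  \<open>tr(B\<^sup>2)\<close>.
\<close>

theorem laplacian_potential_along_ray:
  assumes complete: "geodesically_complete A G"
    and \<sigma>: "geodesic_on A G {0..} \<sigma>" and ray: "\<And>s. 0 \<le> s \<Longrightarrow> \<sigma> s = h (s *\<^sub>R y)"
    and t: "0 < t" and c: "c \<in> A" "\<sigma> t \<in> chart_dom c"
  defines "v \<equiv> velocity c {0..} \<sigma> t" and "x \<equiv> chart_map c (\<sigma> t)"
  shows "\<exists>q. ((\<lambda>s. laplacian_potential (\<sigma> s)) has_real_derivative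
       (laplacian_potential (\<sigma> t) - q - t\<^sup>2 * (v \<bullet> (ricci (G c) x *v v))) / t) (at t)
    \<and> (laplacian_potential (\<sigma> t))\<^sup>2 \<le> real CARD('n) * q"
proof -
  interpret euler_field "chart_img c" "G c" "polar_field h c" by (rule euler_field[OF c(1)])
  have x: "x \<in> chart_img c" unfolding x_def by (rule chart_map_in[OF c(2)])
  have tI: "t \<in> {0..}" using t by simp
  let ?B = "covariant_derivative (G c) (polar_field h c) x"
  have Ev: "polar_field h c x = t *\<^sub>R v"
    unfolding x_def v_def
    by (rule polar_field_along_ray[OF \<sigma> ray t tI at_within_atLeast_pos[OF t] c])
  obtain e where e: "e > 0" "\<And>s. s \<in> {0..} \<Longrightarrow> dist s t < e \<Longrightarrow> \<sigma> s \<in> chart_dom c"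
    by (rule geodesic_near[OF \<sigma> tI c]) (rule that)
  have m: "laplacian_potential (\<sigma> t) = div_E x"
    unfolding x_def by (rule laplacian_potential_eq[OF complete c])
  let ?D = "fderiv div_E x"
  have D: "(div_E has_derivative ?D) (at x)" by (rule smooth_on_has_derivative[OF smooth_div_E x])
  have lD: "linear ?D" by (rule has_derivative_linear[OF D])
  have "((\<lambda>s. div_E (chart_map c (\<sigma> s))) has_derivative (\<lambda>r. ?D (r *\<^sub>R v))) (at t within {0..})"
    using has_derivative_compose[OF geodesic_has_velocity[OF \<sigma> tI c, unfolded has_vector_derivative_def] D[unfolded x_def]]
    unfolding x_def v_def .
  then have "((\<lambda>s. div_E (chart_map c (\<sigma> s))) has_real_derivative ?D v) (at t within {0..})"
    unfolding has_field_derivative_def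
    by (rule has_derivative_eq_rhs) (simp add: fun_eq_iff linear_scale[OF lD] mult.commute)
  then have "((\<lambda>s. laplacian_potential (\<sigma> s)) has_real_derivative ?D v) (at t within {0..})"
    by (rule has_field_derivative_transform_within[OF _ e(1) tI])
      (rule laplacian_potential_eq[OF complete c(1) e(2), symmetric])
  then have d: "((\<lambda>s. laplacian_potential (\<sigma> s)) has_real_derivative ?D v) (at t)"
    unfolding at_within_atLeast_pos[OF t] .
  have "t * ?D v + trace (?B ** ?B) + t\<^sup>2 * (v \<bullet> (ricci (G c) x *v v)) = div_E x"
    using riccati_trace[OF x] unfolding Ev
    by (simp add: linear_scale[OF lD] matrix_vector_mult_scaleR power2_eq_square mult.assoc)
  then have "t * ?D v = laplacian_potential (\<sigma> t) - trace (?B ** ?B) - t\<^sup>2 * (v \<bullet> (ricci (G c) x *v v))"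
    unfolding m by linarith
  then have "?D v = (laplacian_potential (\<sigma> t) - trace (?B ** ?B) - t\<^sup>2 * (v \<bullet> (ricci (G c) x *v v))) / t"
    using t by (simp add: field_simps)
  note d' = d[unfolded this]
  have "(trace ?B)\<^sup>2 \<le> real CARD('n) * trace (?B ** ?B)"
  proof (rule trace_square_ge[OF sym_g[OF x] pos_g[OF x]])
    show "transpose (G c x ** ?B) = G c x ** ?B"
      unfolding metric_covariant_derivative_polar_field[OF c(1) x]
      by (rule hessian_sym[OF smooth_potential[OF c(1)] x])
  qed
  then have "(laplacian_potential (\<sigma> t))\<^sup>2 \<le> real CARD('n) * trace (?B ** ?B)"
    unfolding m div_E_def .
  with d' show ?thesis by blast
qed

end

section \<open>Gradient Ricci solitons with a pole\<close>

theorem theorem1p8: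
  fixes A :: "('m::{t2_space, second_countable_topology}, 'n::finite) chart set"
    and G :: "('m, 'n) metric"
    and f :: "'m \<Rightarrow> real" and lam a b :: real
    and p :: 'm and \<sigma> :: "real \<Rightarrow> 'm"
  assumes "riemannian_manifold A G"
    and "geodesically_complete A G"
    and "connected (UNIV :: 'm set)"
    and "orientable A"
    and "\<not> compact (UNIV :: 'm set)"
    and "gradient_ricci_soliton A G f lam"
    and "has_pole A G p"
    and "ricci_nonneg A G"
    and "geodesic_on A G {0..} \<sigma>" and "unit_speed_on A G {0..} \<sigma>" and "\<sigma> 0 = p"
    and "\<forall>t\<ge>0. f (\<sigma> t) \<le> a * t + b"
  shows "lam \<le> 0"
proof -
  note complete = \<open>geodesically_complete A G\<close> and \<sigma> = \<open>geodesic_on A G {0..} \<sigma>\<close>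
  interpret hausdorff_riemannian A G by standard (rule assms(1))
  obtain c0 where c0: "c0 \<in> A" "p \<in> chart_dom c0" and pole: "bij (exp_map A G c0 p)"
    "smooth_to_manifold A (exp_map A G c0 p)" "smooth_from_manifold A (inv (exp_map A G c0 p))"
    using \<open>has_pole A G p\<close> unfolding has_pole_def by blast
  define h where "h = exp_map A G c0 p"
  interpret polar A G h
    unfolding h_def by (rule exp_map_polar[OF complete c0 pole])
  define y where "y = velocity c0 {0..} \<sigma> 0"
  obtain \<gamma> where \<gamma>: "geodesic_from A G c0 p y \<gamma>"
    using complete c0 unfolding geodesically_complete_def by blast
  then have \<gamma>': "geodesic_on A G UNIV \<gamma>" "\<gamma> 0 = p" "velocity c0 UNIV \<gamma> 0 = y"
    by (simp_all add: geodesic_from_def)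
  have ray: "\<sigma> s = h (s *\<^sub>R y)" if s: "0 \<le> s" for s
  proof -
    have "\<sigma> s = \<gamma> s"
      by (rule geodesic_unique[OF \<sigma> geodesic_atLeast(1)[OF \<gamma>'(1)] c0(1) _ _ _ s])
        (use geodesic_atLeast(2)[OF \<gamma>'(1) c0(1), of 0] \<gamma>' c0 \<open>\<sigma> 0 = p\<close> in \<open>simp_all add: y_def\<close>)
    then show ?thesis unfolding h_def exp_map_ray[OF c0 \<gamma> s] .
  qed
  have fs: "smooth_on (chart_img c) (f \<circ> chart_inv c)" if "c \<in> A" for c
    using assms(6) that by (simp add: gradient_ricci_soliton_def smooth_from_manifold_def)
  define F1 where "F1 = (\<lambda>s. vector_derivative (\<lambda>s. f (\<sigma> s)) (at s within {0..}))"
  show ?thesis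
  proof (rule riccati_growth[of "real CARD('n)" "\<lambda>s. laplacian_potential (\<sigma> s)" F1 lam "\<lambda>s. f (\<sigma> s)" a b])
    show "0 < real CARD('n)" by simp
    show "f (\<sigma> t) \<le> a * t + b" if "0 < t" for t using assms(12) that by simp
    fix t :: real assume t: "0 < t"
    then have tI: "t \<in> {0..}" by simp
    have nb: "at s within {0..} \<noteq> bot" if "s \<in> {0..}" for s :: real
      using at_within_atLeast_nontrivial[of s] that by simp
    obtain c where c: "c \<in> A" "\<sigma> t \<in> chart_dom c" using chart_exists by blast
    define v where "v = velocity c {0..} \<sigma> t"
    define x where "x = chart_map c (\<sigma> t)"
    have x: "x \<in> chart_img c" unfolding x_def by (rule chart_map_in[OF c(2)])
    have "((\<lambda>s. f (\<sigma> s)) has_vector_derivative F1 t) (at t within {0..})"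
      using derivative_along_geodesic[OF \<sigma> tI c fs[OF c(1)]]
        vector_derivative_within[OF nb[OF tI] derivative_along_geodesic[OF \<sigma> tI c fs[OF c(1)]]]
      unfolding F1_def by simp
    then show "((\<lambda>s. f (\<sigma> s)) has_real_derivative F1 t) (at t)"
      by (simp add: at_within_atLeast_pos[OF t] has_real_derivative_iff_has_vector_derivative)
    define \<rho> where "\<rho> = v \<bullet> (ricci (G c) x *v v)"
    have \<rho>: "0 \<le> \<rho>" using \<open>ricci_nonneg A G\<close> c(1) x by (simp add: ricci_nonneg_def \<rho>_def)
    have sol: "hessian (G c) (f \<circ> chart_inv c) x + ricci (G c) x = lam *\<^sub>R G c x"
      using assms(6) c(1) x by (simp add: gradient_ricci_soliton_def)
    have "v \<bullet> (hessian (G c) (f \<circ> chart_inv c) x *v v) + \<rho> = v \<bullet> ((lam *\<^sub>R G c x) *v v)"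
      unfolding sol[symmetric] \<rho>_def by (simp add: matrix_vector_mult_add_rdistrib inner_add_right)
    also have "\<dots> = lam * (v \<bullet> (G c x *v v))"
      by (simp add: scaleR_matrix_vector_assoc[symmetric])
    also have "v \<bullet> (G c x *v v) = 1"
      using \<open>unit_speed_on A G {0..} \<sigma>\<close> c tI by (simp add: unit_speed_on_def v_def x_def)
    finally have hess: "v \<bullet> (hessian (G c) (f \<circ> chart_inv c) x *v v) = lam - \<rho>" by linarith
    have "(F1 has_real_derivative lam - \<rho>) (at t within {0..})"
      unfolding F1_def hess[symmetric] v_def x_def
      by (rule second_derivative_along_geodesic[OF \<sigma> tI nb c fs[OF c(1)]])
    then have F1: "(F1 has_real_derivative lam - \<rho>) (at t)" unfolding at_within_atLeast_pos[OF t] .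
    obtain q where "((\<lambda>s. laplacian_potential (\<sigma> s)) has_real_derivative
       (laplacian_potential (\<sigma> t) - q - t\<^sup>2 * \<rho>) / t) (at t)"
      "(laplacian_potential (\<sigma> t))\<^sup>2 \<le> real CARD('n) * q"
      using laplacian_potential_along_ray[OF complete \<sigma> ray t c]
      unfolding \<rho>_def v_def x_def by blast
    then show "\<exists>q \<rho>. ((\<lambda>s. laplacian_potential (\<sigma> s)) has_real_derivative
       (laplacian_potential (\<sigma> t) - q - t\<^sup>2 * \<rho>) / t) (at t) \<and>
       (laplacian_potential (\<sigma> t))\<^sup>2 \<le> real CARD('n) * q \<and> 0 \<le> \<rho> \<and> (F1 has_real_derivative lam - \<rho>) (at t)"
      using \<rho> F1 by blast
  qed
qed

end
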